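(* For each $r>0$, there exists a sequence of open discs $\{D_k\}_{k=1}^\infty$ in $\mathbb{C}$ such that $\sum_{k=1}^\infty r(D_k)<r$, the point $1$ is in the set $K=\overline{D}\setminus\bigcup_{k=1}^\infty D_k$, and the following conditions hold: (i) $R(K)$ is normal. (ii) $R(K)$ is strongly regular at every point of $K\setminus\{1\}$. (iii) $R(K)$ is not strongly regular at the point $1$. Furthermore, the discs $\{D_k\}_{k=1}^\infty$ can be chosen in such a way that, in addition to $\sum_{k=1}^\infty r(D_k)<r$, $1\in K$, and conditions (i), (ii) and (iii), one has $I_{\rho_1}\supsetneq I_{\rho_2}$ for all real numbers $0\le\rho_1<\rho_2$.
   Context: $D$ is the open unit disc in $\mathbb{C}$, $\overline{D}$ the closed unit disc, and $r(\Delta)$ denotes the radius of a disc $\Delta$. For $K\subset\mathbb{C}$ compact, $R(K)$ is the uniform closure in $C(K)$ (continuous complex-valued functions with supremum norm) of the rational functions with poles off $K$; it is a uniform algebra on $K$, i.e. a closed subalgebra of $C(K)$ containing the constants and separating points. A uniform algebra $A$ on a compact Hausdorff space $X$ is natural if its maximal ideal space is $X$ (identifying points with evaluation functionals); it is normal if it is natural and for each pair of disjoint closed sets $K_0,K_1\subset X$ there is $f\in A$ with $f=1$ on $K_1$ and $f=0$ on $K_0$. For $x\in X$, $M_x=\{f\in A: f(x)=0\}$ and $J_x=\{f\in A: f^{-1}(0)\text{ contains a neighborhood of }x\text{ in }X\}$; $A$ is strongly regular at $x$ if $\overline{J_x}=M_x$. For a compact set $K\subset\overline{D}$ with $1\in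 K$ and a real $\rho\ge0$, $I_\rho$ denotes the closed ideal in $R(K)$ generated by the function $z\mapsto (z-1)\exp\left[\rho\,\frac{z+1}{z-1}\right]$ (given the value $0$ at $z=1$; this function is continuous on $\overline D$ and holomorphic on $D$, so its restriction to $K$ belongs to $R(K)$). *)

theory Defs
  imports "HOL-Analysis.Analysis" "HOL-Computational_Algebra.Polynomial"
begin

text \<open>
  A function on \<open>X\<close> is represented by a total function in \<open>extensional X\<close> (so that functions
  agreeing on \<open>X\<close> are equal, and a functional on an algebra cannot see values off \<open>X\<close>).
  The algebra operations are the pointwise ones, restricted to \<open>X\<close>.
\<close>

definition cont_funs :: "'a::topological_space set \<Rightarrow> ('a \<Rightarrow> complex) set" where
  "cont_funs X = {f \<in> extensional X. continuous_on X f}"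

text \<open>Closure in the supremum norm of \<open>cont_funs X\<close>.\<close>

definition uniform_closure ::
    "'a::topological_space set \<Rightarrow> ('a \<Rightarrow> complex) set \<Rightarrow> ('a \<Rightarrow> complex) set" where
  "uniform_closure X F =
     {f \<in> cont_funs X. \<forall>\<epsilon>>0. \<exists>g\<in>F. \<forall>x\<in>X. cmod (f x - g x) < \<epsilon>}"

definition uniform_algebra :: "'a::t2_space set \<Rightarrow> ('a \<Rightarrow> complex) set \<Rightarrow> bool" where
  "uniform_algebra X A \<longleftrightarrow>
     compact X \<and> A \<subseteq> cont_funs X \<and> uniform_closure X A = A \<and>
     (\<forall>c. (\<lambda>x\<in>X. c) \<in> A) \<and>
     (\<forall>f\<in>A. \<forall>g\<in>A. (\<lambda>x\<in>X. f x + g x) \<in> A) \<and>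
     (\<forall>f\<in>A. \<forall>g\<in>A. (\<lambda>x\<in>X. f x * g x) \<in> A) \<and>
     (\<forall>x\<in>X. \<forall>y\<in>X. x \<noteq> y \<longrightarrow> (\<exists>f\<in>A. f x \<noteq> f y))"

text \<open>
  The maximal ideal space, as the set of nonzero multiplicative linear functionals on \<open>A\<close>.
  Its topology plays no role in naturality: for a uniform algebra on a compact space, the map
  sending a point to its evaluation functional is always a homeomorphism onto its image.
\<close>

definition maximal_ideal_space ::
    "'a set \<Rightarrow> ('a \<Rightarrow> complex) set \<Rightarrow> (('a \<Rightarrow> complex) \<Rightarrow> complex) set" where
  "maximal_ideal_space X A =
     {\<phi> \<in> extensional A.
        (\<forall>f\<in>A. \<forall>g\<in>A. \<phi> (\<lambda>x\<in>X. f x + g x) = \<phi> f + \<phi> g) \<and>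
        (\<forall>c. \<forall>f\<in>A. \<phi> (\<lambda>x\<in>X. c * f x) = c * \<phi> f) \<and>
        (\<forall>f\<in>A. \<forall>g\<in>A. \<phi> (\<lambda>x\<in>X. f x * g x) = \<phi> f * \<phi> g) \<and>
        (\<exists>f\<in>A. \<phi> f \<noteq> 0)}"

definition natural_algebra :: "'a::t2_space set \<Rightarrow> ('a \<Rightarrow> complex) set \<Rightarrow> bool" where
  "natural_algebra X A \<longleftrightarrow>
     uniform_algebra X A \<and> maximal_ideal_space X A = (\<lambda>x. \<lambda>f\<in>A. f x) ` X"

definition normal_algebra :: "'a::t2_space set \<Rightarrow> ('a \<Rightarrow> complex) set \<Rightarrow> bool" where
  "normal_algebra X A \<longleftrightarrow>
     natural_algebra X A \<and>
     (\<forall>K0 K1. closedin (top_of_set X) K0 \<and> closedin (top_of_set X) K1 \<and> K0 \<inter> K1 = {} \<longrightarrow>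
        (\<exists>f\<in>A. (\<forall>x\<in>K1. f x = 1) \<and> (\<forall>x\<in>K0. f x = 0)))"

definition ideal_M :: "('a \<Rightarrow> complex) set \<Rightarrow> 'a \<Rightarrow> ('a \<Rightarrow> complex) set" where
  "ideal_M A x = {f \<in> A. f x = 0}"

definition ideal_J ::
    "'a::topological_space set \<Rightarrow> ('a \<Rightarrow> complex) set \<Rightarrow> 'a \<Rightarrow> ('a \<Rightarrow> complex) set" where
  "ideal_J X A x =
     {f \<in> A. \<exists>U. openin (top_of_set X) U \<and> x \<in> U \<and> (\<forall>y\<in>U. f y = 0)}"

definition strongly_regular_at ::
    "'a::topological_space set \<Rightarrow> ('a \<Rightarrow> complex) set \<Rightarrow> 'a \<Rightarrow> bool" where
  "strongly_regular_at X A x \<longleftrightarrow> uniform_closure X (ideal_J X A x) = ideal_M A x"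

definition closed_ideal ::
    "'a::topological_space set \<Rightarrow> ('a \<Rightarrow> complex) set \<Rightarrow> ('a \<Rightarrow> complex) set \<Rightarrow> bool" where
  "closed_ideal X A I \<longleftrightarrow>
     I \<subseteq> A \<and> (\<lambda>x\<in>X. 0) \<in> I \<and>
     (\<forall>f\<in>I. \<forall>g\<in>I. (\<lambda>x\<in>X. f x + g x) \<in> I) \<and>
     (\<forall>f\<in>A. \<forall>g\<in>I. (\<lambda>x\<in>X. f x * g x) \<in> I) \<and>
     uniform_closure X I = I"

definition rational_funs :: "complex set \<Rightarrow> (complex \<Rightarrow> complex) set" where
  "rational_funs K = {(\<lambda>z\<in>K. poly p z / poly q z) | p q. \<forall>z\<in>K. poly q z \<noteq> 0}"

definition R_alg :: "complex set \<Rightarrow> (complex \<Rightarrow> complex) set" where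
  "R_alg K = uniform_closure K (rational_funs K)"

definition I_gen :: "complex set \<Rightarrow> real \<Rightarrow> complex \<Rightarrow> complex" where
  "I_gen K \<rho> =
     (\<lambda>z\<in>K. if z = 1 then 0
           else (z - 1) * exp (complex_of_real \<rho> * ((z + 1) / (z - 1))))"

definition I_ideal :: "complex set \<Rightarrow> real \<Rightarrow> (complex \<Rightarrow> complex) set" where
  "I_ideal K \<rho> = closed_ideal K (R_alg K) hull {I_gen K \<rho>}"

text \<open>The closed unit disc with the open discs of centres \<open>c k\<close> and radii \<open>s k\<close> removed.\<close>

definition swiss_cheese :: "(nat \<Rightarrow> complex) \<Rightarrow> (nat \<Rightarrow> real) \<Rightarrow> complex set" where
  "swiss_cheese c s = cball 0 1 - (\<Union>k. ball (c k) (s k))"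

lemma uniform_closureD:
  "f \<in> uniform_closure X F \<Longrightarrow> 0 < e \<Longrightarrow> \<exists>g\<in>F. \<forall>x\<in>X. cmod (f x - g x) < e"
  by (simp add: uniform_closure_def)

lemma uniform_closure_idem: "uniform_closure X (uniform_closure X F) = uniform_closure X F"
proof
  show "uniform_closure X (uniform_closure X F) \<subseteq> uniform_closure X F"
  proof
    fix f assume f: "f \<in> uniform_closure X (uniform_closure X F)"
    have "\<exists>g\<in>F. \<forall>x\<in>X. cmod (f x - g x) < e" if "e > 0" for e
    proof -
      have e2: "e / 2 > 0" using that by simp
      obtain h where h: "h \<in> uniform_closure X F" "\<And>x. x \<in> X \<Longrightarrow> cmod (f x - h x) < e / 2"
        using uniform_closureD[OF f e2] by blast
      obtain g where g: "g \<in> F" "\<And>x. x \<in> X \<Longrightarrow> cmod (h x - g x) < e / 2"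
        using uniform_closureD[OF h(1) e2] by blast
      have "cmod (f x - g x) < e" if "x \<in> X" for x
        using h(2)[OF that] g(2)[OF that] by (rule norm_diff_triangle_less [THEN less_le_trans]) simp
      then show ?thesis using g(1) by blast
    qed
    then show "f \<in> uniform_closure X F" using f by (auto simp: uniform_closure_def)
  qed
next
  show "uniform_closure X F \<subseteq> uniform_closure X (uniform_closure X F)"
  proof
    fix f assume f: "f \<in> uniform_closure X F"
    have "\<exists>g\<in>uniform_closure X F. \<forall>x\<in>X. cmod (f x - g x) < e" if "e > 0" for e
      using f that by (intro bexI[of _ f]) auto
    then show "f \<in> uniform_closure X (uniform_closure X F)"
      using f by (auto simp: uniform_closure_def)
  qed
qed

lemma uniform_closure_combine:
  assumes f: "f \<in> uniform_closure X F" and g: "g \<in> uniform_closure X F"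
    and X: "compact X" and F: "F \<subseteq> cont_funs X"
    and add: "\<And>f g. f \<in> F \<Longrightarrow> g \<in> F \<Longrightarrow> (\<lambda>x\<in>X. f x + g x) \<in> F"
    and mult: "\<And>f g. f \<in> F \<Longrightarrow> g \<in> F \<Longrightarrow> (\<lambda>x\<in>X. f x * g x) \<in> F"
  shows "(\<lambda>x\<in>X. f x + g x) \<in> uniform_closure X F" "(\<lambda>x\<in>X. f x * g x) \<in> uniform_closure X F"
proof -
  have cf: "continuous_on X f" and cg: "continuous_on X g"
    using f g by (auto simp: uniform_closure_def cont_funs_def)
  have c1: "(\<lambda>x\<in>X. f x + g x) \<in> cont_funs X" and c2: "(\<lambda>x\<in>X. f x * g x) \<in> cont_funs X"
    using continuous_on_add[OF cf cg] continuous_on_mult[OF cf cg]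
    by (auto simp: cont_funs_def restrict_extensional intro: continuous_on_eq)
  have seq: "\<exists>u. (\<forall>n. u n \<in> F) \<and> uniform_limit X u h sequentially"
    if "h \<in> uniform_closure X F" for h
  proof -
    have "\<forall>n. \<exists>k\<in>F. \<forall>x\<in>X. cmod (h x - k x) < 1 / real (Suc n)"
      using that by (auto simp: uniform_closure_def)
    then obtain u where u: "\<And>n. u n \<in> F" "\<And>n x. x \<in> X \<Longrightarrow> cmod (h x - u n x) < 1 / real (Suc n)"
      by metis
    have "uniform_limit X u h sequentially"
      unfolding uniform_limit_sequentially_iff
    proof (intro allI impI)
      fix e :: real assume "e > 0"
      then obtain N where N: "1 / real (Suc N) < e" using nat_approx_posE by blast
      have "dist (u n x) (h x) < e" if "n \<ge> N" "x \<in> X" for n x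
      proof -
        have "1 / real (Suc n) \<le> 1 / real (Suc N)" using that by (simp add: frac_le)
        then show ?thesis using u(2)[OF that(2), of n] N by (simp add: dist_norm norm_minus_commute)
      qed
      then show "\<exists>N. \<forall>n\<ge>N. \<forall>x\<in>X. dist (u n x) (h x) < e" by blast
    qed
    then show ?thesis using u(1) by blast
  qed
  have lim: "h \<in> uniform_closure X F"
    if h: "h \<in> cont_funs X" and u: "uniform_limit X u k sequentially"
      and uF: "\<And>n. (\<lambda>x\<in>X. u n x) \<in> F" and hk: "\<And>x. x \<in> X \<Longrightarrow> h x = k x" for h k u
  proof -
    have "\<exists>g\<in>F. \<forall>x\<in>X. cmod (h x - g x) < e" if e: "e > 0" for e
    proof -
      obtain n where n: "\<forall>x\<in>X. dist (u n x) (k x) < e"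
        using u e unfolding uniform_limit_sequentially_iff by blast
      have "\<forall>x\<in>X. cmod (h x - (\<lambda>x\<in>X. u n x) x) < e"
        using n hk by (simp add: dist_norm norm_minus_commute)
      then show ?thesis using uF by blast
    qed
    then show ?thesis using h by (auto simp: uniform_closure_def)
  qed
  obtain u v where u: "\<And>n. u n \<in> F" "uniform_limit X u f sequentially"
    and v: "\<And>n. v n \<in> F" "uniform_limit X v g sequentially"
    using seq[OF f] seq[OF g] by blast
  have "bounded (f ` X)" "bounded (g ` X)"
    using X cf cg by (auto intro: compact_imp_bounded compact_continuous_image)
  then have "uniform_limit X (\<lambda>n x. u n x * v n x) (\<lambda>x. f x * g x) sequentially"
    using u(2) v(2) by (intro uniform_lim_mult)
  then show "(\<lambda>x\<in>X. f x * g x) \<in> uniform_closure X F"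
    using c2 mult u(1) v(1) by (intro lim) auto
  have "uniform_limit X (\<lambda>n x. u n x + v n x) (\<lambda>x. f x + g x) sequentially"
    using u(2) v(2) by (intro uniform_limit_add)
  then show "(\<lambda>x\<in>X. f x + g x) \<in> uniform_closure X F"
    using c1 add u(1) v(1) by (intro lim) auto
qed

lemma rational_funs_cont: "rational_funs K \<subseteq> cont_funs K"
proof
  fix f assume "f \<in> rational_funs K"
  then obtain p q where f: "f = (\<lambda>z\<in>K. poly p z / poly q z)" "\<forall>z\<in>K. poly q z \<noteq> 0"
    by (auto simp: rational_funs_def)
  have "continuous_on K (\<lambda>z. poly p z / poly q z)"
    using f(2) by (intro continuous_intros) auto
  then show "f \<in> cont_funs K"
    unfolding cont_funs_def f(1) by (auto intro: continuous_on_eq)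
qed

lemma rational_funs_subset_R_alg: "rational_funs K \<subseteq> R_alg K"
proof
  fix f assume f: "f \<in> rational_funs K"
  have "\<exists>g\<in>rational_funs K. \<forall>x\<in>K. cmod (f x - g x) < e" if "e > 0" for e
    using f that by (intro bexI[of _ f]) auto
  then show "f \<in> R_alg K"
    using f rational_funs_cont by (auto simp: R_alg_def uniform_closure_def)
qed

lemma rational_funsI:
  assumes "\<forall>z\<in>K. poly q z \<noteq> 0" "\<And>z. z \<in> K \<Longrightarrow> f z = poly p z / poly q z"
  shows "(\<lambda>z\<in>K. f z) \<in> rational_funs K"
proof -
  have "(\<lambda>z\<in>K. f z) = (\<lambda>z\<in>K. poly p z / poly q z)"
    using assms(2) by (auto intro: restrict_ext)
  then show ?thesis using assms(1) unfolding rational_funs_def by blast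
qed

lemma rational_funs_ops:
  assumes "f \<in> rational_funs K" "g \<in> rational_funs K"
  shows "(\<lambda>z\<in>K. f z + g z) \<in> rational_funs K" "(\<lambda>z\<in>K. f z * g z) \<in> rational_funs K"
proof -
  obtain p q where f: "f = (\<lambda>z\<in>K. poly p z / poly q z)" "\<forall>z\<in>K. poly q z \<noteq> 0"
    using assms(1) by (auto simp: rational_funs_def)
  obtain p' q' where g: "g = (\<lambda>z\<in>K. poly p' z / poly q' z)" "\<forall>z\<in>K. poly q' z \<noteq> 0"
    using assms(2) by (auto simp: rational_funs_def)
  show "(\<lambda>z\<in>K. f z + g z) \<in> rational_funs K"
    using f g by (intro rational_funsI[where p = "p * q' + p' * q" and q = "q * q'"])
      (auto simp: field_simps)
  show "(\<lambda>z\<in>K. f z * g z) \<in> rational_funs K"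
    using f g by (intro rational_funsI[where p = "p * p'" and q = "q * q'"]) auto
qed

lemma uniform_algebra_R_alg:
  assumes "compact K"
  shows "uniform_algebra K (R_alg K)"
proof -
  have const: "(\<lambda>z\<in>K. c) \<in> R_alg K" for c
    using rational_funsI[of K "[:1:]" "\<lambda>_. c" "[:c:]"] rational_funs_subset_R_alg by auto
  have ident: "(\<lambda>z\<in>K. z) \<in> R_alg K"
    using rational_funsI[of K "[:1:]" "\<lambda>z. z" "[:0, 1:]"] rational_funs_subset_R_alg by auto
  have sep: "\<exists>f\<in>R_alg K. f x \<noteq> f y" if "x \<in> K" "y \<in> K" "x \<noteq> y" for x y
    using ident that by (intro bexI[of _ "\<lambda>z\<in>K. z"]) auto
  have ops: "(\<lambda>x\<in>K. f x + g x) \<in> R_alg K" "(\<lambda>x\<in>K. f x * g x) \<in> R_alg K"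
    if "f \<in> R_alg K" "g \<in> R_alg K" for f g
    using uniform_closure_combine[OF _ _ assms rational_funs_cont rational_funs_ops, of f g] that
    unfolding R_alg_def by blast+
  have sub: "R_alg K \<subseteq> cont_funs K" by (auto simp: R_alg_def uniform_closure_def)
  have cl: "uniform_closure K (R_alg K) = R_alg K"
    unfolding R_alg_def by (rule uniform_closure_idem)
  show ?thesis unfolding uniform_algebra_def
    by (intro conjI ballI allI impI) (rule assms sub cl const ops sep; assumption)+
qed

end

theory Submission imports Defs
begin

text \<open>
  \<^bold>\<open>Units.\<close> As in McKissick's and Koerner's constructions, removing discs of small total radius near a
  circle makes available a function in \<open>R(K)\<close> that is \<open>1\<close> on \<open>ball a R\<close> and \<open>0\<close> off
  \<open>ball a (2 * R)\<close>. Countably many of these give normality.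

  \<^bold>\<open>Strong regularity at\<close> \<open>x \<noteq> 1\<close>. It suffices to approximate \<open>z - x\<close> by functions that vanish
  near \<open>x\<close>. A logarithmic cutoff equals \<open>- w\<close> near \<open>0\<close> and has a uniformly small derivative with
  respect to \<open>cnj w\<close>, of which it is the Cauchy transform. Replacing the Cauchy integral by a Riemann
  sum over a fine grid, with tiny discs removed around the grid points, gives a uniformly small
  rational function that almost equals \<open>- (z - x)\<close> near \<open>x\<close>; adding it to \<open>z - x\<close> and multiplying
  by a factor \<open>1 - u\<close> with a unit \<open>u\<close> yields exact vanishing.

  \<^bold>\<open>The ideals.\<close> The removed discs are so small near \<open>1\<close> that their radii remain summable with
  the weights \<open>exp (m / dist)\<close> for all \<open>m\<close>. In the coordinate \<open>w = (1 + z) / (1 - z)\<close> a Cauchy--Pompeiu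
  argument then shows that \<open>exp (- \<rho>1 * w)\<close> is not approximable by multiples of \<open>exp (- \<rho>2 * w)\<close>, whence
  \<open>I_ideal K \<rho>2\<close> is strictly smaller than \<open>I_ideal K \<rho>1\<close>. Functions vanishing near \<open>1\<close> lie in every
  \<open>I_ideal K \<rho>\<close>, since there \<open>I_gen K \<rho>\<close> may be divided by; so \<open>R(K)\<close> is not strongly regular at \<open>1\<close>.
\<close>

section \<open>The algebra of rational approximation\<close>

text \<open>The difficulty: discs must be removed near every point, also near 1, yet so little may
  be removed near 1 that the exponentials remain distinguishable. Hence each family of discs keeps a
  positive distance from 1, and its total radius is chosen only after that distance. For units this
  is possible because the poles lie in an annulus \<open>R < cmod (z - a) < 2 * R\<close>, and the
  parameters are restricted to those for which 1 lies strictly inside the small disc or strictly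
  outside the large one. For strong regularity at \<open>x\<close> only poles near \<open>x\<close>
  are used.

  Countably many stages must serve uncountably many points \<open>x\<close>. So one stage treats all
  \<open>x\<close> with \<open>cmod (x - 1) \<ge> d\<close> at once: a single function with poles on
  a grid is moved to the grid point next to \<open>x\<close>, and its poles fall on the same grid
  again.

  The units are bounded, but by constants beyond control. This dictates the order of choices at each
  stage: first the radius \<open>s\<close> on which the rational function will be tiny, then
  finitely many units with supports small against \<open>s\<close>, and only then the tolerance
  \<open>\<tau>\<close>, small against the bounds of these units.\<close>

lemma uniform_closureI:
  assumes "f \<in> extensional X" "F \<subseteq> cont_funs X"
    and "\<And>e. e > 0 \<Longrightarrow> \<exists>g\<in>F. \<forall>x\<in>X. cmod (f x - g x) < e"
  shows "f \<in> uniform_closure X F"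
proof -
  have "\<forall>n. \<exists>g\<in>F. \<forall>x\<in>X. cmod (f x - g x) < 1 / real (Suc n)"
    using assms(3) by simp
  then obtain u where u: "\<And>n. u n \<in> F" "\<And>n x. x \<in> X \<Longrightarrow> cmod (f x - u n x) < 1 / real (Suc n)"
    by metis
  have lim: "uniform_limit X u f sequentially"
    unfolding uniform_limit_sequentially_iff
  proof (intro allI impI)
    fix e :: real assume "e > 0"
    then obtain N where N: "1 / real (Suc N) < e" using nat_approx_posE by blast
    have "dist (u n x) (f x) < e" if "n \<ge> N" "x \<in> X" for n x
    proof -
      have "1 / real (Suc n) \<le> 1 / real (Suc N)" using that by (simp add: frac_le)
      then show ?thesis using u(2)[OF that(2), of n] N by (simp add: dist_norm norm_minus_commute)
    qed
    then show "\<exists>N. \<forall>n\<ge>N. \<forall>x\<in>X. dist (u n x) (f x) < e" by blast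
  qed
  have "\<forall>\<^sub>F n in sequentially. continuous_on X (u n)"
    using u(1) assms(2) by (intro always_eventually allI) (auto simp: cont_funs_def subset_iff)
  then have "continuous_on X f"
    by (rule uniform_limit_theorem[OF _ lim]) auto
  then show ?thesis using assms by (auto simp: uniform_closure_def cont_funs_def)
qed

lemma uniform_closure_subset: "F \<subseteq> cont_funs X \<Longrightarrow> F \<subseteq> uniform_closure X F"
  unfolding uniform_closure_def by (auto intro!: bexI)

lemma uniform_closure_mono: "F \<subseteq> G \<Longrightarrow> uniform_closure X F \<subseteq> uniform_closure X G"
  unfolding uniform_closure_def by blast

text \<open>Allows total functions and plain pointwise operations, with no \<open>restrict\<close>
  around every sum and product.\<close>

definition in_R :: "complex set \<Rightarrow> (complex \<Rightarrow> complex) \<Rightarrow> bool" where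
  "in_R K h \<longleftrightarrow> restrict h K \<in> R_alg K"

lemma R_alg_extensional: "f \<in> R_alg K \<Longrightarrow> f \<in> extensional K"
  by (auto simp: R_alg_def uniform_closure_def cont_funs_def)

lemma R_alg_cont_funs: "R_alg K \<subseteq> cont_funs K"
  by (auto simp: R_alg_def uniform_closure_def)

lemma R_alg_in_R: "f \<in> R_alg K \<Longrightarrow> in_R K f"
  by (simp add: in_R_def R_alg_extensional extensional_restrict)

lemma in_R_cong: "in_R K f \<Longrightarrow> (\<And>z. z \<in> K \<Longrightarrow> f z = g z) \<Longrightarrow> in_R K g"
  unfolding in_R_def by (metis restrict_ext)

lemma in_R_continuous: "in_R K f \<Longrightarrow> continuous_on K f"
  unfolding in_R_def R_alg_def uniform_closure_def cont_funs_def
  by (auto cong: continuous_on_cong)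

lemma in_R_bounded:
  assumes "compact K" "in_R K f"
  shows "\<exists>M>0. \<forall>z\<in>K. cmod (f z) \<le> M"
  using compact_continuous_image[OF in_R_continuous[OF assms(2)] assms(1)]
  by (metis bounded_pos compact_imp_bounded image_eqI)

lemma in_R_limit:
  assumes "\<And>e. e > 0 \<Longrightarrow> \<exists>g. in_R K g \<and> (\<forall>z\<in>K. cmod (f z - g z) < e)"
  shows "in_R K f"
proof -
  have "restrict f K \<in> uniform_closure K (R_alg K)"
  proof (rule uniform_closureI)
    fix e :: real assume "e > 0"
    then obtain g where "in_R K g" "\<forall>z\<in>K. cmod (f z - g z) < e" using assms by blast
    then show "\<exists>g\<in>R_alg K. \<forall>x\<in>K. cmod (restrict f K x - g x) < e"
      by (intro bexI[of _ "restrict g K"]) (auto simp: in_R_def)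
  qed (use R_alg_cont_funs in auto)
  then show ?thesis by (simp add: in_R_def R_alg_def uniform_closure_idem)
qed

lemma in_R_const: "compact K \<Longrightarrow> in_R K (\<lambda>z. c)"
  using uniform_algebra_R_alg[of K] unfolding in_R_def uniform_algebra_def by blast

lemma in_R_add: "compact K \<Longrightarrow> in_R K f \<Longrightarrow> in_R K g \<Longrightarrow> in_R K (\<lambda>z. f z + g z)"
proof -
  assume *: "compact K" "in_R K f" "in_R K g"
  then have "(\<lambda>z\<in>K. restrict f K z + restrict g K z) \<in> R_alg K"
    using uniform_algebra_R_alg[of K] unfolding in_R_def uniform_algebra_def by blast
  then show ?thesis unfolding in_R_def by (auto elim!: back_subst[of "\<lambda>f. f \<in> R_alg K"])
qed

lemma in_R_mult: "compact K \<Longrightarrow> in_R K f \<Longrightarrow> in_R K g \<Longrightarrow> in_R K (\<lambda>z. f z * g z)"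
proof -
  assume *: "compact K" "in_R K f" "in_R K g"
  then have "(\<lambda>z\<in>K. restrict f K z * restrict g K z) \<in> R_alg K"
    using uniform_algebra_R_alg[of K] unfolding in_R_def uniform_algebra_def by blast
  then show ?thesis unfolding in_R_def by (auto elim!: back_subst[of "\<lambda>f. f \<in> R_alg K"])
qed

lemma in_R_rational:
  assumes "\<And>z. z \<in> K \<Longrightarrow> poly q z \<noteq> 0"
  shows "in_R K (\<lambda>z. poly p z / poly q z)"
  using rational_funsI[of K q "\<lambda>z. poly p z / poly q z" p] assms rational_funs_subset_R_alg[of K]
  unfolding in_R_def by blast

lemma in_R_poly: "in_R K (poly p)"
  using in_R_rational[of K 1 p] by simp

lemma in_R_id: "in_R K (\<lambda>z. z)"
  by (rule in_R_cong[OF in_R_poly[of K "[:0,1:]"]]) simp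

lemma in_R_minus: "compact K \<Longrightarrow> in_R K f \<Longrightarrow> in_R K (\<lambda>z. - f z)"
  using in_R_mult[OF _ in_R_const, of K f "-1"] by simp

lemma in_R_diff: "compact K \<Longrightarrow> in_R K f \<Longrightarrow> in_R K g \<Longrightarrow> in_R K (\<lambda>z. f z - g z)"
  using in_R_add[OF _ _ in_R_minus, of K f g] by simp

lemma in_R_power: "compact K \<Longrightarrow> in_R K f \<Longrightarrow> in_R K (\<lambda>z. f z ^ n)"
  by (induction n) (auto intro: in_R_const in_R_mult)

lemma in_R_sum: "compact K \<Longrightarrow> (\<And>i. i \<in> I \<Longrightarrow> in_R K (f i)) \<Longrightarrow> in_R K (\<lambda>z. \<Sum>i\<in>I. f i z)"
  by (induction I rule: infinite_finite_induct) (auto intro: in_R_const in_R_add)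

lemma in_R_prod: "compact K \<Longrightarrow> (\<And>i. i \<in> I \<Longrightarrow> in_R K (f i)) \<Longrightarrow> in_R K (\<lambda>z. \<Prod>i\<in>I. f i z)"
  by (induction I rule: infinite_finite_induct) (auto intro: in_R_const in_R_mult)

lemma in_R_approx_rational:
  assumes "in_R K f" "e > 0"
  obtains p q where "\<And>z. z \<in> K \<Longrightarrow> poly q z \<noteq> 0"
    "\<And>z. z \<in> K \<Longrightarrow> cmod (f z - poly p z / poly q z) < e"
proof -
  have "restrict f K \<in> uniform_closure K (rational_funs K)"
    using assms(1) by (simp add: in_R_def R_alg_def)
  then obtain g where "g \<in> rational_funs K" "\<forall>x\<in>K. cmod (restrict f K x - g x) < e"
    using uniform_closureD assms(2) by blast
  then obtain p q where "g = (\<lambda>z\<in>K. poly p z / poly q z)" "\<forall>z\<in>K. poly q z \<noteq> 0"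
    "\<forall>x\<in>K. cmod (restrict f K x - g x) < e"
    unfolding rational_funs_def by blast
  then show ?thesis by (intro that[of q p]) auto
qed

text \<open>On the compact set \<open>f\<close> is bounded away from 0, hence so is every rational
  function \<open>p / q\<close> close to \<open>f\<close>. Then \<open>q / p\<close> has its poles
  off \<open>K\<close> and approximates \<open>1 / f\<close>.\<close>

lemma in_R_inverse:
  assumes K: "compact K" and f: "in_R K f" and nz: "\<And>z. z \<in> K \<Longrightarrow> f z \<noteq> 0"
  shows "in_R K (\<lambda>z. 1 / f z)"
proof -
  have "continuous_on K (\<lambda>z. 1 / f z)"
    using in_R_continuous[OF f] nz by (intro continuous_intros) auto
  then obtain M where M: "M > 0" "\<And>z. z \<in> K \<Longrightarrow> cmod (1 / f z) \<le> M"
    using compact_continuous_image[OF _ K] by (metis bounded_pos compact_imp_bounded image_eqI)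
  have lb: "cmod (f z) \<ge> 1 / M" if "z \<in> K" for z
    using M(2)[OF that] M(1) nz[OF that] by (simp add: norm_divide field_simps)
  show ?thesis
  proof (rule in_R_limit)
    fix e :: real assume e: "e > 0"
    \<comment> \<open>The first bound keeps \<open>p / q\<close> at modulus at least
      \<open>1 / (2 * M)\<close>. The second pays for the factors \<open>M\<close> and
      \<open>2 * M\<close> that bound the two reciprocals.\<close>
    define d where "d = min (1 / (2 * M)) (e / (2 * M\<^sup>2))"
    have d: "d > 0" using M e by (simp add: d_def)
    obtain p q where q: "\<And>z. z \<in> K \<Longrightarrow> poly q z \<noteq> 0"
      and pq: "\<And>z. z \<in> K \<Longrightarrow> cmod (f z - poly p z / poly q z) < d"
      by (rule in_R_approx_rational[OF f d]) blast
    have g: "cmod (poly p z / poly q z) \<ge> 1 / (2 * M)" if "z \<in> K" for z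
    proof -
      have "cmod (f z) - cmod (poly p z / poly q z) \<le> cmod (f z - poly p z / poly q z)"
        by (rule norm_triangle_ineq2)
      also have "\<dots> < 1 / (2 * M)" using pq[OF that] by (simp add: d_def)
      finally show ?thesis using lb[OF that] M(1) by (simp add: field_simps)
    qed
    have p: "poly p z \<noteq> 0" if "z \<in> K" for z
    proof
      assume "poly p z = 0"
      then show False using g[OF that] M(1) by simp
    qed
    have "cmod (1 / f z - poly q z / poly p z) < e" if z: "z \<in> K" for z
    proof -
      have "1 / f z - poly q z / poly p z
          = - (f z - poly p z / poly q z) * (1 / f z) * (1 / (poly p z / poly q z))"
        using nz[OF z] p[OF z] q[OF z] by (simp add: field_simps)
      then have "cmod (1 / f z - poly q z / poly p z)
          = cmod (f z - poly p z / poly q z) * cmod (1 / f z) * (1 / cmod (poly p z / poly q z))"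
        by (simp add: norm_mult norm_divide norm_minus_commute)
      also have "\<dots> \<le> cmod (f z - poly p z / poly q z) * M * (2 * M)"
      proof -
        have "1 / cmod (poly p z / poly q z) \<le> 1 / (1 / (2 * M))"
          by (rule frac_le) (use g[OF z] M in auto)
        then have "1 / cmod (poly p z / poly q z) \<le> 2 * M" by simp
        then show ?thesis
          using M(2)[OF z] M(1) by (intro mult_mono) auto
      qed
      also have "\<dots> < d * M * (2 * M)"
        using pq[OF z] M(1) by (intro mult_strict_right_mono) auto
      also have "\<dots> \<le> (e / (2 * M\<^sup>2)) * M * (2 * M)"
        using M(1) by (intro mult_right_mono) (auto simp: d_def)
      also have "\<dots> = e" using M(1) by (simp add: power2_eq_square)
      finally show ?thesis .
    qed
    then show "\<exists>g. in_R K g \<and> (\<forall>z\<in>K. cmod (1 / f z - g z) < e)"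
      using in_R_rational[of K p q] p by blast
  qed
qed

lemma in_R_pole: "compact K \<Longrightarrow> a \<notin> K \<Longrightarrow> in_R K (\<lambda>z. 1 / (z - a))"
  by (rule in_R_inverse) (auto intro: in_R_diff in_R_id in_R_const)

text \<open>A character is evaluation at its value \<open>a\<close> on the identity function. The
  point \<open>a\<close> lies in \<open>K\<close> because functions without zeros on
  \<open>K\<close> are invertible; evaluation at \<open>a\<close> is then forced on polynomials, on
  rational functions, and on their uniform limits.\<close>

lemma natural_R_alg:
  assumes K: "compact K"
  shows "natural_algebra K (R_alg K)"
proof -
  have "\<phi> \<in> (\<lambda>x. \<lambda>f\<in>R_alg K. f x) ` K" if \<phi>: "\<phi> \<in> maximal_ideal_space K (R_alg K)" for \<phi>
  proof -
    define \<psi> where "\<psi> h = \<phi> (restrict h K)" for h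
    have ext: "\<phi> \<in> extensional (R_alg K)"
      using \<phi> by (simp add: maximal_ideal_space_def)
    have cong: "\<psi> f = \<psi> g" if "\<And>z. z \<in> K \<Longrightarrow> f z = g z" for f g
      unfolding \<psi>_def using that by (metis restrict_ext)
    have add: "\<psi> (\<lambda>z. f z + g z) = \<psi> f + \<psi> g" if "in_R K f" "in_R K g" for f g
    proof -
      have "\<psi> (\<lambda>z. restrict f K z + restrict g K z) = \<psi> f + \<psi> g"
        using \<phi> that unfolding maximal_ideal_space_def \<psi>_def in_R_def by blast
      then show ?thesis using cong[of "\<lambda>z. restrict f K z + restrict g K z" "\<lambda>z. f z + g z"] by auto
    qed
    have mult: "\<psi> (\<lambda>z. f z * g z) = \<psi> f * \<psi> g" if "in_R K f" "in_R K g" for f g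
    proof -
      have "\<psi> (\<lambda>z. restrict f K z * restrict g K z) = \<psi> f * \<psi> g"
        using \<phi> that unfolding maximal_ideal_space_def \<psi>_def in_R_def by blast
      then show ?thesis using cong[of "\<lambda>z. restrict f K z * restrict g K z" "\<lambda>z. f z * g z"] by auto
    qed
    obtain f0 where f0: "f0 \<in> R_alg K" "\<phi> f0 \<noteq> 0"
      using \<phi> by (auto simp: maximal_ideal_space_def)
    have "\<psi> f0 = \<psi> (\<lambda>z. 1 * f0 z)" by simp
    also have "\<dots> = \<psi> (\<lambda>z. 1) * \<psi> f0"
      by (rule mult) (use f0 in \<open>auto intro: in_R_const K R_alg_in_R\<close>)
    finally have one: "\<psi> (\<lambda>z. 1) = 1"
      using f0 by (auto simp: \<psi>_def R_alg_extensional extensional_restrict)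
    have const: "\<psi> (\<lambda>z. c) = c" for c
    proof -
      have "\<phi> (\<lambda>z\<in>K. c * restrict (\<lambda>z. 1) K z) = c * \<phi> (restrict (\<lambda>z. 1) K)"
        using \<phi> in_R_const[OF K, of 1] unfolding maximal_ideal_space_def in_R_def by blast
      then have "\<psi> (\<lambda>z. c * restrict (\<lambda>z. 1) K z) = c" using one by (simp add: \<psi>_def)
      then show ?thesis using cong[of "\<lambda>z. c * restrict (\<lambda>z. 1) K z" "\<lambda>z. c"] by auto
    qed
    \<comment> \<open>Otherwise \<open>f - \<psi> f\<close> would be invertible by
      \<open>in_R_inverse\<close>, although \<open>\<psi>\<close> sends it to 0.\<close>
    have van: "\<exists>z\<in>K. f z = \<psi> f" if f: "in_R K f" for f
    proof (rule ccontr)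
      assume "\<not> (\<exists>z\<in>K. f z = \<psi> f)"
      then have nz: "\<And>z. z \<in> K \<Longrightarrow> f z + - \<psi> f \<noteq> 0" by auto
      have f': "in_R K (\<lambda>z. f z + - \<psi> f)" by (intro in_R_add K f in_R_const)
      have "\<psi> (\<lambda>z. (f z + - \<psi> f) * (1 / (f z + - \<psi> f))) = \<psi> (\<lambda>z. 1)"
        by (rule cong) (use nz in auto)
      moreover have "\<psi> (\<lambda>z. (f z + - \<psi> f) * (1 / (f z + - \<psi> f)))
          = \<psi> (\<lambda>z. f z + - \<psi> f) * \<psi> (\<lambda>z. 1 / (f z + - \<psi> f))"
        by (intro mult f' in_R_inverse K nz)
      moreover have "\<psi> (\<lambda>z. f z + - \<psi> f) = 0"
        using add[OF f in_R_const[OF K], of "- \<psi> f"] const by simp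
      ultimately show False using one by simp
    qed
    obtain a where a: "a \<in> K" "\<psi> (\<lambda>z. z) = a" using van[OF in_R_id] by auto
    have poly: "\<psi> (poly p) = poly p a" for p
    proof (induction p)
      case 0 then show ?case using const[of 0] by simp
    next
      case (pCons c p)
      have "\<psi> (\<lambda>z. c + z * poly p z) = \<psi> (\<lambda>z. c) + \<psi> (\<lambda>z. z * poly p z)"
        by (intro add in_R_const in_R_mult in_R_id in_R_poly K)
      also have "\<psi> (\<lambda>z. z * poly p z) = \<psi> (\<lambda>z. z) * \<psi> (poly p)"
        by (intro mult in_R_id in_R_poly)
      finally have "\<psi> (\<lambda>z. c + z * poly p z) = poly (pCons c p) a"
        using pCons.IH a const by simp
      then show ?case using cong[of "poly (pCons c p)" "\<lambda>z. c + z * poly p z"] by simp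
    qed
    have rat: "\<psi> (\<lambda>z. poly p z / poly q z) = poly p a / poly q a"
      if "\<And>z. z \<in> K \<Longrightarrow> poly q z \<noteq> 0" for p q
    proof -
      have "\<psi> (\<lambda>z. poly q z * (poly p z / poly q z)) = \<psi> (poly p)"
        by (rule cong) (use that in auto)
      moreover have "\<psi> (\<lambda>z. poly q z * (poly p z / poly q z))
           = \<psi> (poly q) * \<psi> (\<lambda>z. poly p z / poly q z)"
        by (intro mult in_R_poly in_R_rational that)
      ultimately show ?thesis using poly that[OF a(1)] by (simp add: field_simps)
    qed
    \<comment> \<open>Continuity of \<open>\<psi>\<close> is automatic: by \<open>van\<close> the
      value of \<open>\<psi>\<close> at \<open>f - r\<close> is attained by \<open>f - r\<close> on
      \<open>K\<close>, where this function is small.\<close>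
    have ev: "\<psi> f = f a" if f: "in_R K f" for f
    proof (rule ccontr)
      assume ne: "\<psi> f \<noteq> f a"
      define e where "e = cmod (\<psi> f - f a) / 2"
      have e: "e > 0" using ne by (simp add: e_def)
      obtain p q where q: "\<And>z. z \<in> K \<Longrightarrow> poly q z \<noteq> 0"
        and pq: "\<And>z. z \<in> K \<Longrightarrow> cmod (f z - poly p z / poly q z) < e"
        by (rule in_R_approx_rational[OF f e]) blast
      let ?r = "\<lambda>z. poly p z / poly q z"
      have r: "in_R K ?r" by (intro in_R_rational q)
      obtain b where b: "b \<in> K" "f b + - ?r b = \<psi> (\<lambda>z. f z + - ?r z)"
        using van[of "\<lambda>z. f z + - ?r z"] in_R_add[OF K f in_R_minus[OF K r]] by auto
      have "\<psi> (\<lambda>z. - ?r z) = \<psi> (\<lambda>z. (-1) * ?r z)"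
        by (rule cong) simp
      also have "\<dots> = \<psi> (\<lambda>z. -1) * \<psi> ?r"
        by (rule mult[OF in_R_const[OF K] r])
      also have "\<dots> = - ?r a"
        using const[of "-1"] rat[of q p] q by simp
      finally have neg: "\<psi> (\<lambda>z. - ?r z) = - ?r a" .
      have "f b - ?r b = \<psi> f - ?r a"
        using b(2) unfolding add[OF f in_R_minus[OF K r]] neg by (simp only: diff_conv_add_uminus)
      then have "\<psi> f - f a = (f b - ?r b) - (f a - ?r a)" by simp
      then have "cmod (\<psi> f - f a) \<le> cmod (f b - ?r b) + cmod (f a - ?r a)"
        by (metis norm_triangle_ineq4)
      also have "\<dots> < 2 * e" using pq[OF b(1)] pq[OF a(1)] by simp
      finally show False by (simp add: e_def)
    qed
    have "\<phi> = (\<lambda>f\<in>R_alg K. f a)"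
    proof (rule extensionalityI[OF ext])
      fix f assume "f \<in> R_alg K"
      then show "\<phi> f = (\<lambda>f\<in>R_alg K. f a) f"
        using ev[OF R_alg_in_R] by (simp add: \<psi>_def R_alg_extensional extensional_restrict)
    qed auto
    then show ?thesis using a(1) by blast
  qed
  moreover have "(\<lambda>f\<in>R_alg K. f x) \<in> maximal_ideal_space K (R_alg K)" if x: "x \<in> K" for x
  proof -
    have ops: "(\<lambda>x\<in>K. f x + g x) \<in> R_alg K" "(\<lambda>x\<in>K. f x * g x) \<in> R_alg K" "(\<lambda>x\<in>K. c) \<in> R_alg K"
      if "f \<in> R_alg K" "g \<in> R_alg K" for f g c
      using uniform_algebra_R_alg[OF K] that unfolding uniform_algebra_def by blast+
    have sc: "(\<lambda>x\<in>K. c * f x) \<in> R_alg K" if "f \<in> R_alg K" for f c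
      using in_R_mult[OF K in_R_const[OF K, of c] R_alg_in_R[OF that]] by (simp add: in_R_def)
    have "\<exists>f\<in>R_alg K. (\<lambda>f\<in>R_alg K. f x) f \<noteq> 0"
      using in_R_const[OF K, of 1] x unfolding in_R_def
      by (intro bexI[of _ "\<lambda>z\<in>K. 1"]) auto
    then show ?thesis unfolding maximal_ideal_space_def using ops sc x by auto
  qed
  ultimately show ?thesis
    unfolding natural_algebra_def using uniform_algebra_R_alg[OF K] by blast
qed

section \<open>The derivative with respect to the conjugate variable\<close>

text \<open>The numbers \<open>a\<close> and \<open>b\<close> are the Wirtinger derivatives with
  respect to \<open>z\<close> and \<open>cnj z\<close>; every real-linear map of the plane has this
  form.\<close>

definition wd :: "(complex \<Rightarrow> complex) \<Rightarrow> complex \<Rightarrow> complex \<Rightarrow> complex \<Rightarrow> bool" where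
  "wd f a b z \<longleftrightarrow> (f has_derivative (\<lambda>v. a * v + b * cnj v)) (at z)"

lemma wd_field: "(f has_field_derivative d) (at z) \<Longrightarrow> wd f d 0 z"
  by (simp add: wd_def has_field_derivative_def)

lemma wd_const: "wd (\<lambda>z. c) 0 0 z"
  by (simp add: wd_def)

lemma wd_cnj: "wd cnj 0 1 z"
  by (simp add: wd_def bounded_linear_imp_has_derivative bounded_linear_cnj)

lemma wd_add:
  assumes "wd f a b z" "wd g a' b' z"
  shows "wd (\<lambda>z. f z + g z) (a + a') (b + b') z"
  using has_derivative_add[OF assms[unfolded wd_def]] by (simp add: wd_def algebra_simps)

lemma wd_mult:
  assumes "wd f a b z" "wd g a' b' z"
  shows "wd (\<lambda>z. f z * g z) (f z * a' + a * g z) (f z * b' + b * g z) z"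
  using has_derivative_mult[OF assms[unfolded wd_def]] by (simp add: wd_def algebra_simps)

lemma wd_unique:
  assumes "wd f a b z" "wd f a' b' z"
  shows "a = a' \<and> b = b'"
proof -
  have "(\<lambda>v. a * v + b * cnj v) = (\<lambda>v. a' * v + b' * cnj v)"
    using has_derivative_unique assms unfolding wd_def by blast
  from fun_cong[OF this, of 1] fun_cong[OF this, of \<i>]
  have "a + b = a' + b'" "\<i> * (a - b) = \<i> * (a' - b')" by (simp_all add: algebra_simps)
  then have "a + b = a' + b'" "a - b = a' - b'" by simp_all
  then have "2 * a = 2 * a'" "2 * b = 2 * b'" by algebra+
  then show ?thesis by simp
qed

lemma wd_transform:
  assumes "wd f a b z" "open S" "z \<in> S" "\<And>w. w \<in> S \<Longrightarrow> f w = g w"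
  shows "wd g a b z"
  using assms unfolding wd_def by (rule has_derivative_transform_within_open)

text \<open>The chain rule passes through the reals: the derivative of a real-valued function takes
  real values, so the outer derivative acts as multiplication by \<open>d\<close> on both Wirtinger
  coefficients.\<close>

lemma wd_of_real_comp:
  assumes u: "wd (\<lambda>z. of_real (u z)) a b z" and m: "(m has_real_derivative d) (at (u z))"
  shows "wd (\<lambda>z. of_real (m (u z))) (of_real d * a) (of_real d * b) z"
proof -
  have du: "(u has_derivative (\<lambda>v. Re (a * v + b * cnj v))) (at z)"
    using has_derivative_Re[OF u[unfolded wd_def]] by simp
  have "(\<lambda>v. of_real (Re (a * v + b * cnj v))) = (\<lambda>v. a * v + b * cnj v)"
    using has_derivative_unique[OF has_derivative_of_real[OF du] u[unfolded wd_def]] .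
  then have eq: "of_real (Re (a * v + b * cnj v)) = a * v + b * cnj v" for v
    by (rule fun_cong)
  have "((\<lambda>z. m (u z)) has_derivative (\<lambda>v. d * Re (a * v + b * cnj v))) (at z)"
    using has_derivative_compose[OF du m[unfolded has_field_derivative_def]] by simp
  from has_derivative_of_real[OF this]
  have "((\<lambda>z. complex_of_real (m (u z))) has_derivative
      (\<lambda>v. of_real d * of_real (Re (a * v + b * cnj v)))) (at z)" by simp
  then show ?thesis unfolding eq wd_def by (simp add: algebra_simps)
qed

text \<open>\<open>dbar_on S f b\<close>: on the open set \<open>S\<close> the function \<open>f\<close> is of class \<open>C\<^sup>1\<close>, and \<open>b\<close> is its
  derivative with respect to \<open>cnj z\<close>.\<close>

definition dbar_on :: "complex set \<Rightarrow> (complex \<Rightarrow> complex) \<Rightarrow> (complex \<Rightarrow> complex) \<Rightarrow> bool" where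
  "dbar_on S f b \<longleftrightarrow> open S \<and> continuous_on S b \<and>
     (\<exists>a. continuous_on S a \<and> (\<forall>z\<in>S. wd f (a z) (b z) z))"

lemma dbar_on_open: "dbar_on S f b \<Longrightarrow> open S"
  and dbar_on_continuous: "dbar_on S f b \<Longrightarrow> continuous_on S b"
  by (auto simp: dbar_on_def)

lemma dbar_on_continuous_fun: "dbar_on S f b \<Longrightarrow> continuous_on S f"
  unfolding dbar_on_def wd_def
  by (metis continuous_at_imp_continuous_on has_derivative_continuous)

lemma dbar_on_subset: "dbar_on S f b \<Longrightarrow> open T \<Longrightarrow> T \<subseteq> S \<Longrightarrow> dbar_on T f b"
  unfolding dbar_on_def by (meson continuous_on_subset subsetD)

lemma dbar_on_cong:
  assumes "dbar_on S f b" "\<And>z. z \<in> S \<Longrightarrow> f z = f' z" "\<And>z. z \<in> S \<Longrightarrow> b z = b' z"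
  shows "dbar_on S f' b'"
proof -
  obtain a where a: "continuous_on S a" "\<And>z. z \<in> S \<Longrightarrow> wd f (a z) (b z) z"
    using assms(1) by (auto simp: dbar_on_def)
  have "wd f' (a z) (b' z) z" if "z \<in> S" for z
    using wd_transform[OF a(2)[OF that] dbar_on_open[OF assms(1)] that] assms(2) assms(3)[OF that]
    by simp
  moreover have "continuous_on S b'"
    using dbar_on_continuous[OF assms(1)] assms(3) by (auto cong: continuous_on_cong)
  ultimately show ?thesis using a(1) dbar_on_open[OF assms(1)] by (auto simp: dbar_on_def)
qed

lemma dbar_on_field:
  assumes "open S" "\<And>z. z \<in> S \<Longrightarrow> (f has_field_derivative d z) (at z)" "continuous_on S d"
  shows "dbar_on S f (\<lambda>z. 0)"
  unfolding dbar_on_def using assms wd_field by (intro conjI exI[of _ d]) auto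

lemma dbar_on_const: "open S \<Longrightarrow> dbar_on S (\<lambda>z. c) (\<lambda>z. 0)"
  by (rule dbar_on_field[where d = "\<lambda>z. 0"]) auto

lemma dbar_on_id: "open S \<Longrightarrow> dbar_on S (\<lambda>z. z) (\<lambda>z. 0)"
  by (rule dbar_on_field[where d = "\<lambda>z. 1"]) auto

lemma dbar_on_cnj: "open S \<Longrightarrow> dbar_on S cnj (\<lambda>z. 1)"
  unfolding dbar_on_def using wd_cnj by (intro conjI exI[of _ "\<lambda>z. 0"]) auto

lemma dbar_on_add:
  assumes "dbar_on S f b" "dbar_on S g b'"
  shows "dbar_on S (\<lambda>z. f z + g z) (\<lambda>z. b z + b' z)"
proof -
  obtain a a' where "continuous_on S a" "\<And>z. z \<in> S \<Longrightarrow> wd f (a z) (b z) z"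
      "continuous_on S a'" "\<And>z. z \<in> S \<Longrightarrow> wd g (a' z) (b' z) z"
    using assms by (auto simp: dbar_on_def)
  then show ?thesis using assms unfolding dbar_on_def
    by (intro conjI exI[of _ "\<lambda>z. a z + a' z"] continuous_intros ballI wd_add) auto
qed

lemma dbar_on_mult:
  assumes "dbar_on S f b" "dbar_on S g b'"
  shows "dbar_on S (\<lambda>z. f z * g z) (\<lambda>z. f z * b' z + b z * g z)"
proof -
  obtain a a' where "continuous_on S a" "\<And>z. z \<in> S \<Longrightarrow> wd f (a z) (b z) z"
      "continuous_on S a'" "\<And>z. z \<in> S \<Longrightarrow> wd g (a' z) (b' z) z"
    using assms by (auto simp: dbar_on_def)
  then show ?thesis
    using assms dbar_on_continuous_fun[OF assms(1)] dbar_on_continuous_fun[OF assms(2)]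
    unfolding dbar_on_def
    by (intro conjI exI[of _ "\<lambda>z. f z * a' z + a z * g z"] continuous_intros ballI wd_mult) auto
qed

lemma dbar_on_cmult: "dbar_on S f b \<Longrightarrow> dbar_on S (\<lambda>z. c * f z) (\<lambda>z. c * b z)"
  using dbar_on_mult[OF dbar_on_const[OF dbar_on_open], of S f b f b c] by simp

lemma dbar_on_diff:
  assumes "dbar_on S f b" "dbar_on S g b'"
  shows "dbar_on S (\<lambda>z. f z - g z) (\<lambda>z. b z - b' z)"
  using dbar_on_add[OF assms(1) dbar_on_cmult[OF assms(2), of "-1"]] by simp

text \<open>The set \<open>T\<close> admits outer functions such as \<open>ln\<close>, whose
  derivative is continuous only on part of the line.\<close>

lemma dbar_on_real_comp:
  assumes u: "dbar_on S (\<lambda>z. of_real (u z)) b"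
    and m: "\<And>z. z \<in> S \<Longrightarrow> (m has_real_derivative m' (u z)) (at (u z))"
    and T: "continuous_on T m'" "u ` S \<subseteq> T"
  shows "dbar_on S (\<lambda>z. of_real (m (u z))) (\<lambda>z. of_real (m' (u z)) * b z)"
proof -
  obtain a where a: "continuous_on S a" "\<And>z. z \<in> S \<Longrightarrow> wd (\<lambda>z. of_real (u z)) (a z) (b z) z"
    using u by (auto simp: dbar_on_def)
  have "continuous_on S u"
    using continuous_on_Re[OF dbar_on_continuous_fun[OF u]] by simp
  then have "continuous_on S (\<lambda>z. m' (u z))"
    using continuous_on_compose2[OF T(1)] T(2) by auto
  then show ?thesis
    using a u m unfolding dbar_on_def
    by (intro conjI exI[of _ "\<lambda>z. of_real (m' (u z)) * a z"] continuous_intros ballI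
        wd_of_real_comp) auto
qed

lemma dbar_on_norm_square:
  "open S \<Longrightarrow> dbar_on S (\<lambda>z. of_real ((cmod (z - e))\<^sup>2)) (\<lambda>z. z - e)"
proof -
  assume S: "open S"
  have "dbar_on S (\<lambda>z. (z - e) * (cnj z - cnj e)) (\<lambda>z. (z - e) * (1 - 0) + (0 - 0) * (cnj z - cnj e))"
    by (intro dbar_on_mult dbar_on_diff dbar_on_id dbar_on_cnj dbar_on_const S)
  then show ?thesis
    by (rule dbar_on_cong) (simp_all only: complex_norm_square complex_cnj_diff, simp)
qed

lemma dbar_on_Re: "open S \<Longrightarrow> dbar_on S (\<lambda>z. of_real (Re z)) (\<lambda>z. 1 / 2)"
proof -
  assume S: "open S"
  have "dbar_on S (\<lambda>z. (1/2) * (z + cnj z)) (\<lambda>z. (1/2) * (0 + 1))"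
    by (intro dbar_on_cmult dbar_on_add dbar_on_id dbar_on_cnj S)
  then show ?thesis
    by (rule dbar_on_cong) (simp_all add: complex_eq_iff)
qed

text \<open>Both hypotheses provide their own derivative with respect to \<open>z\<close>; by
  \<open>wd_unique\<close> the two agree on the overlap and can be glued.\<close>

lemma dbar_on_Un:
  assumes "dbar_on S f b" "dbar_on T f b"
  shows "dbar_on (S \<union> T) f b"
proof -
  obtain a a' where a: "continuous_on S a" "\<And>z. z \<in> S \<Longrightarrow> wd f (a z) (b z) z"
      "continuous_on T a'" "\<And>z. z \<in> T \<Longrightarrow> wd f (a' z) (b z) z"
    using assms by (auto simp: dbar_on_def)
  define A where "A z = (if z \<in> S then a z else a' z)" for z
  have *: "a z = a' z" if "z \<in> S" "z \<in> T" for z using wd_unique a that by blast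
  have op: "open S" "open T" using assms dbar_on_open by auto
  have "continuous_on S A" using a(1) by (simp add: A_def cong: continuous_on_cong)
  moreover have "continuous_on T A"
    using a(3) * by (subst continuous_on_cong[OF refl, of _ _ a']) (auto simp: A_def)
  ultimately have "continuous_on (S \<union> T) A"
    using op by (intro continuous_on_open_Un)
  moreover have "continuous_on (S \<union> T) b"
    using assms op by (intro continuous_on_open_Un dbar_on_continuous)
  moreover have "wd f (A z) (b z) z" if "z \<in> S \<union> T" for z
    using a that by (auto simp: A_def)
  ultimately show ?thesis unfolding dbar_on_def using op by blast
qed

text \<open>The extension is \<open>f\<close> on \<open>S\<close> and 0 on the complement of
  \<open>C\<close>. These two open sets cover the plane, and on their overlap \<open>f\<close>
  vanishes.\<close>

lemma dbar_on_extend_zero: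
  assumes f: "dbar_on S f b" and C: "closed C" "C \<subseteq> S"
    and z: "\<And>z. z \<in> S - C \<Longrightarrow> f z = 0"
  shows "dbar_on UNIV (\<lambda>z. if z \<in> C then f z else 0) (\<lambda>z. if z \<in> C then b z else 0)"
    and "\<And>z. z \<in> S - C \<Longrightarrow> b z = 0"
proof -
  show b0: "b z = 0" if z': "z \<in> S - C" for z
  proof -
    have "open (S - C)" using dbar_on_open[OF f] C by auto
    then have "wd f 0 0 z"
      using wd_transform[OF wd_const, of "S - C" z 0 f] z z' by auto
    then show ?thesis using f z' wd_unique unfolding dbar_on_def by blast
  qed
  let ?f = "\<lambda>z. if z \<in> C then f z else 0" and ?b = "\<lambda>z. if z \<in> C then b z else 0"
  have 1: "dbar_on S ?f ?b"
    by (rule dbar_on_cong[OF f]) (use z b0 in auto)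
  have "dbar_on (- C) (\<lambda>z. 0) (\<lambda>z. 0)" using C by (intro dbar_on_const) auto
  then have 2: "dbar_on (- C) ?f ?b" by (rule dbar_on_cong) auto
  have "S \<union> - C = UNIV" using C by auto
  then show "dbar_on UNIV ?f ?b" using dbar_on_Un[OF 1 2] by simp
qed

section \<open>Integrals of compactly supported functions over the plane\<close>

lemma continuous_compact_support_integrable:
  fixes f :: "complex \<Rightarrow> 'b::{banach, second_countable_topology}"
  assumes "continuous_on UNIV f" "\<And>z. cmod z > L \<Longrightarrow> f z = 0"
  shows "integrable lborel f"
proof -
  have "integrable lborel (\<lambda>x. indicator (cball 0 L) x *\<^sub>R f x)"
    using assms(1) continuous_on_subset by (intro borel_integrable_compact) auto
  also have "(\<lambda>x. indicator (cball 0 L) x *\<^sub>R f x) = f"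
    using assms(2) by (auto simp: indicator_def not_le fun_eq_iff)
  finally show ?thesis .
qed

lemma integral_lborel_complex_affine:
  fixes f :: "complex \<Rightarrow> 'b::{banach, second_countable_topology}"
  assumes [measurable]: "f \<in> borel_measurable borel" and c: "c \<noteq> 0"
  shows "integral\<^sup>L lborel f = c\<^sup>2 *\<^sub>R (\<integral>x. f (t + c *\<^sub>R x) \<partial>lborel)"
proof -
  have "integral\<^sup>L lborel f
      = integral\<^sup>L (density (distr lborel borel (\<lambda>x. t + c *\<^sub>R x)) (\<lambda>_. \<bar>c\<bar>^DIM(complex))) f"
    using lborel_affine[OF c, of t] by simp
  also have "\<dots> = integral\<^sup>L (distr lborel borel (\<lambda>x. t + c *\<^sub>R x)) (\<lambda>x. \<bar>c\<bar>^DIM(complex) *\<^sub>R f x)"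
    by (rule integral_density) auto
  also have "\<dots> = (\<integral>x. \<bar>c\<bar>^DIM(complex) *\<^sub>R f (t + c *\<^sub>R x) \<partial>lborel)"
    by (rule integral_distr) auto
  finally show ?thesis by simp
qed

text \<open>Supplies the Lipschitz constant with which the difference quotients are dominated in
  \<open>integral_dbar_zero\<close>.\<close>

lemma dbar_derivative_bounded:
  assumes cont: "continuous_on UNIV a" "continuous_on UNIV b"
    and wd: "\<And>z. wd f (a z) (b z) z" and supp: "\<And>z. cmod z > L \<Longrightarrow> f z = 0"
  shows "\<And>z. cmod z > L \<Longrightarrow> a z = 0 \<and> b z = 0"
    and "\<exists>M. \<forall>z. cmod (a z) + cmod (b z) \<le> M"
proof -
  show z: "a z = 0 \<and> b z = 0" if "cmod z > L" for z
  proof -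
    have "open {z. cmod z > L}" by (intro open_Collect_less continuous_intros)
    then have "wd f 0 0 z"
      using wd_transform[OF wd_const, of "{z. cmod z > L}" z 0 f] supp that by auto
    then show ?thesis using wd wd_unique by blast
  qed
  have "compact ((\<lambda>z. cmod (a z) + cmod (b z)) ` cball 0 L)"
    by (intro compact_continuous_image continuous_intros continuous_on_subset[OF cont(1)]
        continuous_on_subset[OF cont(2)]) auto
  then obtain M where M: "\<And>z. z \<in> cball 0 L \<Longrightarrow> \<bar>cmod (a z) + cmod (b z)\<bar> \<le> M"
    unfolding bounded_iff[symmetric] using compact_imp_bounded bounded_iff
    by (metis (no_types, lifting) imageI real_norm_def)
  have "cmod (a z) + cmod (b z) \<le> max M 0" for z
    using M[of z] z[of z] by (cases "cmod z > L") auto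
  then show "\<exists>M. \<forall>z. cmod (a z) + cmod (b z) \<le> M" by blast
qed

text \<open>The integral of a derivative vanishes because difference quotients have integral zero by
  translation invariance.\<close>

lemma integral_dbar_zero:
  assumes f: "dbar_on UNIV f b" and supp: "\<And>z. cmod z > L \<Longrightarrow> f z = 0"
  shows "integrable lborel b" "integral\<^sup>L lborel b = 0"
proof -
  obtain a where cont: "continuous_on UNIV a" "continuous_on UNIV b"
    and wd: "\<And>z. wd f (a z) (b z) z"
    using f by (auto simp: dbar_on_def)
  note z = dbar_derivative_bounded(1)[OF cont wd supp]
  obtain M where M: "\<And>z. cmod (a z) + cmod (b z) \<le> M"
    using dbar_derivative_bounded(2)[OF cont wd supp] by blast
  have M0: "M \<ge> 0" using M[of 0] by (meson add_nonneg_nonneg norm_ge_zero order_trans)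
  have fc: "continuous_on UNIV f" by (rule dbar_on_continuous_fun[OF f])
  have fi: "integrable lborel f" using fc supp by (rule continuous_compact_support_integrable)
  have lip: "cmod (f x - f y) \<le> M * cmod (x - y)" for x y
  proof (rule differentiable_bound[of UNIV f "\<lambda>z v. a z * v + b z * cnj v"])
    show "onorm (\<lambda>v. a z * v + b z * cnj v) \<le> M" for z
    proof (rule onorm_le)
      fix v
      have "cmod (a z * v + b z * cnj v) \<le> (cmod (a z) + cmod (b z)) * cmod v"
        by (rule order_trans[OF norm_triangle_ineq]) (simp add: norm_mult algebra_simps)
      also have "\<dots> \<le> M * cmod v" using M by (intro mult_right_mono) auto
      finally show "cmod (a z * v + b z * cnj v) \<le> M * cmod v" .
    qed
  qed (use wd in \<open>auto simp: wd_def\<close>)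
  have key: "(\<integral>w. a w * v + b w * cnj v \<partial>lborel) = 0"
      and ikey: "integrable lborel (\<lambda>w. a w * v + b w * cnj v)" for v
  proof -
    define t where "t n = 1 / real (Suc n)" for n
    have t: "t n > 0" "t n \<le> 1" for n by (auto simp: t_def)
    have tlim: "t \<longlonglongrightarrow> 0" unfolding t_def by (rule LIMSEQ_Suc[OF lim_1_over_n])
    define s where "s n w = (1 / t n) *\<^sub>R (f (w + t n *\<^sub>R v) - f w)" for n w
    \<comment> \<open>Dominates all difference quotients at once: the step \<open>t n\<close> is at
      most 1, so they vanish at points further than \<open>cmod v\<close> from the disc of radius
      \<open>L\<close>.\<close>
    define g where "g w = indicator (cball 0 (L + cmod v)) w *\<^sub>R (M * cmod v)" for w :: complex
    have gi: "integrable lborel g" unfolding g_def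
      by (rule borel_integrable_compact) auto
    have meas: "f \<in> borel_measurable borel" using fc borel_measurable_continuous_onI by auto
    have tr: "(\<lambda>w. f (w + c)) \<in> borel_measurable borel" for c
      by (intro borel_measurable_continuous_onI continuous_on_compose2[OF fc] continuous_intros) auto
    have bound: "norm (s n w) \<le> g w" for n w
    proof (cases "cmod w \<le> L + cmod v")
      case True
      have "norm (s n w) = (1 / t n) * cmod (f (w + t n *\<^sub>R v) - f w)"
        using t by (simp add: s_def abs_of_pos)
      also have "\<dots> \<le> (1 / t n) * (M * cmod (w + t n *\<^sub>R v - w))"
        using t less_imp_le by (intro mult_left_mono lip) auto
      also have "\<dots> = M * cmod v" using t[of n] by (simp add: abs_of_pos)
      finally show ?thesis using True by (simp add: g_def)
    next
      case False
      have "cmod (t n *\<^sub>R v) \<le> cmod v"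
        using t[of n] by (simp add: mult_left_le_one_le abs_of_pos)
      moreover have "cmod (w + t n *\<^sub>R v) \<ge> cmod w - cmod (t n *\<^sub>R v)"
        by (metis norm_diff_ineq)
      ultimately have "cmod (w + t n *\<^sub>R v) > L" using False by linarith
      moreover have "cmod w > L" using False norm_ge_zero[of v] by linarith
      ultimately show ?thesis using supp M0 by (simp add: s_def g_def)
    qed
    have conv: "(\<lambda>n. s n w) \<longlonglongrightarrow> a w * v + b w * cnj v" for w
    proof -
      have "((\<lambda>\<tau>. w + \<tau> *\<^sub>R v) has_derivative (\<lambda>\<tau>. \<tau> *\<^sub>R v)) (at 0)"
        by (auto intro!: derivative_eq_intros)
      moreover have "(f has_derivative (\<lambda>v. a w * v + b w * cnj v)) (at (w + 0 *\<^sub>R v))"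
        using wd by (simp add: wd_def)
      ultimately have "((\<lambda>\<tau>. f (w + \<tau> *\<^sub>R v)) has_derivative
          (\<lambda>\<tau>. a w * (\<tau> *\<^sub>R v) + b w * cnj (\<tau> *\<^sub>R v))) (at 0)"
        by (rule has_derivative_compose)
      then have lim1: "((\<lambda>\<tau>. norm (f (w + \<tau> *\<^sub>R v) - f w - (a w * (\<tau> *\<^sub>R v) + b w * cnj (\<tau> *\<^sub>R v)))
          / norm \<tau>) \<longlongrightarrow> 0) (at 0)"
        unfolding has_derivative_at by simp
      have eq: "norm (f (w + \<tau> *\<^sub>R v) - f w - (a w * (\<tau> *\<^sub>R v) + b w * cnj (\<tau> *\<^sub>R v))) / norm \<tau>
          = norm ((1 / \<tau>) *\<^sub>R (f (w + \<tau> *\<^sub>R v) - f w) - (a w * v + b w * cnj v))" if "\<tau> \<noteq> 0" for \<tau>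
      proof -
        have "(1 / \<tau>) *\<^sub>R (f (w + \<tau> *\<^sub>R v) - f w) - (a w * v + b w * cnj v)
            = (1 / \<tau>) *\<^sub>R (f (w + \<tau> *\<^sub>R v) - f w - (a w * (\<tau> *\<^sub>R v) + b w * cnj (\<tau> *\<^sub>R v)))"
          using that by (simp add: scaleR_diff_right scaleR_add_right)
        then show ?thesis by simp
      qed
      have "((\<lambda>\<tau>. norm ((1 / \<tau>) *\<^sub>R (f (w + \<tau> *\<^sub>R v) - f w) - (a w * v + b w * cnj v)))
          \<longlongrightarrow> 0) (at 0)"
        by (rule Lim_transform_eventually[OF lim1]) 
          (unfold eventually_at_filter, intro always_eventually allI impI eq)
      then have "((\<lambda>\<tau>. (1 / \<tau>) *\<^sub>R (f (w + \<tau> *\<^sub>R v) - f w)) \<longlongrightarrow> a w * v + b w * cnj v) (at 0)"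
        using Lim_null tendsto_norm_zero_iff by blast
      moreover have "filterlim t (at 0) sequentially"
        using tlim t by (auto simp: filterlim_at order_less_imp_not_eq2)
      ultimately show ?thesis unfolding s_def by (rule filterlim_compose)
    qed
    have s0: "integral\<^sup>L lborel (s n) = 0" for n
    proof -
      have i1: "integrable lborel (\<lambda>w. f (w + t n *\<^sub>R v))"
      proof (rule continuous_compact_support_integrable)
        show "continuous_on UNIV (\<lambda>w. f (w + t n *\<^sub>R v))"
          by (intro continuous_on_compose2[OF fc] continuous_intros) auto
        show "f (w + t n *\<^sub>R v) = 0" if "cmod w > L + cmod (t n *\<^sub>R v)" for w
          using that norm_diff_ineq[of w "t n *\<^sub>R v"] by (intro supp) linarith
      qed
      have "(\<integral>w. f (t n *\<^sub>R v + 1 *\<^sub>R w) \<partial>lborel) = integral\<^sup>L lborel f"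
        using integral_lborel_complex_affine[OF meas, of 1 "t n *\<^sub>R v"] by simp
      then have "(\<integral>w. f (w + t n *\<^sub>R v) \<partial>lborel) = integral\<^sup>L lborel f"
        by (simp add: add.commute)
      then show ?thesis unfolding s_def using i1 fi by simp
    qed
    have m1: "s n \<in> borel_measurable lborel" for n
      unfolding s_def using meas tr by measurable
    have m2: "(\<lambda>w. a w * v + b w * cnj v) \<in> borel_measurable lborel"
      using cont by (simp, intro borel_measurable_continuous_onI continuous_intros)
    show "integrable lborel (\<lambda>w. a w * v + b w * cnj v)"
      by (rule integrable_dominated_convergence[where s = s, OF m2 m1 gi]) (use conv bound in auto)
    have "(\<lambda>n. integral\<^sup>L lborel (s n)) \<longlonglongrightarrow> (\<integral>w. a w * v + b w * cnj v \<partial>lborel)"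
      by (rule integral_dominated_convergence[where s = s, OF m2 m1 gi]) (use conv bound in auto)
    then show "(\<integral>w. a w * v + b w * cnj v \<partial>lborel) = 0"
      unfolding s0 by (simp add: LIMSEQ_const_iff)
  qed
  \<comment> \<open>The directions 1 and \<open>\<i>\<close> give the derivatives
    \<open>a + b\<close> and \<open>\<i> * (a - b)\<close>; this combination isolates
    \<open>b\<close>.\<close>
  have eq: "b = (\<lambda>w. ((a w * 1 + b w * cnj 1) + \<i> * (a w * \<i> + b w * cnj \<i>)) / 2)"
    by (auto simp: algebra_simps)
  show "integrable lborel b"
    by (subst eq) (use ikey[of 1] ikey[of \<i>] in auto)
  have "integral\<^sup>L lborel b
      = ((\<integral>w. a w * 1 + b w * cnj 1 \<partial>lborel) + \<i> * (\<integral>w. a w * \<i> + b w * cnj \<i> \<partial>lborel)) / 2"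
    using ikey[of 1] ikey[of \<i>] by (subst eq) simp
  then show "integral\<^sup>L lborel b = 0" using key[of 1] key[of \<i>] by simp
qed

section \<open>Cauchy's formula\<close>

text \<open>At the joint the quotients of \<open>f\<close> from the left and of \<open>g\<close>
  from the right have the common limit \<open>f' a\<close>.\<close>

lemma DERIV_glue:
  fixes f g :: "real \<Rightarrow> real"
  assumes f: "t \<le> a \<Longrightarrow> (f has_real_derivative f' t) (at t)"
    and g: "t \<ge> a \<Longrightarrow> (g has_real_derivative g' t) (at t)"
    and eq: "f a = g a" "f' a = g' a"
  shows "((\<lambda>t. if t \<le> a then f t else g t) has_real_derivative (if t \<le> a then f' t else g' t)) (at t)"
proof (cases t a rule: linorder_cases)
  case less
  then have "\<forall>\<^sub>F x in nhds t. x < a" by (simp add: eventually_nhds_in_open[of "{..<a}", simplified])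
  then have "\<forall>\<^sub>F x in nhds t. (if x \<le> a then f x else g x) = f x"
    by eventually_elim auto
  then show ?thesis using f less by (subst DERIV_cong_ev[OF refl _ refl]) auto
next
  case greater
  then have "\<forall>\<^sub>F x in nhds t. x > a" by (simp add: eventually_nhds_in_open[of "{a<..}", simplified])
  then have "\<forall>\<^sub>F x in nhds t. (if x \<le> a then f x else g x) = g x"
    by eventually_elim auto
  then show ?thesis using g greater by (subst DERIV_cong_ev[OF refl _ refl]) auto
next
  case equal
  have "((\<lambda>y. if y \<le> a then (f y - f a) / (y - a) else (g y - g a) / (y - a)) \<longlongrightarrow> f' a) (at a)"
    using f g equal eq unfolding has_field_derivative_iff
    by (intro filterlim_If) (auto intro: tendsto_mono[OF inf_le1])
  then have "((\<lambda>y. ((if y \<le> a then f y else g y) - f a) / (y - a)) \<longlongrightarrow> f' a) (at a)"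
    by (rule Lim_transform_eventually) (use eq in \<open>auto intro!: always_eventually\<close>)
  then show ?thesis using equal unfolding has_field_derivative_iff by simp
qed

text \<open>The cubic that joins 0 to 1 with horizontal tangents. The resulting class C^1 is all
  that \<open>dbar_on\<close> asks for.\<close>

definition smoothstep :: "real \<Rightarrow> real" where
  "smoothstep t = (if t \<le> 0 then 0 else if t \<le> 1 then 3 * t\<^sup>2 - 2 * t^3 else 1)"

definition smoothstep_deriv :: "real \<Rightarrow> real" where
  "smoothstep_deriv t = (if t \<le> 0 then 0 else if t \<le> 1 then 6 * t - 6 * t\<^sup>2 else 0)"

lemma DERIV_smoothstep: "(smoothstep has_real_derivative smoothstep_deriv t) (at t)"
  unfolding smoothstep_def smoothstep_deriv_def
  by (intro DERIV_glue) (auto intro!: derivative_eq_intros simp: power2_eq_square power3_eq_cube)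

lemma continuous_smoothstep_deriv: "continuous_on T smoothstep_deriv"
proof -
  have eq: "smoothstep_deriv = (\<lambda>t. max 0 (min 1 t) * 6 * (1 - max 0 (min 1 t)))"
    by (auto simp: smoothstep_deriv_def fun_eq_iff max_def min_def power2_eq_square algebra_simps)
  show ?thesis unfolding eq by (intro continuous_intros)
qed

lemma smoothstep_0: "t \<le> 0 \<Longrightarrow> smoothstep t = 0"
  and smoothstep_1: "t \<ge> 1 \<Longrightarrow> smoothstep t = 1"
  and smoothstep_deriv_0: "t \<le> 0 \<Longrightarrow> smoothstep_deriv t = 0"
  and smoothstep_deriv_1: "t \<ge> 1 \<Longrightarrow> smoothstep_deriv t = 0"
  by (auto simp: smoothstep_def smoothstep_deriv_def not_le dest: antisym)

lemma smoothstep_nonneg: "smoothstep t \<ge> 0"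
proof -
  have "3 * t\<^sup>2 - 2 * t^3 = t\<^sup>2 * (3 - 2 * t)" by (simp add: power2_eq_square power3_eq_cube algebra_simps)
  then show ?thesis by (auto simp: smoothstep_def)
qed

lemma smoothstep_le_1: "smoothstep t \<le> 1"
proof -
  have "3 * t\<^sup>2 - 2 * t^3 = 1 - (1 - t)\<^sup>2 * (1 + 2 * t)"
    by (simp add: power2_eq_square power3_eq_cube algebra_simps)
  then show ?thesis by (auto simp: smoothstep_def)
qed

lemma smoothstep_deriv_bounds: "0 \<le> smoothstep_deriv t" "smoothstep_deriv t \<le> 3 / 2"
proof -
  have 1: "6 * t - 6 * t\<^sup>2 = 6 * t * (1 - t)" by (simp add: power2_eq_square algebra_simps)
  have 2: "6 * t - 6 * t\<^sup>2 = 3/2 - 6 * (t - 1/2)\<^sup>2" by (simp add: power2_eq_square algebra_simps)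
  show "0 \<le> smoothstep_deriv t" by (auto simp: smoothstep_deriv_def 1)
  show "smoothstep_deriv t \<le> 3 / 2" by (auto simp: smoothstep_deriv_def 2)
qed

lemma dbar_on_smoothstep:
  assumes "dbar_on S (\<lambda>z. of_real (u z)) b"
  shows "dbar_on S (\<lambda>z. of_real (smoothstep (u z))) (\<lambda>z. of_real (smoothstep_deriv (u z)) * b z)"
  by (rule dbar_on_real_comp[OF assms DERIV_smoothstep continuous_smoothstep_deriv subset_UNIV])

text \<open>A \<open>C\<^sup>1\<close> truncation of the Cauchy kernel \<open>1 / u\<close>, which replaces Green's formula: its
  \<open>cnj\<close>-derivative is a nonnegative bump whose total mass does not depend on \<open>\<delta>\<close>.\<close>

definition kernel_profile :: "real \<Rightarrow> real" where
  "kernel_profile t = (if t \<le> 1 then 2 - t else 1 / t)"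

definition cauchy_kernel :: "real \<Rightarrow> complex \<Rightarrow> complex" where
  "cauchy_kernel \<delta> u = cnj u * of_real (kernel_profile ((cmod u)\<^sup>2 / \<delta>\<^sup>2)) / of_real (\<delta>\<^sup>2)"

definition bump :: "complex \<Rightarrow> real" where
  "bump u = max 0 (2 - 2 * (cmod u)\<^sup>2)"

definition bump_mass :: real where
  "bump_mass = integral\<^sup>L lborel bump"

lemma cauchy_kernel_eq:
  assumes "\<delta> > 0" "cmod u \<ge> \<delta>"
  shows "cauchy_kernel \<delta> u = 1 / u"
proof -
  have t: "(cmod u)\<^sup>2 / \<delta>\<^sup>2 \<ge> 1" using assms by (simp add: power_mono)
  have u: "u \<noteq> 0" using assms by auto
  have "kernel_profile ((cmod u)\<^sup>2 / \<delta>\<^sup>2) = \<delta>\<^sup>2 / (cmod u)\<^sup>2"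
    using t by (cases "(cmod u)\<^sup>2 / \<delta>\<^sup>2 = 1") (auto simp: kernel_profile_def field_simps)
  then have "cauchy_kernel \<delta> u = cnj u / of_real ((cmod u)\<^sup>2)"
    using assms by (simp add: cauchy_kernel_def)
  also have "\<dots> = 1 / u" using u by (simp add: complex_norm_square del: of_real_power)
  finally show ?thesis .
qed

text \<open>With \<open>t = (cmod u)^2 / \<delta>^2\<close> and the profile \<open>k\<close>, the
  product rule gives \<open>(k t + t * k' t) / \<delta>^2\<close>. This is the derivative of
  \<open>t * k t\<close>, which is constant for \<open>t \<ge> 1\<close> and gives
  \<open>2 - 2 * t\<close> for \<open>t \<le> 1\<close>. The line \<open>2 - t\<close> is the
  tangent to \<open>1 / t\<close> at 1, whence class C^1.\<close>

lemma dbar_on_cauchy_kernel: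
  assumes \<delta>: "\<delta> > 0"
  shows "dbar_on UNIV (\<lambda>w. cauchy_kernel \<delta> (w - z)) (\<lambda>w. of_real (bump ((w - z) /\<^sub>R \<delta>) / \<delta>\<^sup>2))"
proof -
  let ?t = "\<lambda>w. (cmod (w - z))\<^sup>2 / \<delta>\<^sup>2"
  define m' :: "real \<Rightarrow> real" where "m' t = (if t \<le> 1 then - 1 else - 1 / t\<^sup>2)" for t
  have "dbar_on UNIV (\<lambda>w. of_real (1 / \<delta>\<^sup>2) * of_real ((cmod (w - z))\<^sup>2)) (\<lambda>w. of_real (1 / \<delta>\<^sup>2) * (w - z))"
    by (intro dbar_on_cmult dbar_on_norm_square open_UNIV)
  then have 1: "dbar_on UNIV (\<lambda>w. of_real (?t w)) (\<lambda>w. of_real (1 / \<delta>\<^sup>2) * (w - z))"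
    by (rule dbar_on_cong) auto
  have d: "(kernel_profile has_real_derivative m' t) (at t)" for t
    unfolding kernel_profile_def m'_def
    by (intro DERIV_glue) (auto intro!: derivative_eq_intros simp: power2_eq_square)
  have m'_eq: "m' = (\<lambda>t. - 1 / (max 1 t)\<^sup>2)"
    by (auto simp: m'_def fun_eq_iff max_def power2_eq_square)
  have "continuous_on UNIV m'"
    unfolding m'_eq by (intro continuous_intros) (auto simp: max_def)
  from dbar_on_real_comp[OF 1 d this subset_UNIV]
  have 2: "dbar_on UNIV (\<lambda>w. of_real (kernel_profile (?t w)))
      (\<lambda>w. of_real (m' (?t w)) * (of_real (1 / \<delta>\<^sup>2) * (w - z)))" .
  have "dbar_on UNIV (\<lambda>w. of_real (1 / \<delta>\<^sup>2) * ((cnj w - cnj z) * of_real (kernel_profile (?t w))))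
      (\<lambda>w. of_real (1 / \<delta>\<^sup>2) * ((cnj w - cnj z) * (of_real (m' (?t w)) * (of_real (1 / \<delta>\<^sup>2) * (w - z)))
          + (1 - 0) * of_real (kernel_profile (?t w))))"
    by (intro dbar_on_cmult dbar_on_mult dbar_on_diff dbar_on_cnj dbar_on_const 2 open_UNIV)
  then show ?thesis
  proof (rule dbar_on_cong)
    fix w
    show "of_real (1 / \<delta>\<^sup>2) * ((cnj w - cnj z) * of_real (kernel_profile (?t w)))
        = cauchy_kernel \<delta> (w - z)"
      by (simp add: cauchy_kernel_def)
    define t where "t = ?t w"
    have "(cnj w - cnj z) * (of_real (m' t) * (of_real (1 / \<delta>\<^sup>2) * (w - z)))
        = of_real (m' t) * of_real (1 / \<delta>\<^sup>2) * ((w - z) * cnj (w - z))"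
      by (simp only: complex_cnj_diff mult_ac)
    also have "\<dots> = of_real (m' t * t)"
      unfolding complex_norm_square[symmetric] by (simp add: t_def)
    finally have "(cnj w - cnj z) * (of_real (m' t) * (of_real (1 / \<delta>\<^sup>2) * (w - z)))
        + (1 - 0) * complex_of_real (kernel_profile t) = of_real (m' t * t + kernel_profile t)" by simp
    moreover have "m' t * t + kernel_profile t = max 0 (2 - 2 * t)"
      by (auto simp: m'_def kernel_profile_def max_def power2_eq_square)
    moreover have "bump ((w - z) /\<^sub>R \<delta>) = max 0 (2 - 2 * t)"
      using \<delta> by (simp add: bump_def t_def power_mult_distrib power_inverse divide_inverse mult.commute)
    ultimately show "of_real (1 / \<delta>\<^sup>2) * ((cnj w - cnj z) * (of_real (m' (?t w)) * (of_real (1 / \<delta>\<^sup>2) * (w - z)))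
          + (1 - 0) * of_real (kernel_profile (?t w))) = of_real (bump ((w - z) /\<^sub>R \<delta>) / \<delta>\<^sup>2)"
      by (simp add: t_def[symmetric])
  qed
qed

lemma bump_nonneg: "bump u \<ge> 0"
  by (simp add: bump_def)

lemma bump_zero: "cmod u \<ge> 1 \<Longrightarrow> bump u = 0"
  by (simp add: bump_def)

lemma continuous_bump: "continuous_on S bump"
  unfolding bump_def by (intro continuous_intros)

lemma integrable_bump: "integrable lborel bump"
  by (rule continuous_compact_support_integrable[where L = 1])
    (auto simp: continuous_bump bump_zero)

lemma bump_mass_pos: "bump_mass > 0"
proof -
  have "(\<integral>u. indicator (cball (0::complex) (1/2)) u *\<^sub>R (1::real) \<partial>lborel) \<le> bump_mass"
    unfolding bump_mass_def
  proof (rule Bochner_Integration.integral_mono'[OF integrable_bump])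
    fix u :: complex
    have "(cmod u)\<^sup>2 \<le> (1/2)\<^sup>2" if "cmod u \<le> 1/2" using that by (rule power_mono) auto
    then show "indicator (cball 0 (1/2)) u *\<^sub>R (1::real) \<le> bump u"
      by (auto simp: indicator_def bump_def power2_eq_square)
  qed (rule bump_nonneg)
  then have "measure lborel (cball (0::complex) (1/2)) \<le> bump_mass" by simp
  then show ?thesis by (rule less_le_trans[OF content_cball_pos, rotated]) simp
qed

lemma integral_bump_scaled:
  assumes "\<delta> > 0"
  shows "integrable lborel (\<lambda>w. bump ((w - z) /\<^sub>R \<delta>) / \<delta>\<^sup>2)"
    "(\<integral>w. bump ((w - z) /\<^sub>R \<delta>) / \<delta>\<^sup>2 \<partial>lborel) = bump_mass"
proof -
  have c: "continuous_on UNIV (\<lambda>w. bump ((w - z) /\<^sub>R \<delta>) / \<delta>\<^sup>2)"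
    by (intro continuous_intros continuous_on_compose2[OF continuous_bump]) (use assms in auto)
  show "integrable lborel (\<lambda>w. bump ((w - z) /\<^sub>R \<delta>) / \<delta>\<^sup>2)"
  proof (rule continuous_compact_support_integrable[OF c, where L = "cmod z + \<delta>"])
    fix w assume "cmod w > cmod z + \<delta>"
    then have "cmod (w - z) \<ge> \<delta>" using norm_triangle_ineq2[of w z] by linarith
    then have "cmod ((w - z) /\<^sub>R \<delta>) \<ge> 1"
      using assms by (simp add: divide_simps)
    then show "bump ((w - z) /\<^sub>R \<delta>) / \<delta>\<^sup>2 = 0"
      using bump_zero by simp
  qed
  show "(\<integral>w. bump ((w - z) /\<^sub>R \<delta>) / \<delta>\<^sup>2 \<partial>lborel) = bump_mass"
    using integral_lborel_complex_affine[of "\<lambda>w. bump ((w - z) /\<^sub>R \<delta>) / \<delta>\<^sup>2" \<delta> z] assms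
      borel_measurable_continuous_onI[OF c]
    by (simp add: bump_mass_def)
qed

text \<open>Since \<open>g\<close> is holomorphic near \<open>z\<close>, the kernel is never evaluated near its singularity. The
  constant \<open>bump_mass\<close> equals \<open>pi\<close>, but only its positivity matters.\<close>

lemma cauchy_pompeiu:
  assumes g: "dbar_on UNIV g b" and supp: "\<And>w. cmod w > L \<Longrightarrow> g w = 0"
    and e: "e > 0" and hol: "\<And>w. w \<in> ball z e \<Longrightarrow> b w = 0"
  shows "integrable lborel (\<lambda>w. b w / (w - z))"
    "(\<integral>w. b w / (w - z) \<partial>lborel) = - of_real bump_mass * g z"
proof -
  have eq: "b w / (w - z) = b w * cauchy_kernel \<delta> (w - z)" if "0 < \<delta>" "\<delta> < e" for \<delta> w
  proof (cases "w \<in> ball z e")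
    case False
    then have "cmod (w - z) \<ge> \<delta>" using that by (simp add: dist_norm norm_minus_commute)
    then show ?thesis using that cauchy_kernel_eq by (simp add: divide_inverse)
  qed (use hol in auto)
  have dk: "dbar_on UNIV (\<lambda>w. g w * cauchy_kernel \<delta> (w - z))
      (\<lambda>w. g w * of_real (bump ((w - z) /\<^sub>R \<delta>) / \<delta>\<^sup>2) + b w * cauchy_kernel \<delta> (w - z))"
    if "\<delta> > 0" for \<delta>
    by (intro dbar_on_mult g dbar_on_cauchy_kernel that)
  have gc: "continuous_on UNIV g" by (rule dbar_on_continuous_fun[OF g])
  have cb: "continuous_on UNIV (\<lambda>w. complex_of_real (bump ((w - z) /\<^sub>R \<delta>) / \<delta>\<^sup>2))" if "\<delta> > 0" for \<delta>
    using dbar_on_continuous[OF dbar_on_cauchy_kernel[OF that]] .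
  have i1: "integrable lborel (\<lambda>w. g w * complex_of_real (bump ((w - z) /\<^sub>R \<delta>) / \<delta>\<^sup>2))" if "\<delta> > 0" for \<delta>
    by (rule continuous_compact_support_integrable[where L = L], rule continuous_on_mult[OF gc cb[OF that]])
      (simp add: supp)
  \<comment> \<open>The \<open>cnj\<close>-derivative of \<open>g\<close> times the truncated kernel
    has integral 0. For \<open>\<delta> < e\<close> the truncation is invisible to \<open>b\<close>,
    so the Cauchy integral equals minus a weighted mean of \<open>g\<close> over the ball of radius
    \<open>\<delta>\<close>.\<close>
  have i2: "integrable lborel (\<lambda>w. b w / (w - z))
     \<and> (\<integral>w. b w / (w - z) \<partial>lborel) = - (\<integral>w. g w * complex_of_real (bump ((w - z) /\<^sub>R \<delta>) / \<delta>\<^sup>2) \<partial>lborel)"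
    if "0 < \<delta>" "\<delta> < e" for \<delta>
  proof -
    note * = integral_dbar_zero[OF dk[OF that(1)], of L]
    have "integrable lborel (\<lambda>w. (g w * of_real (bump ((w - z) /\<^sub>R \<delta>) / \<delta>\<^sup>2) + b w * cauchy_kernel \<delta> (w - z))
        - g w * complex_of_real (bump ((w - z) /\<^sub>R \<delta>) / \<delta>\<^sup>2))"
      by (intro Bochner_Integration.integrable_diff * i1 that) (simp add: supp)
    then have i: "integrable lborel (\<lambda>w. b w / (w - z))" using eq[OF that] by simp
    have "0 = (\<integral>w. g w * of_real (bump ((w - z) /\<^sub>R \<delta>) / \<delta>\<^sup>2) + b w / (w - z) \<partial>lborel)"
      using *(2) supp eq[OF that] by simp
    also have "\<dots> = (\<integral>w. g w * of_real (bump ((w - z) /\<^sub>R \<delta>) / \<delta>\<^sup>2) \<partial>lborel) + (\<integral>w. b w / (w - z) \<partial>lborel)"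
      by (rule Bochner_Integration.integral_add[OF i1[OF that(1)] i])
    finally show ?thesis using i by (simp add: eq_neg_iff_add_eq_0 add.commute)
  qed
  show "integrable lborel (\<lambda>w. b w / (w - z))" using i2[of "e/2"] e by simp
  define X where "X = (\<integral>w. b w / (w - z) \<partial>lborel)"
  \<comment> \<open>As \<open>\<delta>\<close> shrinks, continuity of \<open>g\<close> makes the
    mean tend to \<open>bump_mass * g z\<close>, while the Cauchy integral \<open>X\<close> does not
    change.\<close>
  have "cmod (X + of_real bump_mass * g z) \<le> bump_mass * \<tau>" if \<tau>: "\<tau> > 0" for \<tau>
  proof -
    have "isCont g z" using gc continuous_on_eq_continuous_at by blast
    then obtain d where d: "d > 0" "\<And>w. cmod (w - z) < d \<Longrightarrow> cmod (g w - g z) < \<tau>"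
      using \<tau> unfolding continuous_at_eps_delta by (auto simp: dist_norm)
    define \<delta> where "\<delta> = min d e / 2"
    have \<delta>: "\<delta> > 0" "\<delta> < e" "\<delta> < d" using d e by (auto simp: \<delta>_def)
    let ?\<beta> = "\<lambda>w. bump ((w - z) /\<^sub>R \<delta>) / \<delta>\<^sup>2"
    have ib: "integrable lborel ?\<beta>" and mb: "(\<integral>w. ?\<beta> w \<partial>lborel) = bump_mass"
      using integral_bump_scaled[OF \<delta>(1)] by auto
    have mbc: "(\<integral>w. complex_of_real (?\<beta> w) \<partial>lborel) = of_real bump_mass"
      using ib mb by (simp only: integral_complex_of_real)
    have ibc: "integrable lborel (\<lambda>w. g z * complex_of_real (?\<beta> w))"
      by (intro integrable_mult_right integrable_of_real ib)
    have "- (X + of_real bump_mass * g z) = (\<integral>w. g w * complex_of_real (?\<beta> w) \<partial>lborel)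
        - (\<integral>w. g z * complex_of_real (?\<beta> w) \<partial>lborel)"
      unfolding integral_mult_right_zero mbc
      using i2[OF \<delta>(1,2)] by (simp only: X_def mult.commute[of "g z"] minus_add_distrib minus_minus
          diff_conv_add_uminus)
    also have "\<dots> = (\<integral>w. g w * complex_of_real (?\<beta> w) - g z * complex_of_real (?\<beta> w) \<partial>lborel)"
      by (rule Bochner_Integration.integral_diff[OF i1[OF \<delta>(1)] ibc, symmetric])
    finally have "cmod (X + of_real bump_mass * g z)
        = cmod (\<integral>w. g w * complex_of_real (?\<beta> w) - g z * complex_of_real (?\<beta> w) \<partial>lborel)"
      by (metis norm_minus_cancel)
    also have "\<dots> \<le> (\<integral>w. ?\<beta> w * \<tau> \<partial>lborel)"
    proof (rule Bochner_Integration.integral_norm_bound_integral)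
      show "integrable lborel (\<lambda>w. g w * complex_of_real (?\<beta> w) - g z * complex_of_real (?\<beta> w))"
        by (intro Bochner_Integration.integrable_diff i1 \<delta> ibc)
      show "integrable lborel (\<lambda>w. ?\<beta> w * \<tau>)" by (intro integrable_mult_left ib)
      fix w
      have \<beta>0: "?\<beta> w \<ge> 0" by (simp add: bump_nonneg)
      have "cmod (g w * complex_of_real (?\<beta> w) - g z * complex_of_real (?\<beta> w)) = cmod (g w - g z) * ?\<beta> w"
        using \<beta>0 by (simp only: left_diff_distrib[symmetric] norm_mult norm_of_real abs_of_nonneg)
      also have "\<dots> \<le> \<tau> * ?\<beta> w"
      proof (cases "cmod (w - z) < d")
        case True
        then show ?thesis using d(2)[of w] \<beta>0 by (intro mult_right_mono) auto
      next
        case False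
        then have "cmod ((w - z) /\<^sub>R \<delta>) \<ge> 1" using \<delta> by (simp add: divide_simps)
        then show ?thesis by (simp add: bump_zero)
      qed
      finally show "cmod (g w * complex_of_real (?\<beta> w) - g z * complex_of_real (?\<beta> w)) \<le> ?\<beta> w * \<tau>"
        by (simp add: mult.commute)
    qed
    also have "\<dots> = bump_mass * \<tau>" unfolding integral_mult_left_zero mb ..
    finally show ?thesis .
  qed
  then have "cmod (X + of_real bump_mass * g z) \<le> t" if "t > 0" for t
    using that bump_mass_pos by (metis divide_pos_pos nonzero_mult_div_cancel_left order_less_irrefl
        times_divide_eq_right)
  then have "cmod (X + of_real bump_mass * g z) \<le> 0" by (rule field_le_epsilon[where y = 0, simplified])
  then show "X = - of_real bump_mass * g z" by (simp add: eq_neg_iff_add_eq_0)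
qed

section \<open>Units supported in discs\<close>

definition discs_union :: "(complex \<times> real) set \<Rightarrow> complex set" where
  "discs_union D = (\<Union>(c, \<rho>)\<in>D. ball c \<rho>)"

text \<open>For nonnegative \<open>w\<close> this states that the sum over \<open>D\<close>
  converges and is at most \<open>m\<close>. It suits sets of discs that are united and enumerated
  only later.\<close>

definition sum_le :: "('a \<Rightarrow> real) \<Rightarrow> 'a set \<Rightarrow> real \<Rightarrow> bool" where
  "sum_le w D m \<longleftrightarrow> (\<forall>F. finite F \<and> F \<subseteq> D \<longrightarrow> sum w F \<le> m)"

lemma discs_union_mono: "D \<subseteq> D' \<Longrightarrow> discs_union D \<subseteq> discs_union D'"
  by (auto simp: discs_union_def)

lemma sum_le_mono: "sum_le w D m \<Longrightarrow> D' \<subseteq> D \<Longrightarrow> m \<le> m' \<Longrightarrow> sum_le w D' m'"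
  unfolding sum_le_def by (meson order_trans)

lemma sum_le_finite:
  assumes "finite D" "\<And>d. d \<in> D \<Longrightarrow> w d \<ge> 0" "sum w D \<le> m"
  shows "sum_le w D m"
  unfolding sum_le_def using assms by (meson DiffD1 order_trans sum_mono2)

lemma sum_le_UN:
  fixes D :: "nat \<Rightarrow> 'a set"
  assumes D: "\<And>i. sum_le w (D i) (b i)" and w: "\<And>d. w d \<ge> 0"
    and b: "\<And>n. (\<Sum>i<n. b i) \<le> B"
  shows "sum_le w (\<Union>i. D i) B"
proof -
  have step: "sum w F \<le> (\<Sum>i<n. b i)" if "finite F" "F \<subseteq> (\<Union>i<n. D i)" for F and n :: nat
    using that
  proof (induction n arbitrary: F)
    case (Suc n)
    have "sum w F = sum w (F - D n) + sum w (F \<inter> D n)"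
      using Suc.prems(1) by (metis Diff_Int_distrib2 Int_Diff add.commute sum.Int_Diff)
    moreover have "sum w (F - D n) \<le> (\<Sum>i<n. b i)"
      using Suc.prems by (intro Suc.IH) (auto simp: lessThan_Suc)
    moreover have "sum w (F \<inter> D n) \<le> b n"
      using D[of n] Suc.prems unfolding sum_le_def by auto
    ultimately show ?case by simp
  qed auto
  show ?thesis unfolding sum_le_def
  proof (intro allI impI)
    fix F assume F: "finite F \<and> F \<subseteq> (\<Union>i. D i)"
    then obtain i where i: "\<And>x. x \<in> F \<Longrightarrow> x \<in> D (i x)"
      by (metis UN_E subsetD)
    have "i x < Suc (Max (i ` F))" if "x \<in> F" for x
      using F that by (simp add: le_imp_less_Suc)
    then have "F \<subseteq> (\<Union>i<Suc (Max (i ` F)). D i)" using i by blast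
    then show "sum w F \<le> B" using step[of F] F b by (meson order_trans)
  qed
qed

section \<open>Rational functions that step across a circle\<close>

lemma norm_exp_diff_1:
  assumes "cmod u \<le> 1"
  shows "cmod (exp u - 1) \<le> 3 * cmod u"
proof -
  have "cmod (exp u - exp 0) \<le> 3 * cmod (u - 0)"
  proof (rule field_differentiable_bound[where S = "cball 0 1" and f' = exp])
    fix z :: complex assume "z \<in> cball 0 1"
    then have "exp (cmod z) \<le> exp 1" by simp
    also have "exp 1 \<le> (3::real)" by (rule exp_le)
    finally show "cmod (exp z) \<le> 3" using norm_exp[of z] by linarith
  qed (use assms in \<open>auto intro: DERIV_exp has_field_derivative_at_within\<close>)
  then show ?thesis by simp
qed

text \<open>If \<open>v ^ n\<close> is near 1, then \<open>u = Ln (v ^ n) / n\<close> is small and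
  \<open>v * exp (- u)\<close> is a root of unity. Its distance from \<open>v\<close> is at most
  \<open>3 * cmod u\<close>, and \<open>cmod (Ln (1 + x)) \<le> 2 * cmod x\<close>; together this is
  the factor 6.\<close>

lemma norm_power_diff_1_ge:
  fixes v :: complex
  assumes n: "n > 0" and t: "\<And>\<omega>. \<omega> ^ n = 1 \<Longrightarrow> cmod (v - \<omega>) \<ge> t"
  shows "cmod (v ^ n - 1) \<ge> min (1/2) (real n * t / 6)"
proof (cases "cmod (v ^ n - 1) < 1/2")
  case True
  define x where "x = v ^ n - 1"
  define \<zeta> where "\<zeta> = Ln (1 + x)"
  have nz: "1 + x \<noteq> 0"
  proof
    assume "1 + x = 0" then have "x = -1" by (simp add: add_eq_0_iff)
    then show False using True by (simp add: x_def[symmetric])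
  qed
  have \<zeta>: "cmod \<zeta> \<le> 2 * cmod x" using norm_Ln_le[of x] True by (simp add: \<zeta>_def x_def)
  have ex: "exp \<zeta> = v ^ n" using nz by (simp add: \<zeta>_def x_def)
  define u where "u = \<zeta> / of_nat n"
  define \<omega> where "\<omega> = v * exp (- u)"
  have "\<omega> ^ n = v ^ n * exp (- \<zeta>)"
    using n by (simp add: \<omega>_def u_def power_mult_distrib exp_of_nat_mult[symmetric])
  then have \<omega>: "\<omega> ^ n = 1" by (simp add: ex[symmetric] exp_minus)
  then have "cmod \<omega> ^ n = 1" unfolding norm_power[symmetric] by simp
  then have n\<omega>: "cmod \<omega> = 1" using n power_eq_imp_eq_base[of "cmod \<omega>" n 1] by simp
  have u: "cmod u \<le> 1"
  proof -
    have "cmod u \<le> cmod \<zeta> / 1" unfolding u_def norm_divide norm_of_nat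
      using n by (intro divide_left_mono) auto
    then show ?thesis using \<zeta> True by (simp add: x_def)
  qed
  have "v - \<omega> = \<omega> * (exp u - 1)"
    by (simp add: \<omega>_def algebra_simps exp_minus)
  then have "cmod (v - \<omega>) = cmod (exp u - 1)" by (simp add: norm_mult n\<omega>)
  also have "\<dots> \<le> 3 * cmod u" by (rule norm_exp_diff_1[OF u])
  also have "\<dots> = 3 * cmod \<zeta> / n" by (simp add: u_def norm_divide)
  also have "\<dots> \<le> 3 * (2 * cmod x) / n" using \<zeta> by (intro divide_right_mono mult_left_mono) auto
  finally have "t \<le> 6 * cmod x / n" using t[OF \<omega>] by simp
  then show ?thesis using n by (simp add: x_def field_simps)
qed auto

text \<open>The bound off the discs involves only \<open>r\<close> and the total radius
  \<open>m\<close>, not the precision \<open>q\<close> or the width \<open>\<gamma>\<close>. Thus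
  \<open>q\<close> can be made small after this bound is known.\<close>

definition circle_step ::
    "complex \<Rightarrow> real \<Rightarrow> real \<Rightarrow> real \<Rightarrow> real \<Rightarrow> (complex \<times> real) set \<Rightarrow> (complex \<Rightarrow> complex) \<Rightarrow> bool" where
  "circle_step a r \<gamma> q m D E \<longleftrightarrow> finite D \<and> (\<forall>c \<rho>. (c, \<rho>) \<in> D \<longrightarrow> \<rho> > 0) \<and> sum snd D \<le> m \<and>
     discs_union D \<subseteq> {z. r - \<gamma> < cmod (z - a) \<and> cmod (z - a) < r + \<gamma>} \<and>
     (\<forall>K. compact K \<longrightarrow> K \<inter> discs_union D = {} \<longrightarrow> in_R K E) \<and>
     (\<forall>z. cmod (z - a) \<le> r - \<gamma> \<longrightarrow> cmod (E z - 1) \<le> q) \<and>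
     (\<forall>z. cmod (z - a) \<ge> r + \<gamma> \<longrightarrow> cmod (E z) \<le> q) \<and>
     (\<forall>z. z \<notin> discs_union D \<longrightarrow> cmod (E z) \<le> 2 + 12 * r / m)"

text \<open>The function is \<open>1 / (1 - ((z - a) / r) ^ n)\<close> for large \<open>n\<close>,
  with poles at \<open>n\<close> equally spaced points of the circle. Discs of radius
  \<open>m / (2 * n)\<close> about them have total radius \<open>m / 2\<close>; off them the
  denominator is at least \<open>min (1/2) (m / (12 * r))\<close> by
  \<open>norm_power_diff_1_ge\<close>, because \<open>n\<close> cancels.\<close>

lemma circle_step_exists:
  fixes a :: complex
  assumes r: "0 < \<gamma>" "\<gamma> < r" and q: "q > 0" and m: "m > 0"
  shows "\<exists>D E. circle_step a r \<gamma> q m D E"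
proof -
  define x where "x = 1 - \<gamma> / r"
  define y where "y = 1 + \<gamma> / r"
  have x: "0 \<le> x" "x < 1" using r by (auto simp: x_def field_simps)
  have y: "y > 1" using r by (auto simp: y_def field_simps)
  have e1: "\<forall>\<^sub>F n in sequentially. x ^ n < min (1/2) (q/2)"
    using LIMSEQ_power_zero[of x] x q by (intro order_tendstoD) auto
  have e2: "\<forall>\<^sub>F n in sequentially. y ^ n \<ge> 1 + 1 / q"
  proof -
    obtain N where "1 + 1 / q < y ^ N" using real_arch_pow[OF y] by blast
    then have "1 + 1 / q \<le> y ^ n" if "n \<ge> N" for n
      using power_increasing[OF that, of y] y by linarith
    then show ?thesis by (rule eventually_sequentiallyI)
  qed
  have e3: "\<forall>\<^sub>F n in sequentially. m / 2 / real n < \<gamma>"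
    using lim_const_over_n[of "m/2"] r by (intro order_tendstoD) auto
  obtain n where n: "n > 0" "x ^ n < min (1/2) (q/2)" "y ^ n \<ge> 1 + 1 / q" "m / 2 / real n < \<gamma>"
  proof -
    have "\<forall>\<^sub>F n in sequentially. n > 0 \<and> x ^ n < min (1/2) (q/2) \<and> y ^ n \<ge> 1 + 1 / q \<and> m / 2 / real n < \<gamma>"
      using e1 e2 e3 eventually_gt_at_top[of 0] by eventually_elim blast
    then show ?thesis using that by (auto dest!: eventually_happens)
  qed
  define \<rho> where "\<rho> = m / 2 / real n"
  have \<rho>: "\<rho> > 0" "\<rho> < \<gamma>" using m n by (auto simp: \<rho>_def)
  define W where "W = {\<omega>::complex. \<omega> ^ n = 1}"
  have W: "finite W" "card W = n" using n card_roots_unity_eq[of n] finite_roots_unity[of n]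
    by (auto simp: W_def Suc_le_eq)
  have W1: "cmod \<omega> = 1" if "\<omega> \<in> W" for \<omega>
  proof -
    have "\<omega> ^ n = 1" using that by (simp add: W_def)
    then have "cmod \<omega> ^ n = 1" unfolding norm_power[symmetric] by simp
    then show ?thesis using n power_eq_imp_eq_base[of "cmod \<omega>" n 1] by simp
  qed
  define D where "D = (\<lambda>\<omega>. (a + of_real r * \<omega>, \<rho>)) ` W"
  define E where "E z = 1 / (1 - ((z - a) / of_real r) ^ n)" for z
  have D: "(c, \<rho>') \<in> D \<longleftrightarrow> \<rho>' = \<rho> \<and> (\<exists>\<omega>\<in>W. c = a + of_real r * \<omega>)" for c \<rho>'
    by (auto simp: D_def)
  have off: "cmod ((z - a) / of_real r - \<omega>) \<ge> \<rho> / r" if "z \<notin> discs_union D" "\<omega> \<in> W" for z \<omega>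
  proof -
    have "z \<notin> ball (a + of_real r * \<omega>) \<rho>"
      using that by (auto simp: discs_union_def D_def)
    then have "\<rho> \<le> cmod (z - (a + of_real r * \<omega>))" by (simp add: dist_norm norm_minus_commute)
    also have "z - (a + of_real r * \<omega>) = of_real r * ((z - a) / of_real r - \<omega>)"
      using r by (simp add: field_simps)
    finally have "\<rho> \<le> \<bar>r\<bar> * cmod ((z - a) / of_real r - \<omega>)"
      unfolding norm_mult norm_of_real .
    then show ?thesis using r by (simp only: abs_of_pos pos_divide_le_eq mult.commute)
  qed
  have lb: "cmod (1 - ((z - a) / of_real r) ^ n) \<ge> min (1/2) (m / (12 * r))" if "z \<notin> discs_union D" for z
  proof -
    have "cmod (((z - a) / of_real r) ^ n - 1) \<ge> min (1/2) (real n * (\<rho> / r) / 6)"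
      using off[OF that] n by (intro norm_power_diff_1_ge) (auto simp: W_def)
    also have "real n * (\<rho> / r) / 6 = m / (12 * r)" using n by (simp add: \<rho>_def)
    finally show ?thesis by (simp add: norm_minus_commute)
  qed
  have pos: "min (1/2) (m / (12 * r)) > 0" using m r by auto
  have "circle_step a r \<gamma> q m D E"
    unfolding circle_step_def
  proof (intro conjI allI impI)
    show "finite D" using W by (simp add: D_def)
    show "\<rho>' > 0" if "(c, \<rho>') \<in> D" for c \<rho>' using that D \<rho> by simp
    have "inj_on (\<lambda>\<omega>. (a + of_real r * \<omega>, \<rho>)) W" using r by (auto simp: inj_on_def)
    then have "sum snd D = (\<Sum>\<omega>\<in>W. \<rho>)" unfolding D_def by (simp add: sum.reindex)
    also have "\<dots> \<le> m" using W n m by (simp add: \<rho>_def)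
    finally show "sum snd D \<le> m" .
    show "discs_union D \<subseteq> {z. r - \<gamma> < cmod (z - a) \<and> cmod (z - a) < r + \<gamma>}"
    proof
      fix z assume "z \<in> discs_union D"
      then obtain \<omega> where \<omega>: "\<omega> \<in> W" "cmod (z - a - of_real r * \<omega>) < \<rho>"
        by (auto simp: discs_union_def D_def dist_norm norm_minus_commute algebra_simps)
      have "cmod (of_real r * \<omega>) = r" using r W1[OF \<omega>(1)] by (simp add: norm_mult)
      then have "\<bar>cmod (z - a) - r\<bar> \<le> cmod (z - a - of_real r * \<omega>)"
        by (metis norm_triangle_ineq3)
      then show "z \<in> {z. r - \<gamma> < cmod (z - a) \<and> cmod (z - a) < r + \<gamma>}" using \<omega>(2) \<rho> by auto
    qed
    show "in_R K E" if K: "compact K" "K \<inter> discs_union D = {}" for K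
      unfolding E_def
    proof (rule in_R_inverse[OF K(1)])
      have "in_R K (\<lambda>z. 1 - ((z - a) * (1 / of_real r)) ^ n)"
        by (intro in_R_diff in_R_const in_R_power in_R_mult in_R_id K)
      then show "in_R K (\<lambda>z. 1 - ((z - a) / of_real r) ^ n)" by simp
      show "1 - ((z - a) / of_real r) ^ n \<noteq> 0" if "z \<in> K" for z
      proof
        assume "1 - ((z - a) / of_real r) ^ n = 0"
        then show False using lb[of z] pos K(2) that by (metis disjoint_iff norm_zero not_le)
      qed
    qed
    show "cmod (E z) \<le> 2 + 12 * r / m" if "z \<notin> discs_union D" for z
    proof -
      have "cmod (E z) \<le> 1 / min (1/2) (m / (12 * r))"
        unfolding E_def norm_divide norm_one using lb[OF that] pos by (intro frac_le) auto
      also have "\<dots> \<le> 2 + 12 * r / m" using m r by (auto simp: min_def)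
      finally show ?thesis .
    qed
    show "cmod (E z - 1) \<le> q" if "cmod (z - a) \<le> r - \<gamma>" for z
    proof -
      define v where "v = ((z - a) / of_real r) ^ n"
      have "cmod v = (cmod (z - a) / r) ^ n" using r by (simp add: v_def norm_power norm_divide)
      also have "\<dots> \<le> x ^ n" using that r by (intro power_mono) (auto simp: x_def field_simps)
      finally have v: "cmod v < 1/2" "cmod v < q/2" using n by auto
      have "1 - cmod v \<le> cmod (1 - v)" using norm_triangle_ineq2[of 1 v] by simp
      then have v': "1/2 \<le> cmod (1 - v)" using v by simp
      then have "1 - v \<noteq> 0" by auto
      moreover have "E z = 1 / (1 - v)" by (simp only: E_def v_def)
      ultimately have "E z - 1 = v / (1 - v)" by (simp add: field_simps)
      then have "cmod (E z - 1) = cmod v / cmod (1 - v)" by (simp add: norm_divide)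
      also have "\<dots> \<le> cmod v / (1/2)" using v' by (intro divide_left_mono) auto
      finally have "cmod (E z - 1) \<le> cmod v / (1/2)" .
      then show ?thesis using v by simp
    qed
    show "cmod (E z) \<le> q" if "cmod (z - a) \<ge> r + \<gamma>" for z
    proof -
      define v where "v = ((z - a) / of_real r) ^ n"
      have "y = (r + \<gamma>) / r" using r by (simp add: y_def add_divide_distrib)
      then have "y \<le> cmod (z - a) / r" using that r by (simp add: divide_right_mono)
      then have "y ^ n \<le> (cmod (z - a) / r) ^ n" using y by (intro power_mono) auto
      also have "\<dots> = cmod v" using r by (simp add: v_def norm_power norm_divide)
      finally have v: "cmod v \<ge> 1 + 1/q" using n by auto
      have "cmod v - 1 \<le> cmod (1 - v)" using norm_triangle_ineq2[of v 1] by (simp add: norm_minus_commute)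
      then have "1/q \<le> cmod (1 - v)" using v by simp
      then have "cmod (E z) \<le> 1 / (1/q)"
        unfolding E_def v_def[symmetric] norm_divide norm_one using q by (intro frac_le) auto
      then show ?thesis by simp
    qed
  qed
  then show ?thesis by blast
qed

text \<open>One step of the construction: \<open>u\<close> is replaced by \<open>E' + u E (1 - E')\<close>, where \<open>E'\<close> and \<open>E\<close> step
  across circles inside the region where \<open>u\<close> is almost 1 and almost 0, respectively. There the
  factors \<open>1 - u E\<close> and \<open>u\<close> compensate for the size of \<open>E'\<close> and \<open>E\<close> near their poles.\<close>

lemma annulus_step:
  fixes a :: complex
  assumes R: "0 < R" "R < \<alpha>" "\<alpha> < \<beta>" "\<beta> < 2 * R" and m: "0 < m"
    and M: "M = 2 + 24 * R / m" and \<tau>: "0 < \<tau>" "\<tau> * M \<le> \<epsilon> / 4" and \<epsilon>: "0 < \<epsilon>" "\<epsilon> \<le> 1" and \<tau>': "0 < \<tau>'"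
    and u1: "\<And>z. cmod (z - a) \<le> \<alpha> \<Longrightarrow> cmod (u z - 1) \<le> \<tau>"
    and u0: "\<And>z. cmod (z - a) \<ge> \<beta> \<Longrightarrow> cmod (u z) \<le> \<tau>"
    and uB: "\<And>z. z \<notin> discs_union D \<Longrightarrow> cmod (u z) \<le> B"
    and uR: "\<And>K. compact K \<Longrightarrow> K \<inter> discs_union D = {} \<Longrightarrow> in_R K u"
  obtains D' u' \<alpha>' \<beta>' where "finite D'" "\<And>c \<rho>. (c, \<rho>) \<in> D' \<Longrightarrow> \<rho> > 0" "sum snd D' \<le> 2 * m"
    "discs_union D' \<subseteq> {z. R < cmod (z - a) \<and> cmod (z - a) < 2 * R}"
    "\<And>K. compact K \<Longrightarrow> K \<inter> discs_union (D \<union> D') = {} \<Longrightarrow> in_R K u'"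
    "R < \<alpha>'" "\<alpha>' < \<beta>'" "\<beta>' < 2 * R"
    "\<And>z. cmod (z - a) \<le> \<alpha>' \<Longrightarrow> cmod (u' z - 1) \<le> \<tau>'"
    "\<And>z. cmod (z - a) \<ge> \<beta>' \<Longrightarrow> cmod (u' z) \<le> \<tau>'"
    "\<And>z. z \<notin> discs_union (D \<union> D') \<Longrightarrow> cmod (u' z - u z) \<le> \<epsilon>"
proof -
  have M2: "M \<ge> 2" using R m M by simp
  have \<tau>1: "\<tau> \<le> \<epsilon> / 8" using \<tau> M2 mult_left_mono[of 2 M \<tau>] by linarith
  define B' where "B' = max B 0"
  \<comment> \<open>The first bound serves the new precision \<open>\<tau>'\<close>. The second
    makes every error that carries a factor \<open>q\<close>, even multiplied by \<open>M\<close> or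
    \<open>B'\<close>, negligible against \<open>\<epsilon>\<close>.\<close>
  define q where "q = min (\<tau>' / 3) (\<epsilon> / (4 * (2 * M + 3 * B' + 4)))"
  have den: "4 * (2 * M + 3 * B' + 4) > 0" using M2 by (simp add: B'_def add_pos_nonneg)
  have q: "q > 0" using \<tau>' \<epsilon> den by (simp add: q_def)
  have "q \<le> \<epsilon> / (4 * (2 * M + 3 * B' + 4))" by (simp add: q_def)
  then have "q * (4 * (2 * M + 3 * B' + 4)) \<le> \<epsilon>" using den by (simp add: pos_le_divide_eq)
  then have qs: "8 * (q * M) + 12 * (q * B') + 16 * q \<le> \<epsilon>" by (simp add: algebra_simps)
  have qM: "q * M \<ge> 0" "q * B' \<ge> 0" using q M2 by (auto simp: B'_def)
  have q1: "q \<le> 1" using qs qM \<epsilon> by linarith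
  have q\<tau>: "q \<le> \<tau>' / 3" unfolding q_def by (rule min.cobounded1)
  \<comment> \<open>The two annuli of half-widths \<open>g1\<close> and \<open>g2\<close> lie
    strictly between \<open>R\<close> and \<open>\<alpha>\<close>, and strictly between
    \<open>\<beta>\<close> and \<open>2 * R\<close>.\<close>
  define r1 where "r1 = (R + \<alpha>) / 2"
  define g1 where "g1 = (\<alpha> - R) / 4"
  define r2 where "r2 = (\<beta> + 2 * R) / 2"
  define g2 where "g2 = (2 * R - \<beta>) / 4"
  have g: "0 < g1" "g1 < r1" "0 < g2" "g2 < r2" using R by (auto simp: r1_def g1_def r2_def g2_def)
  obtain D1 E1 where S1: "circle_step a r1 g1 q m D1 E1"
    using circle_step_exists[OF g(1,2) q m] by blast
  then have E1: "finite D1" "\<And>c \<rho>. (c, \<rho>) \<in> D1 \<Longrightarrow> \<rho> > 0" "sum snd D1 \<le> m"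
    "discs_union D1 \<subseteq> {z. r1 - g1 < cmod (z - a) \<and> cmod (z - a) < r1 + g1}"
    "\<And>K. compact K \<Longrightarrow> K \<inter> discs_union D1 = {} \<Longrightarrow> in_R K E1"
    "\<And>z. cmod (z - a) \<le> r1 - g1 \<Longrightarrow> cmod (E1 z - 1) \<le> q"
    "\<And>z. cmod (z - a) \<ge> r1 + g1 \<Longrightarrow> cmod (E1 z) \<le> q"
    "\<And>z. z \<notin> discs_union D1 \<Longrightarrow> cmod (E1 z) \<le> 2 + 12 * r1 / m"
    unfolding circle_step_def by blast+
  obtain D2 E2 where S2: "circle_step a r2 g2 q m D2 E2"
    using circle_step_exists[OF g(3,4) q m] by blast
  then have E2: "finite D2" "\<And>c \<rho>. (c, \<rho>) \<in> D2 \<Longrightarrow> \<rho> > 0" "sum snd D2 \<le> m"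
    "discs_union D2 \<subseteq> {z. r2 - g2 < cmod (z - a) \<and> cmod (z - a) < r2 + g2}"
    "\<And>K. compact K \<Longrightarrow> K \<inter> discs_union D2 = {} \<Longrightarrow> in_R K E2"
    "\<And>z. cmod (z - a) \<le> r2 - g2 \<Longrightarrow> cmod (E2 z - 1) \<le> q"
    "\<And>z. cmod (z - a) \<ge> r2 + g2 \<Longrightarrow> cmod (E2 z) \<le> q"
    "\<And>z. z \<notin> discs_union D2 \<Longrightarrow> cmod (E2 z) \<le> 2 + 12 * r2 / m"
    unfolding circle_step_def by blast+
  have un: "discs_union (A \<union> A') = discs_union A \<union> discs_union A'" for A A'
    by (auto simp: discs_union_def)
  have E1M: "cmod (E1 z) \<le> M" if "z \<notin> discs_union D1" for z
  proof -
    have "12 * r1 / m \<le> 24 * R / m" using R m by (intro divide_right_mono) (auto simp: r1_def)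
    then show ?thesis using E1(8)[OF that] M by linarith
  qed
  have E2M: "cmod (E2 z) \<le> M" if "z \<notin> discs_union D2" for z
  proof -
    have "12 * r2 / m \<le> 24 * R / m" using R m by (intro divide_right_mono) (auto simp: r2_def)
    then show ?thesis using E2(8)[OF that] M by linarith
  qed
  define u' where "u' z = E1 z + u z * E2 z * (1 - E1 z)" for z
  have ord: "r1 + g1 \<le> \<alpha>" "r2 - g2 \<ge> \<beta>" "r1 - g1 \<le> \<alpha>" "r2 + g2 \<ge> \<beta>" "R < r1 - g1" "r2 + g2 < 2 * R"
    using R by (auto simp: r1_def g1_def r2_def g2_def field_simps)
  have near1: "cmod (1 - u z * E2 z) \<le> \<tau> + 2 * q" if "cmod (z - a) \<le> \<alpha>" for z
  proof -
    have e: "cmod (E2 z - 1) \<le> q" using that ord R by (intro E2(6)) linarith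
    have "cmod (u z) \<le> 1 + \<tau>" using u1[OF that] norm_triangle_ineq2[of "u z" 1] by simp
    then have "cmod (u z) \<le> 2" using \<tau>1 \<epsilon> by linarith
    then have "cmod (u z * (1 - E2 z)) \<le> 2 * q"
      unfolding norm_mult using e by (intro mult_mono) (auto simp: norm_minus_commute)
    moreover have eq: "1 - u z * E2 z = (1 - u z) + u z * (1 - E2 z)" by (simp add: algebra_simps)
    moreover have "cmod (1 - u z * E2 z) \<le> cmod (1 - u z) + cmod (u z * (1 - E2 z))"
      unfolding eq by (rule norm_triangle_ineq)
    ultimately show ?thesis
      using u1[OF that] norm_minus_commute[of 1 "u z"] by linarith
  qed
  show ?thesis
  proof (rule that[of "D1 \<union> D2" u' "r1 - g1" "r2 + g2"])
    show "finite (D1 \<union> D2)" using E1 E2 by simp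
    show "\<rho> > 0" if "(c, \<rho>) \<in> D1 \<union> D2" for c \<rho> using that E1 E2 by blast
    have "sum snd (D1 \<union> D2) + sum snd (D1 \<inter> D2) = sum snd D1 + sum snd D2"
      by (rule sum.union_inter) (use E1 E2 in auto)
    moreover have "sum snd (D1 \<inter> D2) \<ge> 0"
      by (rule sum_nonneg) (use E1(2) less_imp_le in force)
    ultimately show "sum snd (D1 \<union> D2) \<le> 2 * m" using E1(3) E2(3) by linarith
    show "discs_union (D1 \<union> D2) \<subseteq> {z. R < cmod (z - a) \<and> cmod (z - a) < 2 * R}"
    proof
      fix z assume "z \<in> discs_union (D1 \<union> D2)"
      then consider "z \<in> discs_union D1" | "z \<in> discs_union D2" unfolding un by blast
      then show "z \<in> {z. R < cmod (z - a) \<and> cmod (z - a) < 2 * R}"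
      proof cases
        case 1 then show ?thesis using E1(4) ord R by fastforce
      next
        case 2 then show ?thesis using E2(4) ord R by fastforce
      qed
    qed
    show "in_R K u'" if K: "compact K" "K \<inter> discs_union (D \<union> (D1 \<union> D2)) = {}" for K
      unfolding u'_def using K
      by (intro in_R_add in_R_mult in_R_diff in_R_const E1(5) E2(5) uR) (auto simp: un)
    show "R < r1 - g1" "r1 - g1 < r2 + g2" "r2 + g2 < 2 * R" using ord R by linarith+
    show "cmod (u' z - 1) \<le> \<tau>'" if z: "cmod (z - a) \<le> r1 - g1" for z
    proof -
      have "u' z - 1 = (1 - u z * E2 z) * (E1 z - 1)" by (simp add: u'_def algebra_simps)
      then have "cmod (u' z - 1) = cmod (1 - u z * E2 z) * cmod (E1 z - 1)" by (simp add: norm_mult)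
      also have "\<dots> \<le> 3 * q"
        using near1[of z] z ord E1(6)[OF z] \<tau>1 q1 \<epsilon> by (intro mult_mono) auto
      finally show ?thesis using q\<tau> by linarith
    qed
    show "cmod (u' z) \<le> \<tau>'" if z: "cmod (z - a) \<ge> r2 + g2" for z
    proof -
      have e1: "cmod (E1 z) \<le> q" using z ord R by (intro E1(7)) linarith
      have e2: "cmod (E2 z) \<le> q" by (rule E2(7)[OF z])
      have e3: "cmod (u z) \<le> 1" using u0[of z] z ord \<tau>1 \<epsilon> by linarith
      have e4: "cmod (1 - E1 z) \<le> 2" using e1 q1 norm_triangle_ineq4[of 1 "E1 z"] by simp
      have "cmod (u z * E2 z * (1 - E1 z)) \<le> 1 * q * 2"
        unfolding norm_mult using e1 e2 e3 e4 q by (intro mult_mono) auto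
      then show ?thesis unfolding u'_def
        using norm_triangle_ineq[of "E1 z" "u z * E2 z * (1 - E1 z)"] e1 q\<tau> by linarith
    qed
    show "cmod (u' z - u z) \<le> \<epsilon>" if "z \<notin> discs_union (D \<union> (D1 \<union> D2))" for z
    proof -
      have z: "z \<notin> discs_union D" "z \<notin> discs_union D1" "z \<notin> discs_union D2" using that by (auto simp: un)
      have "u' z - u z = E1 z * (1 - u z * E2 z) + u z * (E2 z - 1)"
        by (simp add: u'_def algebra_simps)
      then have d: "cmod (u' z - u z) \<le> cmod (E1 z) * cmod (1 - u z * E2 z) + cmod (u z) * cmod (E2 z - 1)"
        using norm_triangle_ineq[of "E1 z * (1 - u z * E2 z)" "u z * (E2 z - 1)"] by (simp add: norm_mult)
      \<comment> \<open>The poles of \<open>E1\<close> lie in the first region, those of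
        \<open>E2\<close> in the third; there the hypothesis
        \<open>\<tau> * M \<le> \<epsilon> / 4\<close> controls the products with large factors. In
        the middle \<open>u\<close> is merely bounded, but \<open>E1\<close> and \<open>E2\<close>
        are within \<open>q\<close> of 0 and 1.\<close>
      consider "cmod (z - a) \<le> \<alpha>" | "\<alpha> \<le> cmod (z - a)" "cmod (z - a) \<le> \<beta>" | "\<beta> \<le> cmod (z - a)" by linarith
      then show ?thesis
      proof cases
        case 1
        have "cmod (E1 z) * cmod (1 - u z * E2 z) \<le> M * (\<tau> + 2 * q)"
          using near1[OF 1] E1M[OF z(2)] M2 by (intro mult_mono) auto
        moreover have "cmod (u z) * cmod (E2 z - 1) \<le> 2 * q"
        proof (intro mult_mono)
          show "cmod (u z) \<le> 2"
            using u1[OF 1] norm_triangle_ineq2[of "u z" 1] \<tau>1 \<epsilon> by simp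
          show "cmod (E2 z - 1) \<le> q" using 1 ord R by (intro E2(6)) linarith
        qed auto
        moreover have "M * (\<tau> + 2 * q) = \<tau> * M + 2 * (q * M)" by (simp add: algebra_simps)
        ultimately show ?thesis using d \<tau>(2) qs qM q \<epsilon> by linarith
      next
        case 2
        have B: "cmod (u z) \<le> B'" using uB[OF z(1)] by (simp add: B'_def)
        have e1: "cmod (E1 z) \<le> q" using 2 ord by (intro E1(7)) linarith
        have e2: "cmod (E2 z - 1) \<le> q" using 2 ord by (intro E2(6)) linarith
        have "cmod (E2 z) \<le> 2" using e2 q1 norm_triangle_ineq2[of "E2 z" 1] by simp
        then have "cmod (u z * E2 z) \<le> B' * 2"
          unfolding norm_mult using B by (intro mult_mono) (auto simp: B'_def)
        then have "cmod (1 - u z * E2 z) \<le> 1 + 2 * B'"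
          using norm_triangle_ineq4[of 1 "u z * E2 z"] by simp
        then have "cmod (E1 z) * cmod (1 - u z * E2 z) \<le> q * (1 + 2 * B')"
          using e1 q by (intro mult_mono) auto
        moreover have "cmod (u z) * cmod (E2 z - 1) \<le> B' * q"
          using B e2 by (intro mult_mono) (auto simp: B'_def)
        moreover have "q * (1 + 2 * B') + B' * q = q + 3 * (q * B')" by (simp add: algebra_simps)
        ultimately show ?thesis using d qs qM q \<epsilon> by linarith
      next
        case 3
        have e0: "cmod (u z) \<le> \<tau>" by (rule u0[OF 3])
        have e1: "cmod (E1 z) \<le> q" using 3 ord R by (intro E1(7)) linarith
        have "cmod (u z * E2 z) \<le> \<tau> * M"
          unfolding norm_mult using e0 E2M[OF z(3)] \<tau> by (intro mult_mono) auto
        then have "cmod (1 - u z * E2 z) \<le> 2"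
          using norm_triangle_ineq4[of 1 "u z * E2 z"] \<tau>(2) \<epsilon> by simp
        then have "cmod (E1 z) * cmod (1 - u z * E2 z) \<le> q * 2"
          using e1 q by (intro mult_mono) auto
        moreover have "cmod (E2 z - 1) \<le> M + 1"
          using E2M[OF z(3)] norm_triangle_ineq4[of "E2 z" 1] by simp
        then have "cmod (u z) * cmod (E2 z - 1) \<le> \<tau> * (M + 1)"
          using e0 \<tau> by (intro mult_mono) auto
        moreover have "\<tau> * (M + 1) = \<tau> * M + \<tau>" by (simp add: algebra_simps)
        ultimately show ?thesis using d \<tau>(2) \<tau>1 qs qM q \<epsilon> by linarith
      qed
    qed
  qed
qed

lemma half_geometric_limit:
  fixes x :: "nat \<Rightarrow> complex"
  assumes "\<And>n. cmod (x (Suc n) - x n) \<le> (1/2)^n"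
  shows "\<exists>l. x \<longlonglongrightarrow> l \<and> (\<forall>n. cmod (l - x n) \<le> 2 * (1/2)^n)"
proof -
  have b: "cmod (x (n + k) - x n) \<le> 2 * (1/2)^n - 2 * (1/2)^(n + k)" for n k
  proof (induction k)
    case (Suc k)
    have "cmod (x (n + Suc k) - x n) \<le> cmod (x (Suc (n + k)) - x (n + k)) + cmod (x (n + k) - x n)"
      using norm_triangle_ineq[of "x (Suc (n + k)) - x (n + k)" "x (n + k) - x n"] by simp
    also have "\<dots> \<le> (1/2)^(n + k) + (2 * (1/2)^n - 2 * (1/2)^(n + k))"
      using assms[of "n + k"] Suc by linarith
    finally show ?case by simp
  qed auto
  have b': "cmod (x m - x n) \<le> 2 * (1/2)^n" if "m \<ge> n" for m n
  proof -
    have "cmod (x (n + (m - n)) - x n) \<le> 2 * (1/2)^n - 2 * (1/2)^(n + (m - n))" by (rule b)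
    also have "\<dots> \<le> 2 * (1/2)^n" by simp
    finally show ?thesis using that by simp
  qed
  have "Cauchy x"
  proof (rule metric_CauchyI)
    fix e :: real assume e: "e > 0"
    then obtain N where N: "(1/2::real)^N < e / 4" using real_arch_pow_inv[of "e/4" "1/2"] by auto
    have "dist (x m) (x n) < e" if "m \<ge> N" "n \<ge> N" for m n
    proof -
      have "dist (x m) (x n) \<le> dist (x m) (x N) + dist (x n) (x N)" by (rule dist_triangle2)
      also have "\<dots> \<le> 2 * (1/2)^N + 2 * (1/2)^N"
        using b'[OF that(1)] b'[OF that(2)] by (simp add: dist_norm add_mono)
      finally show ?thesis using N by simp
    qed
    then show "\<exists>M. \<forall>m\<ge>M. \<forall>n\<ge>M. dist (x m) (x n) < e" by blast
  qed
  then obtain l where l: "x \<longlonglongrightarrow> l" using convergent_eq_Cauchy by blast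
  have "cmod (l - x n) \<le> 2 * (1/2)^n" for n
  proof (rule tendsto_upperbound)
    show "(\<lambda>m. cmod (x m - x n)) \<longlonglongrightarrow> cmod (l - x n)" by (intro tendsto_intros l)
    show "\<forall>\<^sub>F m in sequentially. cmod (x m - x n) \<le> 2 * (1/2)^n"
      using b' by (rule eventually_sequentiallyI)
  qed auto
  then show ?thesis using l by blast
qed

definition annulus_unit ::
    "complex \<Rightarrow> real \<Rightarrow> real \<Rightarrow> (complex \<times> real) set \<Rightarrow> (complex \<Rightarrow> complex) \<Rightarrow> real \<Rightarrow> bool" where
  "annulus_unit a R \<eta> D u M \<longleftrightarrow> countable D \<and> (\<forall>c \<rho>. (c, \<rho>) \<in> D \<longrightarrow> \<rho> > 0) \<and> sum_le snd D \<eta> \<and>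
     discs_union D \<subseteq> {z. R < cmod (z - a) \<and> cmod (z - a) < 2 * R} \<and>
     (\<forall>K. compact K \<longrightarrow> K \<inter> discs_union D = {} \<longrightarrow> in_R K u) \<and>
     (\<forall>z. cmod (z - a) \<le> R \<longrightarrow> u z = 1) \<and> (\<forall>z. cmod (z - a) \<ge> 2 * R \<longrightarrow> u z = 0) \<and>
     (\<forall>z. z \<notin> discs_union D \<longrightarrow> cmod (u z) \<le> M)"

text \<open>Starting from one step across the circle of radius \<open>3 * R / 2\<close>,
  \<open>annulus_step\<close> is iterated. The precision \<open>\<tau> n\<close> needed by step
  \<open>n\<close> depends only on the radius \<open>m n\<close> allotted to that step, so all
  parameters can be fixed beforehand. Off the discs the functions converge geometrically, and
  \<open>\<tau> n\<close> tending to 0 gives the exact values 1 and 0 of the limit.\<close>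

lemma annulus_unit_exists:
  assumes R: "R > 0" and \<eta>: "\<eta> > 0"
  shows "\<exists>D u M. annulus_unit a R \<eta> D u M"
proof -
  \<comment> \<open>A step uses \<open>2 * m n = \<eta> / 2 ^ (n + 2)\<close>, exactly what takes
    the bound \<open>\<eta> - \<eta> / 2 ^ (n + 1)\<close> of the invariant \<open>P\<close> to the
    next index.\<close>
  define m where "m n = \<eta> / 2 ^ (n + 3)" for n :: nat
  define M where "M n = 2 + 24 * R / m n" for n
  define \<epsilon> where "\<epsilon> n = (1/2::real) ^ n" for n :: nat
  define \<tau> where "\<tau> n = \<epsilon> n / (4 * M n)" for n
  have m: "m n > 0" for n using \<eta> by (simp add: m_def)
  have M: "M n \<ge> 2" for n using R m[of n] by (simp add: M_def)
  have \<epsilon>: "0 < \<epsilon> n" "\<epsilon> n \<le> 1" for n by (auto simp: \<epsilon>_def power_le_one)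
  have \<tau>: "\<tau> n > 0" "\<tau> n * M n \<le> \<epsilon> n / 4" for n
  proof -
    have "M n > 0" using M[of n] by linarith
    then show "\<tau> n > 0" "\<tau> n * M n \<le> \<epsilon> n / 4" using \<epsilon>[of n] by (auto simp: \<tau>_def)
  qed
  define P :: "nat \<Rightarrow> (complex \<Rightarrow> complex) \<times> (complex \<times> real) set \<times> real \<times> real \<Rightarrow> bool" where
    "P = (\<lambda>n (u, D, \<alpha>, \<beta>). finite D \<and> (\<forall>c \<rho>. (c, \<rho>) \<in> D \<longrightarrow> \<rho> > 0) \<and> sum snd D \<le> \<eta> - \<eta> / 2 ^ (n + 1) \<and>
       discs_union D \<subseteq> {z. R < cmod (z - a) \<and> cmod (z - a) < 2 * R} \<and>
       (\<forall>K. compact K \<longrightarrow> K \<inter> discs_union D = {} \<longrightarrow> in_R K u) \<and> R < \<alpha> \<and> \<alpha> < \<beta> \<and> \<beta> < 2 * R \<and>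
       (\<forall>z. cmod (z - a) \<le> \<alpha> \<longrightarrow> cmod (u z - 1) \<le> \<tau> n) \<and>
       (\<forall>z. cmod (z - a) \<ge> \<beta> \<longrightarrow> cmod (u z) \<le> \<tau> n) \<and>
       (\<exists>B. \<forall>z. z \<notin> discs_union D \<longrightarrow> cmod (u z) \<le> B))"
  define Q :: "nat \<Rightarrow> (complex \<Rightarrow> complex) \<times> (complex \<times> real) set \<times> real \<times> real
      \<Rightarrow> (complex \<Rightarrow> complex) \<times> (complex \<times> real) set \<times> real \<times> real \<Rightarrow> bool" where
    "Q = (\<lambda>n (u, D, \<alpha>, \<beta>) (u', D', \<alpha>', \<beta>'). D \<subseteq> D' \<and>
       (\<forall>z. z \<notin> discs_union D' \<longrightarrow> cmod (u' z - u z) \<le> \<epsilon> n))"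
  have "\<exists>x. P 0 x"
  proof -
    obtain D E where S: "circle_step a (3 * R / 2) (R / 4) (\<tau> 0) (\<eta> / 2) D E"
      using circle_step_exists[of "R / 4" "3 * R / 2" "\<tau> 0" "\<eta> / 2" a] R \<eta> \<tau> by auto
    have "P 0 (E, D, 3 * R / 2 - R / 4, 3 * R / 2 + R / 4)"
      using S R unfolding P_def circle_step_def by fastforce
    then show ?thesis by blast
  qed
  moreover have "\<exists>y. P (Suc n) y \<and> Q n x y" if x: "P n x" for x n
  proof -
    obtain u D \<alpha> \<beta> where xe: "x = (u, D, \<alpha>, \<beta>)" by (cases x) auto
    obtain B where B: "\<And>z. z \<notin> discs_union D \<Longrightarrow> cmod (u z) \<le> B"
      using x by (auto simp: P_def xe)
    have p: "finite D" "\<And>c \<rho>. (c, \<rho>) \<in> D \<Longrightarrow> \<rho> > 0" "sum snd D \<le> \<eta> - \<eta> / 2 ^ (n + 1)"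
       "discs_union D \<subseteq> {z. R < cmod (z - a) \<and> cmod (z - a) < 2 * R}"
       "\<And>K. compact K \<Longrightarrow> K \<inter> discs_union D = {} \<Longrightarrow> in_R K u" "R < \<alpha>" "\<alpha> < \<beta>" "\<beta> < 2 * R"
       "\<And>z. cmod (z - a) \<le> \<alpha> \<Longrightarrow> cmod (u z - 1) \<le> \<tau> n"
       "\<And>z. cmod (z - a) \<ge> \<beta> \<Longrightarrow> cmod (u z) \<le> \<tau> n"
      using x unfolding P_def xe by blast+
    show ?thesis
    proof (rule annulus_step[OF R p(6-8) m M_def \<tau> \<epsilon> \<tau>(1)[of "Suc n"] p(9) p(10) B p(5)])
      fix D' u' \<alpha>' \<beta>'
      assume q: "finite D'" "\<And>c \<rho>. (c, \<rho>) \<in> D' \<Longrightarrow> \<rho> > 0" "sum snd D' \<le> 2 * m n"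
        "discs_union D' \<subseteq> {z. R < cmod (z - a) \<and> cmod (z - a) < 2 * R}"
        "\<And>K. compact K \<Longrightarrow> K \<inter> discs_union (D \<union> D') = {} \<Longrightarrow> in_R K u'"
        "R < \<alpha>'" "\<alpha>' < \<beta>'" "\<beta>' < 2 * R"
        "\<And>z. cmod (z - a) \<le> \<alpha>' \<Longrightarrow> cmod (u' z - 1) \<le> \<tau> (Suc n)"
        "\<And>z. cmod (z - a) \<ge> \<beta>' \<Longrightarrow> cmod (u' z) \<le> \<tau> (Suc n)"
        "\<And>z. z \<notin> discs_union (D \<union> D') \<Longrightarrow> cmod (u' z - u z) \<le> \<epsilon> n"
      have un: "discs_union (D \<union> D') = discs_union D \<union> discs_union D'"
        by (auto simp: discs_union_def)
      have "sum snd (D \<union> D') + sum snd (D \<inter> D') = sum snd D + sum snd D'"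
        by (rule sum.union_inter) (use p q in auto)
      moreover have "sum snd (D \<inter> D') \<ge> 0"
        by (rule sum_nonneg) (use p(2) less_imp_le in force)
      moreover have "\<eta> - \<eta> / 2 ^ (n + 1) + 2 * m n = \<eta> - \<eta> / 2 ^ (Suc n + 1)"
        by (simp add: m_def field_simps power_add)
      ultimately have s: "sum snd (D \<union> D') \<le> \<eta> - \<eta> / 2 ^ (Suc n + 1)" using p(3) q(3) by linarith
      have bd: "cmod (u' z) \<le> B + \<epsilon> n" if "z \<notin> discs_union (D \<union> D')" for z
        using q(11)[OF that] B[of z] that norm_triangle_ineq2[of "u' z" "u z"] by (auto simp: un)
      have "P (Suc n) (u', D \<union> D', \<alpha>', \<beta>')"
        unfolding P_def prod.case
        by (intro conjI allI impI exI[of _ "B + \<epsilon> n"] bd s q(5-10))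
          (use p(1,2,4) q(1,2,4) in \<open>auto simp: un\<close>)
      moreover have "Q n x (u', D \<union> D', \<alpha>', \<beta>')"
        unfolding Q_def xe prod.case using q(11) by auto
      ultimately show ?thesis by blast
    qed
  qed
  ultimately obtain f where f: "\<And>n. P n (f n)" "\<And>n. Q n (f n) (f (Suc n))"
    using dependent_nat_choice[of P Q] by blast
  define u where "u n = fst (f n)" for n
  define D where "D n = fst (snd (f n))" for n
  define \<alpha> where "\<alpha> n = fst (snd (snd (f n)))" for n
  define \<beta> where "\<beta> n = snd (snd (snd (f n)))" for n
  have fe: "f n = (u n, D n, \<alpha> n, \<beta> n)" for n by (simp add: u_def D_def \<alpha>_def \<beta>_def)
  have p: "finite (D n)" "\<And>c \<rho>. (c, \<rho>) \<in> D n \<Longrightarrow> \<rho> > 0" "sum snd (D n) \<le> \<eta> - \<eta> / 2 ^ (n + 1)"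
     "discs_union (D n) \<subseteq> {z. R < cmod (z - a) \<and> cmod (z - a) < 2 * R}"
     "\<And>K. compact K \<Longrightarrow> K \<inter> discs_union (D n) = {} \<Longrightarrow> in_R K (u n)" "R < \<alpha> n" "\<beta> n < 2 * R"
     "\<And>z. cmod (z - a) \<le> \<alpha> n \<Longrightarrow> cmod (u n z - 1) \<le> \<tau> n"
     "\<And>z. cmod (z - a) \<ge> \<beta> n \<Longrightarrow> cmod (u n z) \<le> \<tau> n"
     "\<exists>B. \<forall>z. z \<notin> discs_union (D n) \<longrightarrow> cmod (u n z) \<le> B" for n
    using f(1)[of n] unfolding P_def fe prod.case by blast+
  have q: "D n \<subseteq> D (Suc n)" "\<And>z. z \<notin> discs_union (D (Suc n)) \<Longrightarrow> cmod (u (Suc n) z - u n z) \<le> \<epsilon> n" for n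
    using f(2)[of n] unfolding Q_def fe prod.case by blast+
  have psnd: "snd d \<ge> 0" if "d \<in> D n" for d n
    using p(2)[of "fst d" "snd d" n] that by simp
  define DD where "DD = (\<Union>n. D n)"
  have DD: "discs_union (D n) \<subseteq> discs_union DD" for n
    by (rule discs_union_mono) (auto simp: DD_def)
  have DDu: "discs_union DD = (\<Union>n. discs_union (D n))" by (auto simp: DD_def discs_union_def)
  define v where "v z = lim (\<lambda>n. u n z)" for z
  have v: "(\<lambda>n. u n z) \<longlonglongrightarrow> v z" "cmod (v z - u n z) \<le> 2 * (1/2)^n" if "z \<notin> discs_union DD" for z n
  proof -
    have "cmod (u (Suc n) z - u n z) \<le> (1/2)^n" for n
      using q(2)[of z n] that DD by (auto simp: \<epsilon>_def)
    then obtain l where l: "(\<lambda>n. u n z) \<longlonglongrightarrow> l" "\<And>n. cmod (l - u n z) \<le> 2 * (1/2)^n"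
      using half_geometric_limit[of "\<lambda>n. u n z"] by blast
    then show "(\<lambda>n. u n z) \<longlonglongrightarrow> v z" "cmod (v z - u n z) \<le> 2 * (1/2)^n"
      using limI[OF l(1)] by (auto simp: v_def)
  qed
  \<comment> \<open>The bound at stage 0 yields one for the limit, since all later changes add up to
    at most 2.\<close>
  obtain B where B: "\<And>z. z \<notin> discs_union (D 0) \<Longrightarrow> cmod (u 0 z) \<le> B" using p(10) by blast
  have \<tau>0: "\<tau> \<longlonglongrightarrow> 0"
  proof (rule tendsto_sandwich[OF _ _ tendsto_const])
    show "\<epsilon> \<longlonglongrightarrow> 0" unfolding \<epsilon>_def by (rule LIMSEQ_power_zero) simp
    have "\<tau> n \<le> \<epsilon> n" for n
    proof -
      have "\<epsilon> n / (4 * M n) \<le> \<epsilon> n / 1" using \<epsilon>[of n] M[of n] by (intro divide_left_mono) auto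
      then show ?thesis by (simp add: \<tau>_def)
    qed
    then show "\<forall>\<^sub>F n in sequentially. \<tau> n \<le> \<epsilon> n" by simp
    show "\<forall>\<^sub>F n in sequentially. 0 \<le> \<tau> n" by (intro always_eventually allI less_imp_le \<tau>(1))
  qed
  have inc: "D i \<subseteq> D n" if "i \<le> n" for i n
    using lift_Suc_mono_le[of D, OF q(1) that] .
  have out: "z \<notin> discs_union DD" if "cmod (z - a) \<le> R \<or> 2 * R \<le> cmod (z - a)" for z
    using p(4) that unfolding DDu by force
  have "annulus_unit a R \<eta> DD v (B + 2)"
    unfolding annulus_unit_def
  proof (intro conjI allI impI)
    show "countable DD" unfolding DD_def using p(1) countable_finite by auto
    show "\<rho> > 0" if "(c, \<rho>) \<in> DD" for c \<rho> using that p(2) by (auto simp: DD_def)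
    show "sum_le snd DD \<eta>"
      unfolding sum_le_def
    proof (intro allI impI)
      fix F assume F: "finite F \<and> F \<subseteq> DD"
      then obtain i where i: "\<And>x. x \<in> F \<Longrightarrow> x \<in> D (i x)"
        unfolding DD_def by (metis UN_E subsetD)
      have "i x \<le> Max (i ` F)" if "x \<in> F" for x using F that by simp
      then have "F \<subseteq> D (Max (i ` F))" using i inc by blast
      then have "sum snd F \<le> sum snd (D (Max (i ` F)))"
        using psnd by (intro sum_mono2 p(1)) auto
      also have "\<dots> \<le> \<eta>" 
        by (rule order_trans[OF p(3)]) (use \<eta> in simp)
      finally show "sum snd F \<le> \<eta>" .
    qed
    show "discs_union DD \<subseteq> {z. R < cmod (z - a) \<and> cmod (z - a) < 2 * R}"
      using p(4) unfolding DDu by blast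
    show "in_R K v" if K: "compact K" "K \<inter> discs_union DD = {}" for K
    proof (rule in_R_limit)
      fix e :: real assume "e > 0"
      then obtain n where n: "(1/2::real)^n < e / 2" using real_arch_pow_inv[of "e/2" "1/2"] by auto
      have "in_R K (u n)" using K DD[of n] by (intro p(5)) auto
      moreover have "\<forall>z\<in>K. cmod (v z - u n z) < e"
      proof
        fix z assume "z \<in> K"
        then have "z \<notin> discs_union DD" using K(2) by blast
        from v(2)[OF this, of n] show "cmod (v z - u n z) < e" using n by linarith
      qed
      ultimately show "\<exists>g. in_R K g \<and> (\<forall>z\<in>K. cmod (v z - g z) < e)" by blast
    qed
    show "v z = 1" if z: "cmod (z - a) \<le> R" for z
    proof -
      have "cmod (u n z - 1) \<le> \<tau> n" for n using p(8)[of z n] p(6)[of n] z by linarith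
      then have "(\<lambda>n. u n z - 1) \<longlonglongrightarrow> 0" by (intro Lim_null_comparison[OF _ \<tau>0]) auto
      then have "(\<lambda>n. u n z) \<longlonglongrightarrow> 1" by (simp add: Lim_null[symmetric])
      then show ?thesis using v(1)[OF out] z LIMSEQ_unique by blast
    qed
    show "v z = 0" if z: "2 * R \<le> cmod (z - a)" for z
    proof -
      have "cmod (u n z) \<le> \<tau> n" for n using p(9)[of n z] p(7)[of n] z by linarith
      then have "(\<lambda>n. u n z) \<longlonglongrightarrow> 0" by (intro Lim_null_comparison[OF _ \<tau>0]) auto
      then show ?thesis using v(1)[OF out] z LIMSEQ_unique by blast
    qed
    show "cmod (v z) \<le> B + 2" if z: "z \<notin> discs_union DD" for z
    proof -
      have "z \<notin> discs_union (D 0)" using z DD by blast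
      then show ?thesis using B[of z] v(2)[OF z, of 0] norm_triangle_ineq2[of "v z" "u 0 z"] by simp
    qed
  qed
  then show ?thesis by blast
qed

section \<open>Logarithmic cutoffs and grids of poles\<close>

text \<open>A logarithmic cutoff: \<open>\<phi>\<close> is uniformly small although its Cauchy transform is linear
  near 0.\<close>

lemma log_cutoff_exists:
  assumes \<kappa>: "\<kappa> > 0" and \<epsilon>: "\<epsilon> > 0"
  shows "\<exists>s g \<phi>. 0 < s \<and> 2 * s < \<epsilon> \<and> dbar_on UNIV g \<phi> \<and> (\<forall>w. cmod w > \<epsilon> \<longrightarrow> g w = 0) \<and>
    (\<forall>w. cmod w \<le> 2 * s \<longrightarrow> g w = - w) \<and> (\<forall>w. cmod w \<le> 2 * s \<or> cmod w > \<epsilon> \<longrightarrow> \<phi> w = 0) \<and>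
    (\<forall>w. cmod (\<phi> w) \<le> \<kappa>)"
proof -
  \<comment> \<open>Makes \<open>ln \<epsilon> - ln (2 * s) = 1 / \<kappa>\<close>, so that
    \<open>t\<close>, which is \<open>\<kappa>\<close> times a logarithm, rises from 0 to 1 between
    the radii \<open>2 * s\<close> and \<open>\<epsilon>\<close>.\<close>
  define s where "s = \<epsilon> * exp (- (1 / \<kappa>)) / 2"
  have s: "s > 0" "2 * s < \<epsilon>" using \<epsilon> \<kappa> by (auto simp: s_def)
  have ln2s: "ln (2 * s) = ln \<epsilon> - 1 / \<kappa>" using \<epsilon> by (simp add: s_def ln_mult ln_div)
  define t where "t w = (\<kappa> / 2) * (ln ((cmod w)\<^sup>2) - ln ((2 * s)\<^sup>2))" for w
  define g where "g w = w * (of_real (smoothstep (t w)) - 1)" for w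
  define \<phi> where "\<phi> w = w * (of_real (smoothstep_deriv (t w)) *
      (of_real (\<kappa> / 2) * (of_real (1 / (cmod w)\<^sup>2) * w)))" for w
  have t0: "t w \<le> 0" if "cmod w \<le> 2 * s" "w \<noteq> 0" for w
  proof -
    have "(cmod w)\<^sup>2 \<le> (2 * s)\<^sup>2" using that by (intro power_mono) auto
    then have "ln ((cmod w)\<^sup>2) \<le> ln ((2 * s)\<^sup>2)" using that s by (subst ln_le_cancel_iff) auto
    then show ?thesis using \<kappa> by (simp add: t_def mult_nonneg_nonpos)
  qed
  have t1: "t w \<ge> 1" if "cmod w \<ge> \<epsilon>" for w
  proof -
    have w: "cmod w > 0" using that \<epsilon> by linarith
    have "ln ((cmod w)\<^sup>2) - ln ((2 * s)\<^sup>2) = 2 * (ln (cmod w) - ln \<epsilon> + 1 / \<kappa>)"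
      using ln_realpow[of "cmod w" 2] ln_realpow[of "2 * s" 2] s unfolding ln2s by simp
    moreover have "ln (cmod w) \<ge> ln \<epsilon>" using that \<epsilon> w by (subst ln_le_cancel_iff) auto
    ultimately have "ln ((cmod w)\<^sup>2) - ln ((2 * s)\<^sup>2) \<ge> 2 / \<kappa>" by simp
    then have "(\<kappa> / 2) * (2 / \<kappa>) \<le> t w" unfolding t_def using \<kappa> by (intro mult_left_mono) auto
    then show ?thesis using \<kappa> by simp
  qed
  let ?S = "- {0 :: complex}"
  have S: "open ?S" by auto
  have 1: "dbar_on ?S (\<lambda>w. of_real ((cmod w)\<^sup>2)) (\<lambda>w. w)"
    using dbar_on_norm_square[OF S, of 0] by simp
  have 2: "dbar_on ?S (\<lambda>w. of_real (ln ((cmod w)\<^sup>2))) (\<lambda>w. of_real (1 / (cmod w)\<^sup>2) * w)"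
    by (rule dbar_on_real_comp[OF 1, where T = "{0<..}"])
      (auto intro!: derivative_eq_intros continuous_intros simp: divide_inverse)
  have "dbar_on ?S (\<lambda>w. of_real (\<kappa> / 2) * (of_real (ln ((cmod w)\<^sup>2)) - of_real (ln ((2 * s)\<^sup>2))))
      (\<lambda>w. of_real (\<kappa> / 2) * (of_real (1 / (cmod w)\<^sup>2) * w - 0))"
    by (intro dbar_on_cmult dbar_on_diff 2 dbar_on_const S)
  then have 3: "dbar_on ?S (\<lambda>w. of_real (t w)) (\<lambda>w. of_real (\<kappa> / 2) * (of_real (1 / (cmod w)\<^sup>2) * w))"
    by (rule dbar_on_cong) (auto simp: t_def)
  have "dbar_on ?S (\<lambda>w. w * (of_real (smoothstep (t w)) - 1))
     (\<lambda>w. w * (of_real (smoothstep_deriv (t w)) * (of_real (\<kappa> / 2) * (of_real (1 / (cmod w)\<^sup>2) * w)) - 0)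
        + 0 * (of_real (smoothstep (t w)) - 1))"
    by (intro dbar_on_mult dbar_on_id dbar_on_diff dbar_on_smoothstep 3 dbar_on_const S)
  then have A: "dbar_on ?S g \<phi>" by (rule dbar_on_cong) (auto simp: g_def \<phi>_def)
  have g0: "g w = - w" if "cmod w \<le> 2 * s" for w
    using t0[OF that] by (cases "w = 0") (auto simp: g_def smoothstep_0)
  have \<phi>0: "\<phi> w = 0" if "cmod w \<le> 2 * s \<or> cmod w > \<epsilon>" for w
  proof (cases "w = 0")
    case False
    then show ?thesis using that t0[of w] t1[of w]
      by (auto simp: \<phi>_def smoothstep_deriv_0 smoothstep_deriv_1)
  qed (simp add: \<phi>_def)
  have "dbar_on (ball 0 (2 * s)) (\<lambda>w. - 1 * w) (\<lambda>w. - 1 * 0)"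
    by (intro dbar_on_cmult dbar_on_id) auto
  then have B: "dbar_on (ball 0 (2 * s)) g \<phi>"
    by (rule dbar_on_cong) (use g0 \<phi>0 in auto)
  have "?S \<union> ball 0 (2 * s) = UNIV" using s by auto
  then have "dbar_on UNIV g \<phi>" using dbar_on_Un[OF A B] by simp
  \<comment> \<open>The derivative of the logarithm has modulus \<open>1 / cmod w\<close>, and the
    factor \<open>w\<close> of \<open>g\<close> cancels it: only \<open>\<kappa>\<close> remains, at
    every scale.\<close>
  moreover have "cmod (\<phi> w) \<le> \<kappa>" for w
  proof (cases "w = 0")
    case False
    have "cmod (\<phi> w) = smoothstep_deriv (t w) * (\<kappa> / 2)"
      using False \<kappa> smoothstep_deriv_bounds(1)[of "t w"]
      by (simp add: \<phi>_def norm_mult norm_divide power2_eq_square)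
    also have "\<dots> \<le> 3/2 * (\<kappa> / 2)" using \<kappa> smoothstep_deriv_bounds(2) by (intro mult_right_mono) auto
    finally show ?thesis using \<kappa> by simp
  qed (use \<kappa> in \<open>simp add: \<phi>_def\<close>)
  moreover have "g w = 0" if "cmod w > \<epsilon>" for w
    using t1[of w] that by (simp add: g_def smoothstep_1)
  ultimately show ?thesis using s g0 \<phi>0 by blast
qed

section \<open>Riemann sums over square grids\<close>

definition grid :: "nat \<Rightarrow> (int \<times> int) set" where
  "grid N = {- int N..int N} \<times> {- int N..int N}"

definition grid_point :: "nat \<Rightarrow> int \<times> int \<Rightarrow> complex" where
  "grid_point N p = Complex (of_int (fst p) / N) (of_int (snd p) / N)"

lemma finite_grid: "finite (grid N)"
  by (simp add: grid_def)

lemma card_grid: "card (grid N) = (2 * N + 1)\<^sup>2"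
proof -
  have "nat (int N - (- int N) + 1) = 2 * N + 1" by simp
  then show ?thesis by (simp add: grid_def card_cartesian_product power2_eq_square)
qed

definition grid_index :: "nat \<Rightarrow> complex \<Rightarrow> int \<times> int" where
  "grid_index N w = (\<lfloor>N * Re w\<rfloor>, \<lfloor>N * Im w\<rfloor>)"

lemma grid_index_close:
  assumes "N > 0"
  shows "cmod (w - grid_point N (grid_index N w)) \<le> 2 / N"
proof -
  have "\<bar>x - of_int \<lfloor>N * x\<rfloor> / N\<bar> \<le> 1 / N" for x :: real
  proof -
    have "\<bar>N * x - of_int \<lfloor>N * x\<rfloor>\<bar> \<le> 1" by linarith
    moreover have "x - of_int \<lfloor>N * x\<rfloor> / N = (N * x - of_int \<lfloor>N * x\<rfloor>) / N"
      using assms by (simp add: field_simps)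
    ultimately show ?thesis by (simp add: divide_right_mono)
  qed
  from this[of "Re w"] this[of "Im w"] show ?thesis
    using cmod_le[of "w - grid_point N (grid_index N w)"] by (simp add: grid_point_def grid_index_def)
qed

lemma grid_index_in_grid:
  assumes "cmod w \<le> 1"
  shows "grid_index N w \<in> grid N"
proof -
  have "\<bar>N * Re w\<bar> \<le> N * 1" "\<bar>N * Im w\<bar> \<le> N * 1"
    using assms abs_Re_le_cmod[of w] abs_Im_le_cmod[of w]
    by (auto simp: abs_mult intro!: mult_left_le)
  then show ?thesis unfolding grid_index_def grid_def
    by (intro SigmaI; simp add: floor_le_iff le_floor_iff; linarith)
qed

lemma grid_cell:
  assumes N: "N > 0"
  defines "Q \<equiv> \<lambda>p. {w. grid_index N w = p}"
  shows "Q p \<in> sets lborel" "emeasure lborel (Q p) = ennreal (1 / (real N)\<^sup>2)"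
proof -
  obtain m n where p: "p = (m, n)" by (cases p)
  have Q: "Q p = {w. of_int m \<le> N * Re w \<and> N * Re w < of_int m + 1 \<and> of_int n \<le> N * Im w \<and> N * Im w < of_int n + 1}"
    by (auto simp: Q_def p grid_index_def floor_eq_iff)
  show S: "Q p \<in> sets lborel" unfolding Q by simp
  define l where "l = Complex (of_int m / N) (of_int n / N)"
  define u where "u = Complex ((of_int m + 1) / N) ((of_int n + 1) / N)"
  have prod: "(\<Prod>b\<in>Basis. (u - l) \<bullet> b) = 1 / (real N)\<^sup>2"
    using N by (simp add: Basis_complex_def l_def u_def inner_complex_def divide_simps power2_eq_square)
  have b1: "emeasure lborel (cbox l u) = ennreal (1 / (real N)\<^sup>2)"
    by (subst emeasure_lborel_cbox)
      (simp_all only: prod, auto simp: Basis_complex_def l_def u_def divide_right_mono)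
  have b2: "emeasure lborel (box l u) = ennreal (1 / (real N)\<^sup>2)"
    by (subst emeasure_lborel_box)
      (simp_all only: prod, auto simp: Basis_complex_def l_def u_def divide_right_mono)
  have "box l u \<subseteq> Q p" "Q p \<subseteq> cbox l u"
    using N by (auto simp: Q in_box_complex_iff in_cbox_complex_iff l_def u_def field_simps)
  then have "emeasure lborel (box l u) \<le> emeasure lborel (Q p)" "emeasure lborel (Q p) \<le> emeasure lborel (cbox l u)"
    using S by (auto intro!: emeasure_mono)
  then show "emeasure lborel (Q p) = ennreal (1 / (real N)\<^sup>2)" unfolding b1 b2 by (rule antisym[rotated])
qed

text \<open>The cells of \<open>grid N\<close> cover the unit disc, and their total area
  \<open>((2 * N + 1) / N)^2\<close> is at most 9.\<close>

lemma riemann_sum_bound: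
  fixes \<Phi> :: "complex \<Rightarrow> complex"
  assumes N: "N > 0" and int: "integrable lborel \<Phi>" and supp: "\<And>w. cmod w > 1 \<Longrightarrow> \<Phi> w = 0"
    and osc: "\<And>w p. cmod (w - p) \<le> 2 / N \<Longrightarrow> cmod (\<Phi> w - \<Phi> p) \<le> \<tau>"
  shows "cmod (integral\<^sup>L lborel \<Phi> - (\<Sum>p\<in>grid N. \<Phi> (grid_point N p) / (real N)\<^sup>2)) \<le> 9 * \<tau>"
proof -
  define Q where "Q p = {w. grid_index N w = p}" for p
  note Q = grid_cell[OF N, folded Q_def]
  have mQ: "measure lborel (Q p) = 1 / (real N)\<^sup>2" for p
    using Q(2)[of p] by (simp add: measure_def)
  have fin: "emeasure lborel (Q p) < \<infinity>" for p using Q(2)[of p] by simp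
  have i1: "integrable lborel (\<lambda>w. indicator (Q p) w *\<^sub>R \<Phi> w)" for p
    by (rule integrable_mult_indicator[OF Q(1) int])
  have i2: "integrable lborel (\<lambda>w. indicator (Q p) w *\<^sub>R \<Phi> (grid_point N p))" for p
    using integrable_real_indicator[OF Q(1) fin] by (rule integrable_scaleR_left)
  have "\<Phi> w = (\<Sum>p\<in>grid N. indicator (Q p) w *\<^sub>R \<Phi> w)" for w
  proof (cases "cmod w > 1")
    case False
    have "(\<Sum>p\<in>grid N. indicator (Q p) w *\<^sub>R \<Phi> w) = (\<Sum>p\<in>grid N. if p = grid_index N w then \<Phi> w else 0)"
      by (rule sum.cong) (auto simp: Q_def indicator_def)
    then show ?thesis using grid_index_in_grid[of w N] False finite_grid by simp
  qed (use supp in simp)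
  then have "integral\<^sup>L lborel \<Phi> = (\<integral>w. (\<Sum>p\<in>grid N. indicator (Q p) w *\<^sub>R \<Phi> w) \<partial>lborel)"
    by presburger
  also have "\<dots> = (\<Sum>p\<in>grid N. \<integral>w. indicator (Q p) w *\<^sub>R \<Phi> w \<partial>lborel)"
    using i1 by (intro Bochner_Integration.integral_sum) auto
  finally have 1: "integral\<^sup>L lborel \<Phi> = (\<Sum>p\<in>grid N. \<integral>w. indicator (Q p) w *\<^sub>R \<Phi> w \<partial>lborel)" .
  have 2: "\<Phi> (grid_point N p) / (real N)\<^sup>2 = (\<integral>w. indicator (Q p) w *\<^sub>R \<Phi> (grid_point N p) \<partial>lborel)" for p
  proof -
    have "(\<integral>w. indicator (Q p) w *\<^sub>R \<Phi> (grid_point N p) \<partial>lborel) = measure lborel (Q p) *\<^sub>R \<Phi> (grid_point N p)"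
      using Q(1)[of p] fin[of p] by simp
    then show ?thesis by (simp add: mQ scaleR_conv_of_real)
  qed
  have "integral\<^sup>L lborel \<Phi> - (\<Sum>p\<in>grid N. \<Phi> (grid_point N p) / (real N)\<^sup>2)
      = (\<Sum>p\<in>grid N. \<integral>w. indicator (Q p) w *\<^sub>R \<Phi> w - indicator (Q p) w *\<^sub>R \<Phi> (grid_point N p) \<partial>lborel)"
    unfolding 1 2 sum_subtractf[symmetric] using i1 i2
    by (intro sum.cong refl Bochner_Integration.integral_diff[symmetric]) auto
  also have "cmod \<dots> \<le> (\<Sum>p\<in>grid N. \<tau> / (real N)\<^sup>2)"
  proof (rule sum_norm_le)
    fix p
    have "cmod (\<integral>w. indicator (Q p) w *\<^sub>R \<Phi> w - indicator (Q p) w *\<^sub>R \<Phi> (grid_point N p) \<partial>lborel)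
        \<le> (\<integral>w. indicator (Q p) w * \<tau> \<partial>lborel)"
    proof (rule Bochner_Integration.integral_norm_bound_integral)
      show "integrable lborel (\<lambda>w. indicator (Q p) w * \<tau>)"
        using integrable_real_indicator[OF Q(1) fin] by (rule integrable_mult_left)
      fix w
      have "cmod (\<Phi> w - \<Phi> (grid_point N p)) \<le> \<tau>" if "w \<in> Q p"
        using that grid_index_close[OF N, of w] by (intro osc) (auto simp: Q_def)
      then show "cmod (indicator (Q p) w *\<^sub>R \<Phi> w - indicator (Q p) w *\<^sub>R \<Phi> (grid_point N p)) \<le> indicator (Q p) w * \<tau>"
        by (auto simp: indicator_def)
    qed (intro Bochner_Integration.integrable_diff i1 i2)
    also have "\<dots> = \<tau> / (real N)\<^sup>2" using Q(1)[of p] fin[of p] by (simp add: mQ)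
    finally show "cmod (\<integral>w. indicator (Q p) w *\<^sub>R \<Phi> w - indicator (Q p) w *\<^sub>R \<Phi> (grid_point N p) \<partial>lborel)
        \<le> \<tau> / (real N)\<^sup>2" .
  qed
  also have "\<dots> = ((2 * real N + 1) / N)\<^sup>2 * \<tau>"
    by (simp add: card_grid power_divide)
  also have "\<dots> \<le> 3\<^sup>2 * \<tau>"
  proof (intro mult_right_mono power_mono)
    show "(2 * real N + 1) / N \<le> 3" using N by (simp add: field_simps)
    have "cmod (\<Phi> 0 - \<Phi> 0) \<le> \<tau>" by (rule osc) simp
    then show "0 \<le> \<tau>" by simp
  qed auto
  finally show ?thesis by simp
qed

text \<open>The induction step adds two terms \<open>1 / sqrt (M + 2)\<close>; that they are paid
  for by the growth of \<open>4 * sqrt (M + 1)\<close> is the inequality of arithmetic and geometric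
  means for \<open>sqrt (M + 1)\<close> and \<open>sqrt (M + 2)\<close>.\<close>

lemma sum_inverse_sqrt_symmetric:
  "(\<Sum>k=- int M..int M. 1 / sqrt (real_of_int \<bar>k\<bar> + 1)) \<le> 4 * sqrt (real M + 1)"
proof (induction M)
  case (Suc M)
  have "{- int (Suc M)..int (Suc M)} = insert (- int (Suc M)) (insert (int (Suc M)) {- int M..int M})"
    by auto
  then have "(\<Sum>k=- int (Suc M)..int (Suc M). 1 / sqrt (real_of_int \<bar>k\<bar> + 1))
      = 2 / sqrt (real M + 2) + (\<Sum>k=- int M..int M. 1 / sqrt (real_of_int \<bar>k\<bar> + 1))"
    by (simp add: add.commute)
  also have "\<dots> \<le> 2 / sqrt (real M + 2) + 4 * sqrt (real M + 1)" using Suc by simp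
  also have "\<dots> \<le> 4 * sqrt (real M + 2)"
  proof -
    have "sqrt (real M + 2) * sqrt (real M + 1) \<le> (sqrt (real M + 2) * sqrt (real M + 2) + sqrt (real M + 1)
        * sqrt (real M + 1)) / 2"
      using sum_squares_ge_zero[of "sqrt (real M + 2) - sqrt (real M + 1)" 0] by (simp add: algebra_simps)
    then have "sqrt (real M + 2) * sqrt (real M + 1) \<le> real M + 3/2" by (simp add: add_divide_distrib)
    moreover have "2 / sqrt (real M + 2) + 4 * sqrt (real M + 1)
        = (2 + 4 * (sqrt (real M + 2) * sqrt (real M + 1))) / sqrt (real M + 2)"
      by (simp add: add_divide_distrib)
    moreover have "4 * sqrt (real M + 2) = 4 * ((real M + 2) / sqrt (real M + 2))"
      by (subst real_div_sqrt) auto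
    then have "4 * sqrt (real M + 2) = (4 * (real M + 2)) / sqrt (real M + 2)"
      by (simp only: times_divide_eq_right)
    ultimately show ?thesis by (simp only:) (rule divide_right_mono, auto)
  qed
  finally show ?case by (simp add: add.commute)
qed auto

text \<open>Recentering at the integer part of \<open>t\<close> costs a factor \<open>sqrt 3\<close>
  and widens the range to \<open>5 * N\<close> on either side, where the symmetric sum is at most
  \<open>4 * sqrt (6 * N)\<close>. Note \<open>288 = 3 * 16 * 6\<close>.\<close>

lemma sum_inverse_sqrt_dist:
  fixes t :: real
  assumes N: "N > 0" and t: "\<bar>t\<bar> \<le> 3 * N"
  shows "(\<Sum>m=- int N..int N. 1 / sqrt (max 1 \<bar>t - of_int m\<bar>)) \<le> sqrt 288 * sqrt N"
proof -
  define f where "f k = sqrt 3 * (1 / sqrt (real_of_int \<bar>k\<bar> + 1))" for k :: int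
  define m0 where "m0 = \<lfloor>t\<rfloor>"
  have m0: "\<bar>m0\<bar> \<le> 3 * int N + 1" using t unfolding m0_def by linarith
  have "(\<Sum>m=- int N..int N. 1 / sqrt (max 1 \<bar>t - of_int m\<bar>)) \<le> (\<Sum>m=- int N..int N. f (m - m0))"
  proof (rule sum_mono)
    fix m
    define j where "j = real_of_int \<bar>m - m0\<bar> + 1"
    have j: "j > 0" by (simp add: j_def)
    have "\<bar>real_of_int m - of_int m0\<bar> \<le> \<bar>t - of_int m\<bar> + 1" unfolding m0_def by linarith
    then have "j \<le> \<bar>t - of_int m\<bar> + 2" unfolding j_def by simp
    then have b: "max 1 \<bar>t - of_int m\<bar> \<ge> j / 3" by linarith
    have "1 / sqrt (max 1 \<bar>t - of_int m\<bar>) \<le> 1 / sqrt (j / 3)"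
      using b j by (intro frac_le) auto
    also have "\<dots> = sqrt 3 * (1 / sqrt j)" using j by (simp add: real_sqrt_divide)
    finally show "1 / sqrt (max 1 \<bar>t - of_int m\<bar>) \<le> f (m - m0)" by (simp add: f_def j_def)
  qed
  also have "\<dots> = sum f ((\<lambda>m. m - m0) ` {- int N..int N})"
    by (subst sum.reindex) (auto simp: inj_on_def)
  also have "\<dots> \<le> sum f {- int (5 * N)..int (5 * N)}"
    using m0 N by (intro sum_mono2) (auto simp: f_def)
  also have "\<dots> = sqrt 3 * (\<Sum>k=- int (5 * N)..int (5 * N). 1 / sqrt (real_of_int \<bar>k\<bar> + 1))"
    unfolding f_def sum_distrib_left ..
  also have "\<dots> \<le> sqrt 3 * (4 * sqrt (real (5 * N) + 1))"
    by (intro mult_left_mono sum_inverse_sqrt_symmetric) auto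
  also have "\<dots> \<le> sqrt 3 * (4 * sqrt (6 * real N))" using N by (intro mult_left_mono) auto
  also have "\<dots> = sqrt (3 * (16 * (6 * real N)))"
    unfolding real_sqrt_mult by simp
  also have "\<dots> = sqrt 288 * sqrt N" unfolding real_sqrt_mult[symmetric] by simp
  finally show ?thesis .
qed

text \<open>Apart from the at most four points in the cell of \<open>z\<close>, the bound
  \<open>1 / cmod (x + \<i> y) \<le> 1 / sqrt (\<bar>x\<bar> * \<bar>y\<bar>)\<close> reduces the double sum to a product.\<close>

lemma grid_sum_bound:
  assumes N: "N > 0" and z: "cmod z \<le> 3" and \<eta>: "\<eta> > 0" and I: "I \<subseteq> grid N"
    and off: "\<And>p. p \<in> I \<Longrightarrow> cmod (z - grid_point N p) \<ge> \<eta> / (real N)\<^sup>2"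
  shows "(\<Sum>p\<in>I. 1 / ((real N)\<^sup>2 * cmod (z - grid_point N p))) \<le> 4 / \<eta> + 288"
proof -
  define t where "t = N * Re z"
  define t' where "t' = N * Im z"
  have t: "\<bar>t\<bar> \<le> 3 * N" "\<bar>t'\<bar> \<le> 3 * N"
    using z abs_Re_le_cmod[of z] abs_Im_le_cmod[of z]
      mult_left_mono[of "\<bar>Re z\<bar>" 3 "real N"] mult_left_mono[of "\<bar>Im z\<bar>" 3 "real N"]
    by (auto simp: t_def t'_def abs_mult)
  define S where "S m = 1 / sqrt (max 1 \<bar>t - of_int m\<bar>)" for m
  define S' where "S' m = 1 / sqrt (max 1 \<bar>t' - of_int m\<bar>)" for m
  define A where "A = {\<lfloor>t\<rfloor>, \<lfloor>t\<rfloor> + 1} \<times> {\<lfloor>t'\<rfloor>, \<lfloor>t'\<rfloor> + 1}"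
  have A: "finite A" "card A \<le> 4"
  proof -
    show "finite A" by (simp add: A_def)
    show "card A \<le> 4" by (simp add: A_def card_cartesian_product)
  qed
  have fI: "finite I" using I finite_grid finite_subset by blast
  let ?f = "\<lambda>p. 1 / ((real N)\<^sup>2 * cmod (z - grid_point N p))"
  have "(\<Sum>p\<in>I. ?f p) = (\<Sum>p\<in>I \<inter> A. ?f p) + (\<Sum>p\<in>I - A. ?f p)"
    by (rule sum.Int_Diff[OF fI])
  also have "(\<Sum>p\<in>I \<inter> A. ?f p) \<le> (\<Sum>p\<in>I \<inter> A. 1 / \<eta>)"
  proof (rule sum_mono)
    fix p assume "p \<in> I \<inter> A"
    then have "\<eta> \<le> (real N)\<^sup>2 * cmod (z - grid_point N p)"
      using off[of p] N by (simp add: field_simps)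
    then show "?f p \<le> 1 / \<eta>" using \<eta> by (intro frac_le) auto
  qed
  also have "\<dots> \<le> 4 / \<eta>"
  proof -
    have "card (I \<inter> A) \<le> 4" using card_mono[OF A(1), of "I \<inter> A"] A(2) by simp
    then show ?thesis using \<eta> by (simp add: divide_right_mono)
  qed
  also have "(\<Sum>p\<in>I - A. ?f p) \<le> (\<Sum>p\<in>I - A. (1 / N) * (S (fst p) * S' (snd p)))"
  proof (rule sum_mono)
    fix p assume p: "p \<in> I - A"
    define x where "x = \<bar>t - of_int (fst p)\<bar>"
    define y where "y = \<bar>t' - of_int (snd p)\<bar>"
    have "x \<ge> 1 \<or> y \<ge> 1"
    proof (rule ccontr)
      assume "\<not> (x \<ge> 1 \<or> y \<ge> 1)"
      then have "x < 1" "y < 1" by auto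
      then have "fst p = \<lfloor>t\<rfloor> \<or> fst p = \<lfloor>t\<rfloor> + 1" "snd p = \<lfloor>t'\<rfloor> \<or> snd p = \<lfloor>t'\<rfloor> + 1"
        unfolding x_def y_def by linarith+
      then show False using p by (cases p) (auto simp: A_def)
    qed
    have w: "z - grid_point N p = Complex ((t - of_int (fst p)) / N) ((t' - of_int (snd p)) / N)"
      using N by (simp add: complex_eq_iff grid_point_def t_def t'_def field_simps)
    have "\<bar>Re (z - grid_point N p)\<bar> = x / N" "\<bar>Im (z - grid_point N p)\<bar> = y / N"
      unfolding w by (auto simp: x_def y_def)
    then have "x / N \<le> cmod (z - grid_point N p)" "y / N \<le> cmod (z - grid_point N p)"
      using abs_Re_le_cmod[of "z - grid_point N p"] abs_Im_le_cmod[of "z - grid_point N p"] by simp_all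
    then have xy: "max 1 x \<le> N * cmod (z - grid_point N p)" "max 1 y \<le> N * cmod (z - grid_point N p)"
      using \<open>x \<ge> 1 \<or> y \<ge> 1\<close> N by (auto simp: field_simps)
    have "sqrt (max 1 x) * sqrt (max 1 y) \<le> sqrt (N * cmod (z - grid_point N p)) * sqrt (N * cmod (z -
        grid_point N p))"
      using xy by (intro mult_mono) auto
    then have "sqrt (max 1 x) * sqrt (max 1 y) \<le> N * cmod (z - grid_point N p)" by simp
    then have "1 / (N * cmod (z - grid_point N p)) \<le> 1 / (sqrt (max 1 x) * sqrt (max 1 y))"
      by (intro frac_le mult_pos_pos) (auto simp: max_def)
    then have "(1 / N) * (1 / (N * cmod (z - grid_point N p))) \<le> (1 / N) * (S (fst p) * S' (snd p))"
      by (intro mult_left_mono) (auto simp: S_def S'_def x_def y_def)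
    then show "?f p \<le> (1 / N) * (S (fst p) * S' (snd p))"
      by (simp add: power2_eq_square mult.assoc)
  qed
  also have "\<dots> \<le> (\<Sum>p\<in>grid N. (1 / N) * (S (fst p) * S' (snd p)))"
    using I by (intro sum_mono2 finite_grid) (auto simp: S_def S'_def)
  also have "\<dots> = (1 / N) * ((\<Sum>m=- int N..int N. S m) * (\<Sum>n=- int N..int N. S' n))"
  proof -
    have "(\<Sum>m=- int N..int N. S m) * (\<Sum>n=- int N..int N. S' n) = (\<Sum>p\<in>grid N. S (fst p) * S' (snd p))"
      by (simp add: grid_def sum_product sum.cartesian_product case_prod_beta)
    then show ?thesis by (simp only: sum_distrib_left)
  qed
  also have "\<dots> \<le> (1 / N) * ((sqrt 288 * sqrt N) * (sqrt 288 * sqrt N))"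
    unfolding S_def S'_def
    using t by (intro mult_left_mono mult_mono sum_inverse_sqrt_dist N sum_nonneg) auto
  also have "(sqrt 288 * sqrt N) * (sqrt 288 * sqrt N) = 288 * real N"
    by (simp add: mult.assoc mult.left_commute)
  also have "(1 / N) * (288 * real N) = 288" using N by simp
  finally show ?thesis by simp
qed

text \<open>The range \<open>cmod z \<le> 3\<close> leaves room for moving the function to a point
  next to the unit disc. Near 0 the sum over the poles is almost \<open>- z\<close>.\<close>

definition grid_function ::
    "real \<Rightarrow> real \<Rightarrow> real \<Rightarrow> real \<Rightarrow> real \<Rightarrow> nat \<Rightarrow> (int \<times> int) set \<Rightarrow> (int \<times> int \<Rightarrow> complex) \<Rightarrow> bool" where
  "grid_function \<epsilon> \<eta> e s \<tau> N I a \<longleftrightarrow> I \<subseteq> grid N \<and> (\<forall>p\<in>I. cmod (grid_point N p) \<le> \<epsilon>) \<and>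
    (\<forall>z. cmod z \<le> 3 \<longrightarrow> (\<forall>p\<in>I. cmod (z - grid_point N p) \<ge> \<eta> / (real N)\<^sup>2) \<longrightarrow>
       cmod (\<Sum>p\<in>I. a p / (z - grid_point N p)) \<le> e) \<and>
    (\<forall>z. cmod z \<le> s \<longrightarrow> cmod (z + (\<Sum>p\<in>I. a p / (z - grid_point N p))) \<le> \<tau>)"

text \<open>The radius \<open>s\<close> comes from the logarithmic cutoff alone; a smaller
  \<open>\<tau>\<close> only requires a finer grid. Refinement is free: of the order of
  \<open>N^2\<close> discs of radius \<open>\<eta> / N^2\<close> have a total radius of order
  \<open>\<eta>\<close> for every \<open>N\<close>.\<close>

lemma grid_function_exists:
  assumes \<epsilon>: "0 < \<epsilon>" "\<epsilon> \<le> 1" and e: "e > 0" and \<eta>: "\<eta> > 0"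
  shows "\<exists>s>0. \<forall>\<tau>>0. \<exists>N0. \<forall>N\<ge>N0. \<exists>I a. grid_function \<epsilon> \<eta> e s \<tau> N I a"
proof -
  define c where "c = bump_mass"
  have c: "c > 0" by (simp add: c_def bump_mass_pos)
  \<comment> \<open>Turns the bound \<open>(\<kappa> / c) * (4 / \<eta> + 288)\<close> that results
    from \<open>grid_sum_bound\<close> into \<open>e\<close>.\<close>
  define \<kappa> where "\<kappa> = e * c / (4 / \<eta> + 288)"
  have den: "4 / \<eta> + 288 > 0" using \<eta> by (simp add: add_pos_pos)
  have \<kappa>: "\<kappa> > 0" using e c den by (simp add: \<kappa>_def)
  obtain s g \<phi> where s: "0 < s" "2 * s < \<epsilon>" and g: "dbar_on UNIV g \<phi>"
    and g1: "\<And>w. cmod w > \<epsilon> \<Longrightarrow> g w = 0" and g0: "\<And>w. cmod w \<le> 2 * s \<Longrightarrow> g w = - w"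
    and \<phi>0: "\<And>w. cmod w \<le> 2 * s \<or> cmod w > \<epsilon> \<Longrightarrow> \<phi> w = 0" and \<phi>\<kappa>: "\<And>w. cmod (\<phi> w) \<le> \<kappa>"
    using log_cutoff_exists[OF \<kappa> \<epsilon>(1)] by blast
  have \<phi>c: "continuous_on UNIV \<phi>" by (rule dbar_on_continuous[OF g])
  show ?thesis
  proof (intro exI[of _ s] conjI allI impI)
    show "0 < s" by (rule s)
    fix \<tau> :: real assume \<tau>: "\<tau> > 0"
    define \<tau>' where "\<tau>' = c * \<tau> / 9"
    have \<tau>': "\<tau>' > 0" using \<tau> c by (simp add: \<tau>'_def)
    \<comment> \<open>For \<open>cmod z \<le> s\<close> the truncated kernel agrees with
      \<open>1 / (w - z)\<close> wherever \<open>\<phi> w\<close> is not 0, and it is continuous in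
      both variables. Uniform continuity therefore yields one mesh size for all
      \<open>z\<close>.\<close>
    let ?\<Phi> = "\<lambda>(z, w). \<phi> w * cauchy_kernel s (w - z)"
    have kc: "continuous_on UNIV (cauchy_kernel s)"
      using dbar_on_continuous_fun[OF dbar_on_cauchy_kernel[OF s(1), of 0]] by simp
    have "continuous_on (cball 0 s \<times> cball 0 2) ?\<Phi>"
      unfolding case_prod_beta
      by (intro continuous_intros continuous_on_compose2[OF \<phi>c] continuous_on_compose2[OF kc]) auto
    then have uc: "uniformly_continuous_on (cball 0 s \<times> cball 0 2) ?\<Phi>"
      by (rule compact_uniformly_continuous) (intro compact_Times compact_cball)
    obtain d where d: "d > 0" "\<And>x x'. x \<in> cball 0 s \<times> cball 0 2 \<Longrightarrow> x' \<in> cball 0 s \<times> cball 0 2 \<Longrightarrow>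
        dist x' x < d \<Longrightarrow> dist (?\<Phi> x') (?\<Phi> x) < \<tau>'"
      using uc[unfolded uniformly_continuous_on_def, rule_format, OF \<tau>'] by blast
    \<comment> \<open>The 2 ensures \<open>2 / N \<le> 1\<close>: if one of two neighbouring points
      lies beyond radius 2, then both lie outside the unit disc, where \<open>\<phi>\<close>
      vanishes.\<close>
    define N0 where "N0 = max 2 (nat \<lceil>2 / d\<rceil> + 1)"
    show "\<exists>N0. \<forall>N\<ge>N0. \<exists>I a. grid_function \<epsilon> \<eta> e s \<tau> N I a"
    proof (intro exI[of _ N0] allI impI)
      fix N assume "N \<ge> N0"
      then have N: "N \<ge> 2" "N > 2 / d" unfolding N0_def by linarith+
      then have N': "N > 0" "2 / N < d" "2 / real N \<le> 1" using d by (auto simp: field_simps)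
      define I where "I = {p \<in> grid N. \<phi> (grid_point N p) \<noteq> 0}"
      define a where "a p = \<phi> (grid_point N p) / (of_real c * (of_nat N)\<^sup>2)" for p
      have fI: "finite I" using finite_grid by (simp add: I_def)
      have 1: "I \<subseteq> grid N" by (auto simp: I_def)
      have 2: "cmod (grid_point N p) \<le> \<epsilon>" if "p \<in> I" for p
        using \<phi>0[of "grid_point N p"] that by (force simp: I_def)
      have 3: "cmod (\<Sum>p\<in>I. a p / (z - grid_point N p)) \<le> e"
        if z: "cmod z \<le> 3" "\<forall>p\<in>I. cmod (z - grid_point N p) \<ge> \<eta> / (real N)\<^sup>2" for z
      proof -
        have "cmod (\<Sum>p\<in>I. a p / (z - grid_point N p))
            \<le> (\<Sum>p\<in>I. (\<kappa> / c) * (1 / ((real N)\<^sup>2 * cmod (z - grid_point N p))))"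
        proof (rule sum_norm_le)
          fix p
          have "cmod (a p / (z - grid_point N p))
              = cmod (\<phi> (grid_point N p)) * (1 / c * (1 / ((real N)\<^sup>2 * cmod (z - grid_point N p))))"
            using c by (simp add: a_def norm_divide norm_mult norm_power)
          also have "\<dots> \<le> \<kappa> * (1 / c * (1 / ((real N)\<^sup>2 * cmod (z - grid_point N p))))"
            using \<phi>\<kappa> c by (intro mult_right_mono) auto
          finally show "cmod (a p / (z - grid_point N p))
              \<le> (\<kappa> / c) * (1 / ((real N)\<^sup>2 * cmod (z - grid_point N p)))" by simp
        qed
        also have "\<dots> = (\<kappa> / c) * (\<Sum>p\<in>I. 1 / ((real N)\<^sup>2 * cmod (z - grid_point N p)))"
          by (simp only: sum_distrib_left)
        also have "\<dots> \<le> (\<kappa> / c) * (4 / \<eta> + 288)"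
          using grid_sum_bound[OF N'(1) z(1) \<eta> 1] z(2) \<kappa> c by (intro mult_left_mono) auto
        also have "\<dots> = e" using c den by (simp add: \<kappa>_def)
        finally show ?thesis .
      qed
      have 4: "cmod (z + (\<Sum>p\<in>I. a p / (z - grid_point N p))) \<le> \<tau>" if z: "cmod z \<le> s" for z
      proof -
        define \<Phi> where "\<Phi> w = \<phi> w * cauchy_kernel s (w - z)" for w
        have \<Phi>: "\<Phi> w = \<phi> w / (w - z)" for w
        proof (cases "cmod w \<le> 2 * s")
          case True then show ?thesis using \<phi>0 by (simp add: \<Phi>_def)
        next
          case False
          then have "cmod (w - z) \<ge> s" using z norm_triangle_ineq2[of w z] by linarith
          then show ?thesis using cauchy_kernel_eq[OF s(1)] by (simp add: \<Phi>_def)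
        qed
        have hol: "\<phi> w = 0" if "w \<in> ball z s" for w
        proof -
          have "cmod w \<le> cmod (w - z) + cmod z" using norm_triangle_ineq[of "w - z" z] by simp
          then show ?thesis using that z by (intro \<phi>0) (simp add: dist_norm norm_minus_commute)
        qed
        have "\<Phi> = (\<lambda>w. \<phi> w / (w - z))" using \<Phi> by blast
        then have CP: "integrable lborel \<Phi>" "integral\<^sup>L lborel \<Phi> = - of_real bump_mass * g z"
          using cauchy_pompeiu[where L = \<epsilon> and z = z, OF g _ s(1)] g1 hol by simp_all
        have int: "integral\<^sup>L lborel \<Phi> = of_real c * z"
          using CP(2) g0[of z] z s by (simp add: c_def)
        have supp: "\<Phi> w = 0" if "cmod w > 1" for w
          using \<phi>0[of w] that \<epsilon> by (simp add: \<Phi>_def)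
        have osc: "cmod (\<Phi> w - \<Phi> p) \<le> \<tau>'" if wp: "cmod (w - p) \<le> 2 / N" for w p
        proof (cases "cmod w \<le> 2 \<and> cmod p \<le> 2")
          case True
          then have "dist (?\<Phi> (z, w)) (?\<Phi> (z, p)) < \<tau>'"
            using z wp N' by (intro d(2)) (auto simp: dist_Pair_Pair dist_norm)
          then show ?thesis by (simp add: \<Phi>_def dist_norm)
        next
          case False
          then have "cmod w > 1 \<and> cmod p > 1"
            using wp N'(3) norm_triangle_ineq2[of w p] norm_triangle_ineq2[of p w]
            by (auto simp: norm_minus_commute)
          then show ?thesis using supp \<tau>' by simp
        qed
        have "cmod (of_real c * z - (\<Sum>p\<in>grid N. \<Phi> (grid_point N p) / (real N)\<^sup>2)) \<le> 9 * \<tau>'"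
          unfolding int[symmetric] by (rule riemann_sum_bound[OF N'(1) CP(1) supp osc])
        also have "(\<Sum>p\<in>grid N. \<Phi> (grid_point N p) / (real N)\<^sup>2)
            = (\<Sum>p\<in>I. \<Phi> (grid_point N p) / (real N)\<^sup>2)"
          by (rule sum.mono_neutral_right) (auto simp: finite_grid I_def \<Phi>_def)
        also have "\<dots> = - of_real c * (\<Sum>p\<in>I. a p / (z - grid_point N p))"
          unfolding sum_distrib_left
        proof (rule sum.cong)
          fix p
          have "\<Phi> (grid_point N p) = - (\<phi> (grid_point N p) / (z - grid_point N p))"
            unfolding \<Phi> using minus_divide_right[of "\<phi> (grid_point N p)" "z - grid_point N p"] by simp
          then show "\<Phi> (grid_point N p) / (real N)\<^sup>2 = - of_real c * (a p / (z - grid_point N p))"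
            using c by (simp add: a_def)
        qed simp
        finally have "cmod (of_real c * (z + (\<Sum>p\<in>I. a p / (z - grid_point N p)))) \<le> c * \<tau>"
          by (simp add: \<tau>'_def algebra_simps)
        then show ?thesis using c by (simp add: norm_mult)
      qed
      show "\<exists>I a. grid_function \<epsilon> \<eta> e s \<tau> N I a"
        unfolding grid_function_def using 1 2 3 4 by blast
    qed
  qed
qed

definition grid_stage :: "real \<Rightarrow> real \<Rightarrow> real \<Rightarrow> real \<Rightarrow> real \<Rightarrow> (complex \<times> real) set \<Rightarrow> bool" where
  "grid_stage d e \<eta> s \<tau> D \<longleftrightarrow> finite D \<and>
     (\<forall>c \<rho>. (c, \<rho>) \<in> D \<longrightarrow> \<rho> > 0 \<and> cmod (1 - c) - \<rho> \<ge> d / 4) \<and> sum snd D \<le> \<eta> \<and>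
     (\<forall>x. cmod x \<le> 1 \<longrightarrow> cmod (x - 1) \<ge> d \<longrightarrow>
        (\<exists>h. (\<forall>K. compact K \<longrightarrow> K \<inter> discs_union D = {} \<longrightarrow> in_R K h) \<and>
          (\<forall>z. cmod z \<le> 1 \<longrightarrow> z \<notin> discs_union D \<longrightarrow> cmod (h z - (z - x)) \<le> e) \<and>
          (\<forall>z. cmod (z - x) \<le> s \<longrightarrow> cmod (h z) \<le> \<tau>)))"

text \<open>Discs are removed around all points of a large grid that are at distance at least
  \<open>d / 2\<close> from 1. For a given \<open>x\<close> the grid function is moved to the grid
  point \<open>x0\<close> next to \<open>x\<close>, at the price of an error \<open>2 / N\<close>.
  Its poles lie within \<open>d / 4\<close> of \<open>x0\<close>, hence at distance at least
  \<open>d / 2\<close> from 1, and are grid points themselves.\<close>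

lemma grid_stage_exists:
  assumes d: "0 < d" "d \<le> 1" and e: "e > 0" and \<eta>: "\<eta> > 0"
  shows "\<exists>s>0. \<forall>\<tau>>0. \<exists>D. grid_stage d e \<eta> s \<tau> D"
proof -
  \<comment> \<open>There will be at most \<open>(4 * N + 1)^2 \<le> 25 * N^2\<close> discs of
    radius \<open>\<eta>' / N^2\<close>.\<close>
  define \<eta>' where "\<eta>' = \<eta> / 25"
  have \<eta>': "\<eta>' > 0" using \<eta> by (simp add: \<eta>'_def)
  obtain s where s: "s > 0" and S: "\<And>\<tau>. \<tau> > 0 \<Longrightarrow> \<exists>N0. \<forall>N\<ge>N0. \<exists>I a. grid_function (d / 4) \<eta>' (e / 2) s \<tau> N I a"
  proof -
    have "\<exists>s>0. \<forall>\<tau>>0. \<exists>N0. \<forall>N\<ge>N0. \<exists>I a. grid_function (d / 4) \<eta>' (e / 2) s \<tau> N I a"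
      by (rule grid_function_exists) (use d e \<eta>' in simp_all)
    then show thesis using that by blast
  qed
  have "\<exists>D. grid_stage d e \<eta> (s / 2) \<tau> D" if \<tau>: "\<tau> > 0" for \<tau>
  proof -
    obtain N0 where N0: "\<And>N. N \<ge> N0 \<Longrightarrow> \<exists>I a. grid_function (d / 4) \<eta>' (e / 2) s \<tau> N I a"
      using S[OF \<tau>] by blast
    define N where "N = N0 + 2 + nat \<lceil>8 / d\<rceil> + nat \<lceil>4 / s\<rceil> + nat \<lceil>4 / e\<rceil> + nat \<lceil>4 * \<eta>' / d\<rceil>"
    have nc: "real (nat \<lceil>x\<rceil>) \<ge> x" for x by linarith
    have "N \<ge> N0" "N \<ge> 2" by (auto simp: N_def)
    have "real N \<ge> 8 / d" "real N \<ge> 4 / s" "real N \<ge> 4 / e" "real N \<ge> 4 * \<eta>' / d"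
      using nc[of "8 / d"] nc[of "4 / s"] nc[of "4 / e"] nc[of "4 * \<eta>' / d"] by (simp_all add: N_def)
    then have N: "N > 0" "2 / real N \<le> 1" "2 / real N \<le> d / 4" "2 / real N \<le> s / 2" "2 / real N \<le> e / 2"
        "\<eta>' / real N \<le> d / 4"
      using \<open>N \<ge> 2\<close> d s e by (auto simp: field_simps)
    have N2: "\<eta>' / (real N)\<^sup>2 \<le> d / 4"
    proof -
      have "real N \<le> (real N)\<^sup>2" using N(1) by (simp add: power2_eq_square)
      then have "\<eta>' / (real N)\<^sup>2 \<le> \<eta>' / real N" using \<eta>' N(1) by (intro divide_left_mono) auto
      then show ?thesis using N(6) by linarith
    qed
    obtain I a where G: "grid_function (d / 4) \<eta>' (e / 2) s \<tau> N I a"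
      using N0[OF \<open>N \<ge> N0\<close>] by blast
    have I: "I \<subseteq> grid N" "\<And>p. p \<in> I \<Longrightarrow> cmod (grid_point N p) \<le> d / 4"
      and u1: "\<And>z. cmod z \<le> 3 \<Longrightarrow> (\<And>p. p \<in> I \<Longrightarrow> cmod (z - grid_point N p) \<ge> \<eta>' / (real N)\<^sup>2) \<Longrightarrow>
         cmod (\<Sum>p\<in>I. a p / (z - grid_point N p)) \<le> e / 2"
      and u2: "\<And>z. cmod z \<le> s \<Longrightarrow> cmod (z + (\<Sum>p\<in>I. a p / (z - grid_point N p))) \<le> \<tau>"
      using G unfolding grid_function_def by blast+
    \<comment> \<open>Twice the range of \<open>grid N\<close>, so as to contain the sums of two
      indices from \<open>grid N\<close>.\<close>
    define L where "L = {- (2 * int N)..2 * int N} \<times> {- (2 * int N)..2 * int N}"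
    define D where "D = (\<lambda>p. (grid_point N p, \<eta>' / (real N)\<^sup>2)) ` {p \<in> L. cmod (grid_point N p - 1) \<ge> d / 2}"
    have fL: "finite L" by (simp add: L_def)
    have fD: "finite D" using fL by (simp add: D_def)
    have sD: "sum snd D \<le> \<eta>"
    proof -
      have cL: "card L = (4 * N + 1)\<^sup>2"
      proof -
        have "nat (2 * int N - (- (2 * int N)) + 1) = 4 * N + 1" by simp
        then show ?thesis by (simp add: L_def card_cartesian_product power2_eq_square)
      qed
      have "card D \<le> card {p \<in> L. cmod (grid_point N p - 1) \<ge> d / 2}"
        unfolding D_def by (rule card_image_le) (use fL in simp)
      also have "\<dots> \<le> card L" by (rule card_mono[OF fL]) auto
      finally have cD: "real (card D) \<le> (4 * real N + 1)\<^sup>2"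
        unfolding cL of_nat_le_iff[where 'a = real, symmetric] by (simp add: add.commute)
      have "sum snd D = (\<Sum>x\<in>D. \<eta>' / (real N)\<^sup>2)" by (rule sum.cong) (auto simp: D_def)
      also have "\<dots> = real (card D) * (\<eta>' / (real N)\<^sup>2)" by simp
      also have "\<dots> \<le> (5 * real N)\<^sup>2 * (\<eta>' / (real N)\<^sup>2)"
      proof (rule mult_right_mono)
        have "(4 * real N + 1)\<^sup>2 \<le> (5 * real N)\<^sup>2" using N(1) by (intro power_mono) auto
        then show "real (card D) \<le> (5 * real N)\<^sup>2" using cD by linarith
      qed (use \<eta>' in auto)
      also have "\<dots> = \<eta>" using N(1) by (simp add: \<eta>'_def power_mult_distrib)
      finally show ?thesis .
    qed
    have "\<exists>h. (\<forall>K. compact K \<longrightarrow> K \<inter> discs_union D = {} \<longrightarrow> in_R K h) \<and>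
          (\<forall>z. cmod z \<le> 1 \<longrightarrow> z \<notin> discs_union D \<longrightarrow> cmod (h z - (z - x)) \<le> e) \<and>
          (\<forall>z. cmod (z - x) \<le> s / 2 \<longrightarrow> cmod (h z) \<le> \<tau>)"
      if x: "cmod x \<le> 1" "cmod (x - 1) \<ge> d" for x
    proof -
      define i where "i = grid_index N x"
      define x0 where "x0 = grid_point N i"
      have xx: "cmod (x - x0) \<le> 2 / N" using grid_index_close[OF N(1)] by (simp add: x0_def i_def)
      have iG: "i \<in> grid N" using grid_index_in_grid[OF x(1)] by (simp add: i_def)
      define add where "add p = (fst i + fst p, snd i + snd p)" for p :: "int \<times> int"
      have gp: "grid_point N (add p) = x0 + grid_point N p" for p
        by (simp add: add_def x0_def grid_point_def complex_eq_iff add_divide_distrib)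
      have inD: "(x0 + grid_point N p, \<eta>' / (real N)\<^sup>2) \<in> D" if "p \<in> I" for p
      proof -
        have "add p \<in> L" using iG I(1) that by (force simp: add_def L_def grid_def)
        moreover have "cmod (grid_point N (add p) - 1) \<ge> d / 2"
        proof -
          have eq: "x - 1 = (grid_point N (add p) - 1) + (x - x0) - grid_point N p" by (simp add: gp)
          have "cmod (x - 1) \<le> cmod (grid_point N (add p) - 1 + (x - x0)) + cmod (grid_point N p)"
            unfolding eq by (rule norm_triangle_ineq4)
          moreover have "cmod (grid_point N (add p) - 1 + (x - x0)) \<le> cmod (grid_point N (add p) - 1) + cmod (x - x0)"
            by (rule norm_triangle_ineq)
          ultimately have "cmod (x - 1) \<le> cmod (grid_point N (add p) - 1) + cmod (x - x0) + cmod (grid_point N p)"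
            by linarith
          then show ?thesis using x(2) xx N(3) I(2)[OF that] by linarith
        qed
        ultimately show ?thesis unfolding D_def gp[symmetric] by blast
      qed
      have off: "cmod (z - x0 - grid_point N p) \<ge> \<eta>' / (real N)\<^sup>2" if "z \<notin> discs_union D" "p \<in> I" for z p
      proof -
        have "z \<notin> ball (x0 + grid_point N p) (\<eta>' / (real N)\<^sup>2)"
          using inD[OF that(2)] that(1) unfolding discs_union_def by blast
        then show ?thesis by (simp add: dist_norm norm_minus_commute diff_diff_eq)
      qed
      have pos: "\<eta>' / (real N)\<^sup>2 > 0" using \<eta>' N(1) by simp
      define h where "h z = (z - x0) + (\<Sum>p\<in>I. a p / (z - x0 - grid_point N p))" for z
      have "in_R K h" if K: "compact K" "K \<inter> discs_union D = {}" for K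
      proof -
        have "in_R K (\<lambda>z. a p * (1 / (z - (x0 + grid_point N p))))" if p: "p \<in> I" for p
        proof -
          have "x0 + grid_point N p \<in> discs_union D"
            using inD[OF p] pos unfolding discs_union_def by force
          then show ?thesis using K by (intro in_R_mult in_R_const in_R_pole) auto
        qed
        then have "in_R K (\<lambda>z. (z - x0) + (\<Sum>p\<in>I. a p * (1 / (z - (x0 + grid_point N p)))))"
          using K by (intro in_R_add in_R_diff in_R_id in_R_const in_R_sum) auto
        then show ?thesis by (rule in_R_cong) (simp add: h_def diff_diff_eq)
      qed
      moreover have "cmod (h z - (z - x)) \<le> e" if z: "cmod z \<le> 1" "z \<notin> discs_union D" for z
      proof -
        have "cmod (z - x0) \<le> cmod z + (cmod (x - x0) + cmod x)"
          using norm_triangle_ineq4[of z x0] norm_triangle_ineq4[of x "x - x0"] by simp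
        then have "cmod (z - x0) \<le> 3" using z x xx N(2) by linarith
        then have "cmod (\<Sum>p\<in>I. a p / (z - x0 - grid_point N p)) \<le> e / 2"
          using off[OF z(2)] by (intro u1) auto
        moreover have eq: "h z - (z - x) = (x - x0) + (\<Sum>p\<in>I. a p / (z - x0 - grid_point N p))"
          by (simp add: h_def)
        have "cmod (h z - (z - x)) \<le> cmod (x - x0) + cmod (\<Sum>p\<in>I. a p / (z - x0 - grid_point N p))"
          unfolding eq by (rule norm_triangle_ineq)
        ultimately show ?thesis using xx N(5) by linarith
      qed
      moreover have "cmod (h z) \<le> \<tau>" if "cmod (z - x) \<le> s / 2" for z
      proof -
        have "cmod (z - x0) \<le> cmod (z - x) + cmod (x - x0)"
          using norm_triangle_ineq[of "z - x" "x - x0"] by simp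
        then have "cmod (z - x0) \<le> s" using that xx N(4) by linarith
        then show ?thesis unfolding h_def by (rule u2)
      qed
      ultimately show ?thesis by blast
    qed
    note H = this
    have Dp: "\<rho> > 0 \<and> cmod (1 - c) - \<rho> \<ge> d / 4" if "(c, \<rho>) \<in> D" for c \<rho>
    proof -
      have "\<rho> = \<eta>' / (real N)\<^sup>2" "cmod (c - 1) \<ge> d / 2" using that by (auto simp: D_def)
      moreover have "\<eta>' / (real N)\<^sup>2 > 0" using \<eta>' N(1) by simp
      ultimately show ?thesis using N2 norm_minus_commute[of c 1] by linarith
    qed
    have "grid_stage d e \<eta> (s / 2) \<tau> D"
      unfolding grid_stage_def by (intro conjI allI impI fD sD Dp[THEN conjunct1] Dp[THEN conjunct2] H)
    then show ?thesis by blast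
  qed
  then show ?thesis using s half_gt_zero by blast
qed

section \<open>Exponentials on the half plane minus small discs\<close>

lemma dbar_on_inverse:
  assumes f: "dbar_on S f b" and nz: "\<And>z. z \<in> S \<Longrightarrow> f z \<noteq> 0"
  shows "dbar_on S (\<lambda>z. 1 / f z) (\<lambda>z. - b z / (f z)\<^sup>2)"
proof -
  obtain a where a: "continuous_on S a" "\<And>z. z \<in> S \<Longrightarrow> wd f (a z) (b z) z"
    using f by (auto simp: dbar_on_def)
  have "wd (\<lambda>z. 1 / f z) (- a z / (f z)\<^sup>2) (- b z / (f z)\<^sup>2) z" if z: "z \<in> S" for z
    using Deriv.has_derivative_inverse[OF nz[OF z] a(2)[OF z, unfolded wd_def]] nz[OF z]
    by (simp add: wd_def divide_inverse power2_eq_square algebra_simps)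
  then show ?thesis
    using f a(1) nz dbar_on_continuous_fun[OF f] unfolding dbar_on_def
    by (intro conjI exI[of _ "\<lambda>z. - a z / (f z)\<^sup>2"] continuous_intros ballI) auto
qed

lemma dbar_on_poly:
  assumes "dbar_on S h (\<lambda>z. 0)"
  shows "dbar_on S (\<lambda>z. poly p (h z)) (\<lambda>z. 0)"
proof (induction p)
  case 0
  show ?case using dbar_on_const[OF dbar_on_open[OF assms], of 0] by simp
next
  case (pCons c p)
  have "dbar_on S (\<lambda>z. c + h z * poly p (h z)) (\<lambda>z. 0 + (h z * 0 + 0 * poly p (h z)))"
    by (intro dbar_on_add dbar_on_mult dbar_on_const assms pCons.IH dbar_on_open[OF assms])
  then show ?case by (rule dbar_on_cong) auto
qed

lemma dbar_on_exp: "open S \<Longrightarrow> dbar_on S (\<lambda>w. exp (c * w)) (\<lambda>w. 0)"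
  by (rule dbar_on_field[where d = "\<lambda>w. c * exp (c * w)"])
    (auto intro!: derivative_eq_intros continuous_intros)

text \<open>In the product rule each derivative \<open>\<beta> d\<close> is accompanied by factors
  between 0 and 1 only.\<close>

lemma dbar_on_prod:
  assumes E: "finite E" and \<psi>: "\<And>d. d \<in> E \<Longrightarrow> dbar_on UNIV (\<lambda>w. of_real (\<psi> d w)) (\<beta> d)"
    and le: "\<And>d w. d \<in> E \<Longrightarrow> 0 \<le> \<psi> d w \<and> \<psi> d w \<le> 1"
  shows "\<exists>b. dbar_on UNIV (\<lambda>w. of_real (\<Prod>d\<in>E. \<psi> d w)) b \<and> (\<forall>w. cmod (b w) \<le> (\<Sum>d\<in>E. cmod (\<beta> d w)))"
  using assms
proof (induction E)
  case empty
  show ?case using dbar_on_const[OF open_UNIV, of 1] by (intro exI[of _ "\<lambda>w. 0"]) auto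
next
  case (insert d E)
  obtain b where b: "dbar_on UNIV (\<lambda>w. of_real (\<Prod>d\<in>E. \<psi> d w)) b"
      "\<And>w. cmod (b w) \<le> (\<Sum>d\<in>E. cmod (\<beta> d w))"
    using insert by blast
  define b' where "b' w = of_real (\<psi> d w) * b w + \<beta> d w * of_real (\<Prod>d\<in>E. \<psi> d w)" for w
  have "dbar_on UNIV (\<lambda>w. of_real (\<psi> d w) * of_real (\<Prod>d\<in>E. \<psi> d w)) b'"
    unfolding b'_def by (intro dbar_on_mult insert.prems b) auto
  then have "dbar_on UNIV (\<lambda>w. of_real (\<Prod>d\<in>insert d E. \<psi> d w)) b'"
    by (rule dbar_on_cong) (use insert.hyps in auto)
  moreover have "cmod (b' w) \<le> (\<Sum>d\<in>insert d E. cmod (\<beta> d w))" for w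
  proof -
    have p: "0 \<le> (\<Prod>d\<in>E. \<psi> d w)" "(\<Prod>d\<in>E. \<psi> d w) \<le> 1"
      using insert.prems(2) by (auto intro!: prod_nonneg prod_le_1)
    have "cmod (b' w) \<le> \<psi> d w * cmod (b w) + cmod (\<beta> d w) * (\<Prod>d\<in>E. \<psi> d w)"
      unfolding b'_def using insert.prems(2)[of d w] p
      by (intro order_trans[OF norm_triangle_ineq]) (simp add: norm_mult del: of_real_prod)
    also have "\<dots> \<le> 1 * cmod (b w) + cmod (\<beta> d w) * 1"
      using insert.prems(2)[of d w] p by (intro add_mono mult_mono) auto
    finally show ?thesis using b(2)[of w] insert.hyps by simp
  qed
  ultimately show ?case by blast
qed

text \<open>The argument of \<open>smoothstep\<close> grows from 0 to 1 between the radii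
  \<open>R\<close> and \<open>2 * R\<close>. Using the squared distance keeps it smooth at the
  centre.\<close>

definition disc_cutoff :: "complex \<times> real \<Rightarrow> complex \<Rightarrow> real" where
  "disc_cutoff = (\<lambda>(e, R) w. smoothstep (((cmod (w - e))\<^sup>2 / R\<^sup>2 - 1) / 3))"

lemma disc_cutoff_bounds: "0 \<le> disc_cutoff d w" "disc_cutoff d w \<le> 1"
  by (auto simp: disc_cutoff_def smoothstep_nonneg smoothstep_le_1 split: prod.splits)

lemma disc_cutoff_0:
  assumes "R > 0" "cmod (w - e) \<le> R" shows "disc_cutoff (e, R) w = 0"
proof -
  have "(cmod (w - e))\<^sup>2 \<le> R\<^sup>2" using assms by (intro power_mono) auto
  then show ?thesis using assms by (simp add: disc_cutoff_def smoothstep_0 field_simps)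
qed

lemma disc_cutoff_1:
  assumes "R > 0" "cmod (w - e) \<ge> 2 * R" shows "disc_cutoff (e, R) w = 1"
proof -
  have "(2 * R)\<^sup>2 \<le> (cmod (w - e))\<^sup>2" using assms by (intro power_mono) auto
  then show ?thesis using assms by (simp add: disc_cutoff_def smoothstep_1 field_simps power2_eq_square)
qed

lemma dbar_on_disc_cutoff:
  assumes R: "R > 0"
  shows "\<exists>b. dbar_on UNIV (\<lambda>w. of_real (disc_cutoff (e, R) w)) b \<and>
    (\<forall>w. cmod (b w) \<le> 1 / R) \<and> (\<forall>w. cmod (w - e) \<le> R \<or> cmod (w - e) \<ge> 2 * R \<longrightarrow> b w = 0)"
proof -
  define t where "t w = ((cmod (w - e))\<^sup>2 / R\<^sup>2 - 1) / 3" for w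
  define b where "b w = of_real (smoothstep_deriv (t w)) * (of_real (1 / (3 * R\<^sup>2)) * (w - e))" for w
  have "dbar_on UNIV (\<lambda>w. of_real (1 / (3 * R\<^sup>2)) * of_real ((cmod (w - e))\<^sup>2) - of_real (1/3))
      (\<lambda>w. of_real (1 / (3 * R\<^sup>2)) * (w - e) - 0)"
    by (intro dbar_on_diff dbar_on_cmult dbar_on_norm_square dbar_on_const open_UNIV)
  then have "dbar_on UNIV (\<lambda>w. of_real (t w)) (\<lambda>w. of_real (1 / (3 * R\<^sup>2)) * (w - e))"
    by (rule dbar_on_cong) (auto simp: t_def diff_divide_distrib)
  from dbar_on_smoothstep[OF this]
  have 1: "dbar_on UNIV (\<lambda>w. of_real (disc_cutoff (e, R) w)) b"
    by (rule dbar_on_cong) (auto simp: disc_cutoff_def t_def b_def)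
  have 2: "b w = 0" if "cmod (w - e) \<le> R \<or> cmod (w - e) \<ge> 2 * R" for w
    using that
  proof
    assume "cmod (w - e) \<le> R"
    then have "(cmod (w - e))\<^sup>2 \<le> R\<^sup>2" by (intro power_mono) auto
    then have "t w \<le> 0" using R by (simp add: t_def field_simps)
    then show ?thesis by (simp add: b_def smoothstep_deriv_0)
  next
    assume "cmod (w - e) \<ge> 2 * R"
    then have "(2 * R)\<^sup>2 \<le> (cmod (w - e))\<^sup>2" using R by (intro power_mono) auto
    then have "t w \<ge> 1" using R by (simp add: t_def field_simps power2_eq_square)
    then show ?thesis by (simp add: b_def smoothstep_deriv_1)
  qed
  have 3: "cmod (b w) \<le> 1 / R" for w
  proof (cases "cmod (w - e) \<ge> 2 * R")
    case False
    have "cmod (b w) = smoothstep_deriv (t w) * (1 / (3 * R\<^sup>2) * cmod (w - e))"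
      using smoothstep_deriv_bounds(1)[of "t w"] R by (simp add: b_def norm_mult norm_divide norm_power)
    also have "\<dots> \<le> (3/2) * (1 / (3 * R\<^sup>2) * (2 * R))"
      using False R smoothstep_deriv_bounds[of "t w"] by (intro mult_mono) auto
    also have "\<dots> = 1 / R" using R by (simp add: power2_eq_square)
    finally show ?thesis .
  qed (use 2 R in auto)
  show ?thesis using 1 2 3 by blast
qed

section \<open>Area bounds and integrability in the plane\<close>

lemma emeasure_cball_complex_le:
  assumes "r \<ge> 0"
  shows "emeasure lborel (cball (e::complex) r) \<le> ennreal (4 * r\<^sup>2)"
proof -
  define l where "l = e - Complex r r"
  define u where "u = e + Complex r r"
  have "cball e r \<subseteq> cbox l u"
  proof
    fix w assume "w \<in> cball e r"
    then have "cmod (w - e) \<le> r" by (simp add: dist_norm norm_minus_commute)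
    then have "\<bar>Re w - Re e\<bar> \<le> r" "\<bar>Im w - Im e\<bar> \<le> r"
      using abs_Re_le_cmod[of "w - e"] abs_Im_le_cmod[of "w - e"] by auto
    then show "w \<in> cbox l u" by (auto simp: in_cbox_complex_iff l_def u_def)
  qed
  then have "emeasure lborel (cball e r) \<le> emeasure lborel (cbox l u)" by (intro emeasure_mono) auto
  also have "\<dots> = ennreal (4 * r\<^sup>2)"
  proof -
    have prod: "(\<Prod>b\<in>Basis. (u - l) \<bullet> b) = 4 * r\<^sup>2"
      by (simp add: Basis_complex_def l_def u_def inner_complex_def power2_eq_square)
    show ?thesis
      by (subst emeasure_lborel_cbox) (simp_all only: prod, use assms in \<open>auto simp: Basis_complex_def l_def u_def\<close>)
  qed
  finally show ?thesis .
qed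

lemma integral_indicator_cball:
  assumes "r \<ge> 0"
  shows "integrable lborel (\<lambda>w::complex. C * indicator (cball e r) w :: real)"
    and "C \<ge> 0 \<Longrightarrow> (\<integral>w. C * indicator (cball e r) (w::complex) \<partial>lborel) \<le> C * (4 * r\<^sup>2)"
proof -
  have fin: "emeasure lborel (cball e r) < \<infinity>"
    by (rule emeasure_lborel_cball_finite)
  show "integrable lborel (\<lambda>w::complex. C * indicator (cball e r) w :: real)"
    using fin by (intro integrable_mult_right integrable_real_indicator) auto
  have "measure lborel (cball e r) \<le> 4 * r\<^sup>2"
    unfolding measure_def using emeasure_cball_complex_le[OF assms, of e]
    by (metis enn2real_leI mult_nonneg_nonneg zero_le_numeral zero_le_power2)
  then show "(\<integral>w. C * indicator (cball e r) (w::complex) \<partial>lborel) \<le> C * (4 * r\<^sup>2)" if "C \<ge> 0"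
    using that by (simp add: mult_left_mono)
qed

text \<open>Dyadic comparison: if \<open>2 ^ j\<close> is the least such power that is at least
  \<open>cmod w\<close>, the integrand is at most \<open>8 / 8 ^ j\<close>. The disc of that radius
  has area at most \<open>4 * 4 ^ j\<close>, which leaves the geometric series of
  \<open>32 / 2 ^ j\<close>.\<close>

lemma integrable_inverse_cube: "integrable lborel (\<lambda>w::complex. 1 / (1 + cmod w) ^ 3)"
proof (rule integrableI_bounded)
  show "(\<lambda>w::complex. 1 / (1 + cmod w) ^ 3) \<in> borel_measurable lborel" by measurable
  have "ennreal (norm (1 / (1 + cmod w) ^ 3)) \<le> (\<Sum>j. ennreal (8 / 8 ^ j) * indicator (cball 0 (2 ^ j)) w)" for w
  proof -
    define j where "j = (LEAST j::nat. cmod w \<le> 2 ^ j)"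
    have ex: "\<exists>j::nat. cmod w \<le> 2 ^ j" using real_arch_pow[of 2 "cmod w"] by (auto intro: less_imp_le)
    have j: "cmod w \<le> 2 ^ j" unfolding j_def by (rule LeastI_ex[OF ex])
    have "1 / (1 + cmod w) ^ 3 \<le> 8 / 8 ^ j"
    proof (cases j)
      case 0
      have "1 / (1 + cmod w) ^ 3 \<le> 1 / 1" by (intro frac_le one_le_power) auto
      then show ?thesis using 0 by simp
    next
      case (Suc i)
      have "\<not> cmod w \<le> 2 ^ i" using not_less_Least[of i "\<lambda>j. cmod w \<le> 2 ^ j"] Suc by (simp add: j_def)
      then have "(2 ^ i) ^ 3 \<le> (1 + cmod w) ^ 3" by (intro power_mono) simp_all
      then have "1 / (1 + cmod w) ^ 3 \<le> 1 / (2 ^ i) ^ 3"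
        by (intro frac_le order_refl zero_less_power zero_le_one) simp_all
      also have "((2::real) ^ i) ^ 3 = (2 ^ 3) ^ i" by (simp only: power_mult[symmetric] mult.commute)
      also have "(2::real) ^ 3 = 8" by simp
      finally show ?thesis using Suc by simp
    qed
    then have "ennreal (norm (1 / (1 + cmod w) ^ 3)) \<le> ennreal (8 / 8 ^ j) * indicator (cball 0 (2 ^ j)) w"
      using j by (simp add: ennreal_leI)
    also have "\<dots> \<le> (\<Sum>j. ennreal (8 / 8 ^ j) * indicator (cball 0 (2 ^ j)) w)"
    proof -
      have "F j \<le> suminf F" for F :: "nat \<Rightarrow> ennreal"
        using sum_le_suminf[of F "{j}"] by simp
      then show ?thesis .
    qed
    finally show ?thesis .
  qed
  then have "(\<integral>\<^sup>+w. ennreal (norm (1 / (1 + cmod w) ^ 3)) \<partial>lborel)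
      \<le> (\<integral>\<^sup>+w. (\<Sum>j. ennreal (8 / 8 ^ j) * indicator (cball 0 (2 ^ j)) (w::complex)) \<partial>lborel)"
    by (intro nn_integral_mono)
  also have "\<dots> = (\<Sum>j. \<integral>\<^sup>+w. ennreal (8 / 8 ^ j) * indicator (cball 0 (2 ^ j)) (w::complex) \<partial>lborel)"
    by (rule nn_integral_suminf) (auto intro!: borel_measurable_times_ennreal borel_measurable_indicator)
  also have "\<dots> \<le> (\<Sum>j. ennreal (32 * (1/2) ^ j))"
  proof (rule suminf_le)
    fix j :: nat
    have "(\<integral>\<^sup>+w. ennreal (8 / 8 ^ j) * indicator (cball 0 (2 ^ j)) (w::complex) \<partial>lborel)
        = ennreal (8 / 8 ^ j) * emeasure lborel (cball (0::complex) (2 ^ j))"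
      by (rule nn_integral_cmult_indicator) auto
    also have "\<dots> \<le> ennreal (8 / 8 ^ j) * ennreal (4 * (2 ^ j)\<^sup>2)"
      by (intro mult_left_mono emeasure_cball_complex_le) auto
    also have "\<dots> = ennreal (8 / 8 ^ j * (4 * (2 ^ j)\<^sup>2))" by (rule ennreal_mult[symmetric]) auto
    also have "8 / 8 ^ j * (4 * (2 ^ j)\<^sup>2) = 32 * (1/2::real) ^ j"
    proof -
      have "(8::real) ^ j = 2 ^ j * (2 ^ j)\<^sup>2"
        by (simp add: power2_eq_square power_mult_distrib[symmetric])
      then show ?thesis by (simp add: power_divide)
    qed
    finally show "(\<integral>\<^sup>+w. ennreal (8 / 8 ^ j) * indicator (cball 0 (2 ^ j)) (w::complex) \<partial>lborel)
        \<le> ennreal (32 * (1/2) ^ j)" .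
  qed (rule summableI)+
  also have "\<dots> < \<infinity>"
  proof -
    have "summable (\<lambda>j. 32 * (1/2::real) ^ j)" by (intro summable_mult summable_geometric) simp
    then have "(\<Sum>j. ennreal (32 * (1/2) ^ j)) \<noteq> top" by (rule ennreal_suminf_neq_top) simp
    then show ?thesis by (simp add: less_top[symmetric] infinity_ennreal_def)
  qed
  finally show "(\<integral>\<^sup>+w. ennreal (norm (1 / (1 + cmod w) ^ 3)) \<partial>lborel) < \<infinity>" .
qed

text \<open>One of the four powers of decay is spent on the factor \<open>cmod (w + 1)\<close> in
  the approximation hypothesis; the remaining three make the integral over the half plane converge.
  The poles are simple, so \<open>cauchy_pompeiu\<close> evaluates each of them, and lie to the left
  of the region in which \<open>f\<close> lives.\<close>

definition weight4 :: "complex \<Rightarrow> complex" where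
  "weight4 w = 1 / ((w + 1) * (w + 2) * (w + 3) * (w + 4))"

lemma weight4_partial_fractions:
  assumes "w \<noteq> -1" "w \<noteq> -2" "w \<noteq> -3" "w \<noteq> -4"
  shows "weight4 w = (1/6) / (w + 1) - (1/2) / (w + 2) + (1/2) / (w + 3) - (1/6) / (w + 4)"
proof -
  have "w + 1 \<noteq> 0" "w + 2 \<noteq> 0" "w + 3 \<noteq> 0" "w + 4 \<noteq> 0"
    using assms by (auto simp: add_eq_0_iff2)
  then have "(1/6) / (w + 1) = (1/6) * ((w + 2) * (w + 3) * (w + 4)) * weight4 w"
    "(1/2) / (w + 2) = (1/2) * ((w + 1) * (w + 3) * (w + 4)) * weight4 w"
    "(1/2) / (w + 3) = (1/2) * ((w + 1) * (w + 2) * (w + 4)) * weight4 w"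
    "(1/6) / (w + 4) = (1/6) * ((w + 1) * (w + 2) * (w + 3)) * weight4 w"
    by (simp_all add: weight4_def)
  then have "(1/6) / (w + 1) - (1/2) / (w + 2) + (1/2) / (w + 3) - (1/6) / (w + 4)
      = ((1/6) * ((w + 2) * (w + 3) * (w + 4)) - (1/2) * ((w + 1) * (w + 3) * (w + 4))
        + (1/2) * ((w + 1) * (w + 2) * (w + 4)) - (1/6) * ((w + 1) * (w + 2) * (w + 3))) * weight4 w"
    by (simp only: left_diff_distrib distrib_right)
  also have "(1/6) * ((w + 2) * (w + 3) * (w + 4)) - (1/2) * ((w + 1) * (w + 3) * (w + 4))
        + (1/2) * ((w + 1) * (w + 2) * (w + 4)) - (1/6) * ((w + 1) * (w + 2) * (w + 3)) = 1"
    by (simp add: field_simps)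
  finally show ?thesis by simp
qed

lemma norm_add_half_plane:
  fixes k :: real
  assumes "Re w \<ge> 0" "k \<ge> 1"
  shows "cmod (w + of_real k) \<ge> (1 + cmod w) / 2"
proof -
  have "(cmod w)\<^sup>2 + 1 = ((1 + cmod w) / 2)\<^sup>2 + ((1 - cmod w)\<^sup>2 + 2 * (cmod w)\<^sup>2 + 2) / 4"
    by (simp add: power2_eq_square field_simps)
  then have "((1 + cmod w) / 2)\<^sup>2 \<le> (cmod w)\<^sup>2 + 1" by simp
  also have "\<dots> \<le> (cmod (w + of_real k))\<^sup>2"
  proof -
    have "k\<^sup>2 \<ge> 1" using assms(2) by simp
    moreover have "Re w * k \<ge> 0" using assms by simp
    moreover have "(cmod (w + of_real k))\<^sup>2 = (cmod w)\<^sup>2 + 2 * (Re w * k) + k\<^sup>2"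
      unfolding cmod_power2 by (simp add: power2_eq_square algebra_simps)
    ultimately show ?thesis by linarith
  qed
  finally show ?thesis by (rule power2_le_imp_le) simp
qed

lemma weight4_half_plane:
  assumes "Re w \<ge> 0"
  shows "cmod (w + 1) * cmod (weight4 w) \<le> 8 / (1 + cmod w) ^ 3"
proof -
  define h where "h = (1 + cmod w) / 2"
  have h: "h > 0" by (simp add: h_def add_pos_nonneg)
  have k: "h \<le> cmod (w + 1)" "h \<le> cmod (w + 2)" "h \<le> cmod (w + 3)" "h \<le> cmod (w + 4)"
    using norm_add_half_plane[OF assms, of 1] norm_add_half_plane[OF assms, of 2]
      norm_add_half_plane[OF assms, of 3] norm_add_half_plane[OF assms, of 4] by (simp_all add: h_def)
  have "cmod (w + 1) * cmod (weight4 w) = 1 / (cmod (w + 2) * cmod (w + 3) * cmod (w + 4))"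
  proof -
    have "w + 1 \<noteq> 0" using k(1) h by auto
    then show ?thesis by (simp add: weight4_def norm_divide norm_mult)
  qed
  also have "\<dots> \<le> 1 / (h * h * h)"
    using k h by (intro frac_le mult_mono mult_pos_pos) auto
  also have "\<dots> = 8 / (1 + cmod w) ^ 3" by (simp add: h_def power3_eq_cube)
  finally show ?thesis .
qed

lemma weight4_far:
  assumes "T \<ge> 10" "cmod w \<ge> T"
  shows "cmod (weight4 w) \<le> 16 / T ^ 4"
proof -
  have k: "T / 2 \<le> cmod (w + of_real k)" if "0 \<le> k" "k \<le> 4" for k :: real
    using norm_diff_ineq[of w "of_real k"] that assms by simp
  have "cmod (weight4 w) = 1 / (cmod (w + 1) * cmod (w + 2) * cmod (w + 3) * cmod (w + 4))"
    by (simp add: weight4_def norm_divide norm_mult)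
  also have "\<dots> \<le> 1 / ((T / 2) * (T / 2) * (T / 2) * (T / 2))"
    using k[of 1] k[of 2] k[of 3] k[of 4] assms by (intro frac_le mult_mono mult_pos_pos) auto
  also have "\<dots> = 16 / T ^ 4" by (simp add: power4_eq_xxxx)
  finally show ?thesis .
qed

lemma dbar_on_weight4:
  assumes "open S" "\<And>w. w \<in> S \<Longrightarrow> Re w > -1"
  shows "dbar_on S weight4 (\<lambda>w. 0)"
proof -
  have 1: "dbar_on S (\<lambda>w. (w + 1) * (w + 2) * (w + 3) * (w + 4)) (\<lambda>w. 0)"
  proof (rule dbar_on_cong)
    show "dbar_on S (\<lambda>w. (w + 1) * (w + 2) * (w + 3) * (w + 4))
      (\<lambda>w. (w + 1) * (w + 2) * (w + 3) * (0 + 0) + ((w + 1) * (w + 2) * (0 + 0)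
         + ((w + 1) * (0 + 0) + (0 + 0) * (w + 2)) * (w + 3)) * (w + 4))"
      by (intro dbar_on_mult dbar_on_add dbar_on_id dbar_on_const assms)
  qed auto
  have "(w + 1) * (w + 2) * (w + 3) * (w + 4) \<noteq> 0" if "w \<in> S" for w
  proof -
    have "w + 1 \<noteq> 0" "w + 2 \<noteq> 0" "w + 3 \<noteq> 0" "w + 4 \<noteq> 0"
      using assms(2)[OF that] by (auto simp: complex_eq_iff)
    then show ?thesis by simp
  qed
  from dbar_on_inverse[OF 1 this] show ?thesis by (rule dbar_on_cong) (auto simp: weight4_def)
qed

lemma open_discs_union: "open (discs_union D)"
  by (auto simp: discs_union_def)

text \<open>The function \<open>exp (\<rho> * w)\<close> cannot be approximated on the right half plane minus small discs
  by functions that are bounded and holomorphic there. Testing against the \<open>cnj w\<close>-derivative of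
  the cutoff \<open>A = \<Theta> P\<close>, where \<open>\<Theta>\<close> cuts off to the left of the imaginary axis and \<open>P\<close> cuts off
  the discs, annihilates such functions up to the contribution of \<open>\<Omega>\<close> near infinity; for
  \<open>exp (\<rho> * w)\<close> it yields the residues of \<open>exp (\<rho> * w) * weight4 w\<close> at \<open>-1, -2, -3, -4\<close>. The
  discs may overlap, since only the sum of the derivatives of the cutoffs enters.\<close>

lemma exp_not_approximable:
  assumes \<rho>: "0 < \<rho>" "\<rho> \<le> \<rho>2" and C0: "0 \<le> C0"
  shows "\<exists>\<epsilon>>0. \<forall>E f S Cf. finite E \<longrightarrow> (\<forall>e R. (e, R) \<in> E \<longrightarrow> R > 0) \<longrightarrow>
    (\<Sum>(e, R)\<in>E. R * exp (\<rho>2 * (cmod e + 2 * R))) \<le> C0 \<longrightarrow> dbar_on S f (\<lambda>w. 0) \<longrightarrow>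
    {w. Re w \<ge> 0} - discs_union E \<subseteq> S \<longrightarrow>
    (\<forall>w. Re w \<ge> 0 \<longrightarrow> w \<notin> discs_union E \<longrightarrow> cmod (f w) \<le> Cf) \<longrightarrow>
    \<not> (\<forall>w. Re w \<ge> 0 \<longrightarrow> w \<notin> discs_union E \<longrightarrow>
        cmod (exp (of_real \<rho> * w) - f w) \<le> \<epsilon> * exp (\<rho>2 * Re w) * cmod (w + 1))"
proof -
  define c where "c = bump_mass"
  define x where "x = exp (- \<rho>)"
  \<comment> \<open>This is \<open>x / 6 - x^2 / 2 + x^3 / 2 - x^4 / 6\<close>: the values
    \<open>exp (- \<rho> * k)\<close> at the four poles combined with the partial fraction
    coefficients of \<open>weight4\<close>.\<close>
  define \<kappa> where "\<kappa> = x * (1 - x) ^ 3 / 6"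
  define J where "J = (\<integral>w. 1 / (1 + cmod w) ^ 3 \<partial>lborel)"
  \<comment> \<open>The term with \<open>J\<close> comes from the strip where
    \<open>\<Theta>\<close> varies, the term with \<open>C0\<close> from the disc cutoffs; 1 keeps
    \<open>Q\<close> positive. The choice of \<open>\<epsilon>\<close> makes their joint
    contribution at most half of the main term \<open>c * \<kappa>\<close>.\<close>
  define Q where "Q = 8 * exp \<rho>2 * J + 128 * C0 + 1"
  define \<epsilon> where "\<epsilon> = c * \<kappa> / (2 * Q)"
  have c: "c > 0" by (simp add: c_def bump_mass_pos)
  have x: "0 < x" "x < 1" using \<rho> by (auto simp: x_def)
  have \<kappa>: "\<kappa> > 0" using x by (simp add: \<kappa>_def)
  have J: "J \<ge> 0" unfolding J_def by (rule Bochner_Integration.integral_nonneg) auto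
  have Q: "Q \<ge> 1" using J C0 by (simp add: Q_def)
  have \<epsilon>: "\<epsilon> > 0" using c \<kappa> Q by (simp add: \<epsilon>_def)
  show ?thesis
  proof (intro exI[of _ \<epsilon>] conjI allI impI notI)
    show "0 < \<epsilon>" by (rule \<epsilon>)
    fix E f S Cf
    assume E: "finite E" and R: "\<forall>e R. (e, R) \<in> E \<longrightarrow> R > 0"
      and sum: "(\<Sum>(e, R)\<in>E. R * exp (\<rho>2 * (cmod e + 2 * R))) \<le> C0"
      and f: "dbar_on S f (\<lambda>w. 0)" and S: "{w. Re w \<ge> 0} - discs_union E \<subseteq> S"
      and Cf: "\<forall>w. Re w \<ge> 0 \<longrightarrow> w \<notin> discs_union E \<longrightarrow> cmod (f w) \<le> Cf"
      and approx: "\<forall>w. Re w \<ge> 0 \<longrightarrow> w \<notin> discs_union E \<longrightarrow>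
        cmod (exp (of_real \<rho> * w) - f w) \<le> \<epsilon> * exp (\<rho>2 * Re w) * cmod (w + 1)"
    define Cf' where "Cf' = max Cf 0"
    \<comment> \<open>Beyond radius \<open>T\<close> no disc cutoff is active, and the part near
      infinity is at most \<open>c * \<kappa> / 4\<close>. Unlike \<open>\<epsilon>\<close>, the
      radius may depend on the discs and on the bound \<open>Cf\<close>.\<close>
    define T where "T = 10 + (\<Sum>(e, R)\<in>E. cmod e + 2 * R) + 1024 * (exp \<rho> + Cf') / (c * \<kappa>)"
    have Rpos: "snd d > 0" if "d \<in> E" for d using R that by (metis prod.collapse)
    have nnE: "0 \<le> (case d of (e, R) \<Rightarrow> cmod e + 2 * R)" if "d \<in> E" for d
      using Rpos[OF that] by (cases d) (simp add: add_nonneg_nonneg)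
    have sE: "(\<Sum>(e, R)\<in>E. cmod e + 2 * R) \<ge> 0"
      by (rule sum_nonneg) (rule nnE)
    have tE: "1024 * (exp \<rho> + Cf') / (c * \<kappa>) \<ge> 0" using c \<kappa> by (simp add: Cf'_def add_nonneg_nonneg)
    have T10: "T \<ge> 10" using sE tE by (simp add: T_def)
    have TE: "cmod e + 2 * R \<le> T" if "(e, R) \<in> E" for e R
    proof -
      have "(\<lambda>(e, R). cmod e + 2 * R) (e, R) \<le> (\<Sum>(e, R)\<in>E. cmod e + 2 * R)"
        by (rule member_le_sum[OF that nnE E]) simp
      then show ?thesis using tE by (simp add: T_def)
    qed
    have TC: "256 * (exp \<rho> + Cf') / T ^ 3 \<le> c * \<kappa> / 4"
    proof -
      have "1024 * (exp \<rho> + Cf') / (c * \<kappa>) \<le> T" using sE by (simp add: T_def)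
      also have "T \<le> T ^ 3" using T10 by (simp add: power3_eq_cube mult_ge1_I)
      finally have "1024 * (exp \<rho> + Cf') \<le> T ^ 3 * (c * \<kappa>)" using c \<kappa> by (simp add: pos_divide_le_eq)
      then show ?thesis using T10 by (simp add: pos_divide_le_eq mult.commute)
    qed
    define \<Theta> where "\<Theta> w = smoothstep (Re w)" for w
    define B\<Theta> where "B\<Theta> w = complex_of_real (smoothstep_deriv (Re w)) * (1/2)" for w
    have d\<Theta>: "dbar_on UNIV (\<lambda>w. of_real (\<Theta> w)) B\<Theta>"
      unfolding \<Theta>_def B\<Theta>_def by (rule dbar_on_smoothstep[OF dbar_on_Re[OF open_UNIV]])
    have "\<forall>d\<in>E. \<exists>b. dbar_on UNIV (\<lambda>w. of_real (disc_cutoff d w)) b \<and>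
        (\<forall>w. cmod (b w) \<le> 1 / snd d) \<and> (\<forall>w. cmod (w - fst d) \<ge> 2 * snd d \<longrightarrow> b w = 0)"
    proof
      fix d assume d: "d \<in> E"
      obtain b where "dbar_on UNIV (\<lambda>w. of_real (disc_cutoff (fst d, snd d) w)) b" "\<forall>w. cmod (b w) \<le> 1 / snd d"
          "\<forall>w. cmod (w - fst d) \<le> snd d \<or> cmod (w - fst d) \<ge> 2 * snd d \<longrightarrow> b w = 0"
        using dbar_on_disc_cutoff[OF Rpos[OF d], of "fst d"] by blast
      then show "\<exists>b. dbar_on UNIV (\<lambda>w. of_real (disc_cutoff d w)) b \<and>
          (\<forall>w. cmod (b w) \<le> 1 / snd d) \<and> (\<forall>w. cmod (w - fst d) \<ge> 2 * snd d \<longrightarrow> b w = 0)"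
        by (intro exI[of _ b]) simp
    qed
    from bchoice[OF this] obtain \<beta> where \<beta>: "\<And>d. d \<in> E \<Longrightarrow> dbar_on UNIV (\<lambda>w. of_real (disc_cutoff d w)) (\<beta> d)"
        "\<And>d w. d \<in> E \<Longrightarrow> cmod (\<beta> d w) \<le> 1 / snd d"
        "\<And>d w. d \<in> E \<Longrightarrow> cmod (w - fst d) \<ge> 2 * snd d \<Longrightarrow> \<beta> d w = 0"
      by blast
    define P where "P w = (\<Prod>d\<in>E. disc_cutoff d w)" for w
    obtain BP where dP: "dbar_on UNIV (\<lambda>w. of_real (P w)) BP"
      and BP: "\<And>w. cmod (BP w) \<le> (\<Sum>d\<in>E. cmod (\<beta> d w))"
      using dbar_on_prod[of E disc_cutoff \<beta>, OF E \<beta>(1)] disc_cutoff_bounds unfolding P_def by blast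
    have P01: "0 \<le> P w" "P w \<le> 1" for w
      unfolding P_def using disc_cutoff_bounds by (auto intro!: prod_nonneg prod_le_1)
    have \<Theta>01: "0 \<le> \<Theta> w" "\<Theta> w \<le> 1" for w by (auto simp: \<Theta>_def smoothstep_nonneg smoothstep_le_1)
    have P0: "P w = 0" if w: "w \<in> discs_union E" for w
    proof -
      obtain e r where "(e, r) \<in> E" "cmod (w - e) < r"
        using w by (auto simp: discs_union_def dist_norm norm_minus_commute)
      moreover from this have "disc_cutoff (e, r) w = 0" using R by (intro disc_cutoff_0) auto
      ultimately show ?thesis unfolding P_def using E by (intro prod_zero) auto
    qed
    have BP0: "BP w = 0" if "w \<in> discs_union E" for w
    proof -
      have "wd (\<lambda>w. of_real (P w)) 0 0 w"
        by (rule wd_transform[OF wd_const open_discs_union that]) (use P0 in auto)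
      then show ?thesis using dP wd_unique unfolding dbar_on_def by blast
    qed
    have P1: "P w = 1" if "cmod w \<ge> T" for w
      unfolding P_def
    proof (rule prod.neutral, rule ballI)
      fix d assume d: "d \<in> E"
      obtain e r where [simp]: "d = (e, r)" by (cases d)
      have "cmod (w - e) \<ge> 2 * r" using TE[of e r] d that norm_triangle_ineq2[of w e] by simp
      then show "disc_cutoff d w = 1" using R d by (simp add: disc_cutoff_1)
    qed
    obtain b\<Omega> where d\<Omega>': "dbar_on UNIV (\<lambda>w. of_real (disc_cutoff (0, T) w)) b\<Omega>"
      and b\<Omega>: "\<And>w. cmod (b\<Omega> w) \<le> 1 / T" "\<And>w. cmod w \<le> T \<or> cmod w \<ge> 2 * T \<Longrightarrow> b\<Omega> w = 0"
      using dbar_on_disc_cutoff[of T 0] T10 by auto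
    define \<Omega> where "\<Omega> w = 1 - complex_of_real (disc_cutoff (0, T) w)" for w
    define B\<Omega> where "B\<Omega> w = - b\<Omega> w" for w
    have d\<Omega>: "dbar_on UNIV \<Omega> B\<Omega>"
      using dbar_on_diff[OF dbar_on_const[OF open_UNIV, of 1] d\<Omega>'] by (simp add: \<Omega>_def[abs_def] B\<Omega>_def[abs_def])
    have \<Omega>1: "\<Omega> w = 1" if "cmod w \<le> T" for w using that T10 disc_cutoff_0[of T w 0] by (simp add: \<Omega>_def)
    have \<Omega>0: "\<Omega> w = 0" if "cmod w \<ge> 2 * T" for w using that T10 disc_cutoff_1[of T w 0] by (simp add: \<Omega>_def)
    have \<Omega>n: "cmod (\<Omega> w) \<le> 1" for w
    proof -
      have "\<Omega> w = of_real (1 - disc_cutoff (0, T) w)" by (simp add: \<Omega>_def)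
      then have "cmod (\<Omega> w) = \<bar>1 - disc_cutoff (0, T) w\<bar>" by (simp only: norm_of_real)
      then show ?thesis using disc_cutoff_bounds[of "(0, T)" w] by linarith
    qed
    define A where "A w = complex_of_real (\<Theta> w) * of_real (P w)" for w
    define BA where "BA w = of_real (\<Theta> w) * BP w + B\<Theta> w * of_real (P w)" for w
    have dA: "dbar_on UNIV A BA" unfolding A_def BA_def by (rule dbar_on_mult[OF d\<Theta> dP])
    have A0: "A w = 0 \<and> BA w = 0" if "Re w \<le> 0 \<or> w \<in> discs_union E" for w
      using that P0 BP0 by (auto simp: A_def BA_def \<Theta>_def B\<Theta>_def smoothstep_0 smoothstep_deriv_0)
    have An: "cmod (1 - A w) \<le> 1" "cmod (A w) \<le> 1" for w
    proof -
      have "0 \<le> \<Theta> w * P w" "\<Theta> w * P w \<le> 1"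
        using P01[of w] \<Theta>01[of w] by (auto intro: mult_le_one)
      moreover have "A w = of_real (\<Theta> w * P w)" "1 - A w = of_real (1 - \<Theta> w * P w)" by (auto simp: A_def)
      then have "cmod (A w) = \<bar>\<Theta> w * P w\<bar>" "cmod (1 - A w) = \<bar>1 - \<Theta> w * P w\<bar>"
        by (simp_all only: norm_of_real)
      ultimately show "cmod (1 - A w) \<le> 1" "cmod (A w) \<le> 1" by linarith+
    qed
    \<comment> \<open>\<open>V\<close> carries the residues: it equals the exponential near the
      poles of \<open>weight4\<close>, where \<open>A\<close> is 0 and \<open>\<Omega>\<close> is 1,
      and has compact support. The factor \<open>1 - A\<close> removes it where the exponential is
      large, except near the discs.\<close>
    define V where "V w = ((1 - A w) * \<Omega> w) * exp (of_real \<rho> * w)" for w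
    define BV where "BV w = ((1 - A w) * B\<Omega> w - BA w * \<Omega> w) * exp (of_real \<rho> * w)" for w
    have dV: "dbar_on UNIV V BV"
    proof (rule dbar_on_cong)
      show "dbar_on UNIV (\<lambda>w. ((1 - A w) * \<Omega> w) * exp (of_real \<rho> * w))
        (\<lambda>w. ((1 - A w) * \<Omega> w) * 0 + ((1 - A w) * B\<Omega> w + (0 - BA w) * \<Omega> w) * exp (of_real \<rho> * w))"
        by (intro dbar_on_mult dbar_on_diff dbar_on_const dbar_on_exp dA d\<Omega> open_UNIV)
    qed (auto simp: V_def BV_def)
    have Vsupp: "V w = 0" if "cmod w > 2 * T" for w using \<Omega>0[of w] that by (simp add: V_def)
    have BV0: "BV w = 0" if "Re w \<le> 0" "cmod w \<le> T" for w
      using A0[of w] b\<Omega>(2)[of w] that by (simp add: BV_def B\<Omega>_def)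
    have res: "integrable lborel (\<lambda>w. BV w / (w + of_real k))
        \<and> (\<integral>w. BV w / (w + of_real k) \<partial>lborel) = - of_real (c * exp (- \<rho> * k))"
      if k: "1 \<le> k" "k \<le> 4" for k :: real
    proof -
      have hol: "BV w = 0" if "w \<in> ball (- of_real k) (1/2)" for w
      proof (rule BV0)
        have *: "cmod (w + of_real k) < 1/2" using that by (simp add: dist_norm norm_minus_commute)
        show "Re w \<le> 0" using * abs_Re_le_cmod[of "w + of_real k"] k by simp
        have "cmod w \<le> cmod (w + of_real k) + cmod (of_real k :: complex)"
          using norm_triangle_ineq4[of "w + of_real k" "of_real k"] by simp
        then show "cmod w \<le> T" using * k T10 by simp
      qed
      have v: "V (- of_real k) = of_real (exp (- \<rho> * k))"
        using A0[of "- of_real k"] \<Omega>1[of "- of_real k"] k T10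
        by (simp add: V_def exp_of_real[symmetric])
      show ?thesis
        using cauchy_pompeiu[where L = "2 * T" and z = "- of_real k" and e = "1/2", OF dV Vsupp _ hol]
        by (simp add: v c_def)
    qed
    have BVW: "BV w * weight4 w = (1/6) * (BV w / (w + 1)) - (1/2) * (BV w / (w + 2))
        + (1/2) * (BV w / (w + 3)) - (1/6) * (BV w / (w + 4))" for w
    proof (cases "w \<in> {-1, -2, -3, -4}")
      case True
      then have "BV w = 0" using T10 by (intro BV0) auto
      then show ?thesis by simp
    next
      case False
      have "b * (p / u - q / v + q / s - p / t) = p * (b / u) - q * (b / v) + q * (b / s) - p * (b / t)"
        for b p q u v s t :: complex by (simp add: algebra_simps)
      moreover have "weight4 w = (1/6) / (w + 1) - (1/2) / (w + 2) + (1/2) / (w + 3) - (1/6) / (w + 4)"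
        using False by (intro weight4_partial_fractions) auto
      ultimately show ?thesis by (simp only:)
    qed
    have iV: "integrable lborel (\<lambda>w. BV w * weight4 w)"
      and IV: "(\<integral>w. BV w * weight4 w \<partial>lborel) = - of_real (c * \<kappa>)"
    proof -
      have r: "integrable lborel (\<lambda>w. BV w / (w + 1))" "(\<integral>w. BV w / (w + 1) \<partial>lborel) = - of_real (c * x)"
        "integrable lborel (\<lambda>w. BV w / (w + 2))" "(\<integral>w. BV w / (w + 2) \<partial>lborel) = - of_real (c * x^2)"
        "integrable lborel (\<lambda>w. BV w / (w + 3))" "(\<integral>w. BV w / (w + 3) \<partial>lborel) = - of_real (c * x^3)"
        "integrable lborel (\<lambda>w. BV w / (w + 4))" "(\<integral>w. BV w / (w + 4) \<partial>lborel) = - of_real (c * x^4)"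
        using res[of 1] res[of 2] res[of 3] res[of 4]
        by (simp_all add: x_def exp_of_nat_mult[symmetric] mult.commute)
      show "integrable lborel (\<lambda>w. BV w * weight4 w)"
        unfolding BVW using r
        by (intro Bochner_Integration.integrable_diff Bochner_Integration.integrable_add integrable_mult_right) auto
      have lin: "(\<integral>w. p * f1 w - q * f2 w + q * f3 w - p * f4 w \<partial>lborel)
          = p * integral\<^sup>L lborel f1 - q * integral\<^sup>L lborel f2 + q * integral\<^sup>L lborel f3 - p * integral\<^sup>L lborel f4"
        if "integrable lborel f1" "integrable lborel f2" "integrable lborel f3" "integrable lborel f4"
        for p q :: complex and f1 f2 f3 f4 :: "complex \<Rightarrow> complex"
        using that by simp
      have "(\<integral>w. BV w * weight4 w \<partial>lborel) = (1/6) * (- of_real (c * x)) - (1/2) * (- of_real (c * x^2))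
          + (1/2) * (- of_real (c * x^3)) - (1/6) * (- of_real (c * x^4))"
        unfolding BVW r(2)[symmetric] r(4)[symmetric] r(6)[symmetric] r(8)[symmetric]
        by (rule lin[OF r(1,3,5,7)])
      also have "\<dots> = - of_real (c * ((1/6) * x - (1/2) * x^2 + (1/2) * x^3 - (1/6) * x^4))"
        by (simp add: algebra_simps)
      also have "(1/6) * x - (1/2) * x^2 + (1/2) * x^3 - (1/6) * x^4 = \<kappa>"
        by (simp add: \<kappa>_def power2_eq_square power3_eq_cube power4_eq_xxxx field_simps)
      finally show "(\<integral>w. BV w * weight4 w \<partial>lborel) = - of_real (c * \<kappa>)" .
    qed
    define Cl where "Cl = {w. Re w \<ge> 0} - discs_union E"
    define S' where "S' = S \<inter> {w. Re w > - (1/2)}"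
    have cCl: "closed Cl" unfolding Cl_def
      by (intro closed_Diff open_discs_union closed_halfspace_Re_ge)
    have oS': "open S'" unfolding S'_def
      by (intro open_Int dbar_on_open[OF f] open_halfspace_Re_gt)
    have ClS: "Cl \<subseteq> S'" using S by (auto simp: Cl_def S'_def)
    \<comment> \<open>Since \<open>A\<close> vanishes outside \<open>Cl\<close>, \<open>U\<close>
      extends by 0 to the plane and the integral of its \<open>cnj\<close>-derivative is 0. Adding
      this derivative to \<open>BV * weight4\<close> replaces the exponential by
      \<open>exp (\<rho> * w) - f w\<close> in all terms with \<open>BA\<close>, which is where the
      approximation enters.\<close>
    define U where "U w = (A w * \<Omega> w) * (f w * weight4 w)" for w
    define BU where "BU w = (A w * B\<Omega> w + BA w * \<Omega> w) * (f w * weight4 w)" for w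
    have dU: "dbar_on S' U BU"
    proof (rule dbar_on_cong)
      show "dbar_on S' (\<lambda>w. (A w * \<Omega> w) * (f w * weight4 w))
        (\<lambda>w. (A w * \<Omega> w) * (f w * 0 + 0 * weight4 w) + (A w * B\<Omega> w + BA w * \<Omega> w) * (f w * weight4 w))"
        by (intro dbar_on_mult dbar_on_weight4 oS' dbar_on_subset[OF dA] dbar_on_subset[OF d\<Omega>]
            dbar_on_subset[OF f]) (auto simp: S'_def)
    qed (auto simp: U_def BU_def)
    have U0: "U w = 0" if "w \<in> S' - Cl" for w
    proof -
      have "Re w \<le> 0 \<or> w \<in> discs_union E" using that by (auto simp: Cl_def)
      then show ?thesis using A0 by (auto simp: U_def)
    qed
    note ext = dbar_on_extend_zero(1)[OF dU cCl ClS U0]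
    define BU' where "BU' w = (if w \<in> Cl then BU w else 0)" for w
    have "cmod w > 2 * T \<Longrightarrow> (if w \<in> Cl then U w else 0) = 0" for w
      using \<Omega>0[of w] by (simp add: U_def)
    from integral_dbar_zero[OF ext this]
    have iU: "integrable lborel BU'" and IU: "integral\<^sup>L lborel BU' = 0"
      by (simp_all add: BU'_def[abs_def])
    define C' where "C' = 16 / T ^ 5 * (exp \<rho> + Cf')"
    have C': "C' \<ge> 0" using T10 by (simp add: C'_def Cf'_def add_nonneg_nonneg)
    define Wd where "Wd w = (\<Sum>d\<in>E. (8 / snd d * exp (\<rho>2 * (cmod (fst d) + 2 * snd d)))
        * indicator (cball (fst d) (2 * snd d)) w)" for w :: complex
    define W where "W w = \<epsilon> * (8 * exp \<rho>2 * (1 / (1 + cmod w) ^ 3) + Wd w) + C' * indicator (cball 0 (2 *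
        T)) w" for w :: complex
    have Wd0: "Wd w \<ge> 0" for w unfolding Wd_def
      by (rule sum_nonneg) (use Rpos less_imp_le in \<open>force intro!: mult_nonneg_nonneg\<close>)
    \<comment> \<open>\<open>B\<Omega>\<close> lives between the radii \<open>T\<close> and
      \<open>2 * T\<close> and is at most \<open>1 / T\<close>, and the weight is at most
      \<open>16 / T ^ 4\<close> there. With an area of order \<open>T^2\<close> the total is of
      order \<open>1 / T ^ 3\<close>.\<close>
    have far: "cmod (a * (B\<Omega> w * h * weight4 w)) \<le> 16 / T ^ 5 * M * indicator (cball 0 (2 * T)) w"
      if "cmod a \<le> 1" "cmod w > T \<Longrightarrow> a = 0 \<or> cmod h \<le> M" "M \<ge> 0" for a h w M
    proof (cases "cmod w \<le> T \<or> cmod w \<ge> 2 * T \<or> a = 0")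
      case True
      then have "a * (B\<Omega> w * h * weight4 w) = 0" using b\<Omega>(2)[of w] by (auto simp: B\<Omega>_def)
      then have "cmod (a * (B\<Omega> w * h * weight4 w)) = 0" by (simp only: norm_zero)
      moreover have "0 \<le> 16 / T ^ 5 * M * indicator (cball 0 (2 * T)) w"
        using that(3) T10 by (intro mult_nonneg_nonneg) auto
      ultimately show ?thesis by linarith
    next
      case False
      have "cmod (a * (B\<Omega> w * h * weight4 w)) = cmod a * (cmod (b\<Omega> w) * cmod h * cmod (weight4 w))"
        by (simp add: norm_mult B\<Omega>_def)
      also have "\<dots> \<le> 1 * (1 / T * M * (16 / T ^ 4))"
        using that b\<Omega>(1)[of w] weight4_far[OF T10, of w] T10 False
        by (intro mult_mono mult_nonneg_nonneg) auto
      also have "\<dots> = 16 / T ^ 5 * M" by (simp add: field_simps power_Suc[symmetric] del: power_Suc)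
      finally show ?thesis using False by simp
    qed
    have far1: "cmod ((1 - A w) * (B\<Omega> w * exp (of_real \<rho> * w) * weight4 w)) \<le> 16 / T ^ 5 * exp \<rho> * indicator
        (cball 0 (2 * T)) w" for w
    proof (rule far[OF An(1)])
      assume w: "cmod w > T"
      \<comment> \<open>Beyond radius \<open>T\<close> either \<open>Re w \<ge> 1\<close> and then
        \<open>A w = 1\<close>, or \<open>Re w < 1\<close> and the exponential is bounded.\<close>
      show "1 - A w = 0 \<or> cmod (exp (of_real \<rho> * w)) \<le> exp \<rho>"
      proof (cases "Re w \<ge> 1")
        case True
        then show ?thesis using P1[of w] w by (simp add: A_def \<Theta>_def smoothstep_1)
      next
        case False
        then have "\<rho> * Re w \<le> \<rho> * 1" using \<rho> by (intro mult_left_mono) auto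
        then show ?thesis by simp
      qed
    qed simp
    have bound: "cmod (BV w * weight4 w + BU' w) \<le> W w" for w
    proof (cases "w \<in> Cl")
      case False
      then have "Re w \<le> 0 \<or> w \<in> discs_union E" by (auto simp: Cl_def)
      then have "BV w * weight4 w + BU' w = (1 - A w) * (B\<Omega> w * exp (of_real \<rho> * w) * weight4 w)"
        using A0 False by (simp add: BV_def BU'_def)
      then have "cmod (BV w * weight4 w + BU' w) \<le> 16 / T ^ 5 * exp \<rho> * indicator (cball 0 (2 * T)) w"
        using far1 by simp
      also have "\<dots> \<le> C' * indicator (cball 0 (2 * T)) w"
        unfolding C'_def using T10 by (intro mult_right_mono mult_left_mono) (auto simp: Cf'_def)
      also have "\<dots> \<le> W w" using \<epsilon> Wd0[of w] by (simp add: W_def add_nonneg_nonneg)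
      finally show ?thesis .
    next
      case True
      then have w: "Re w \<ge> 0" "w \<notin> discs_union E" by (auto simp: Cl_def)
      have eq: "BV w * weight4 w + BU' w = (1 - A w) * (B\<Omega> w * exp (of_real \<rho> * w) * weight4 w)
          + A w * (B\<Omega> w * f w * weight4 w) - BA w * \<Omega> w * ((exp (of_real \<rho> * w) - f w) * weight4 w)"
        using True by (simp add: BV_def BU'_def BU_def algebra_simps)
      have 1: "cmod (A w * (B\<Omega> w * f w * weight4 w)) \<le> 16 / T ^ 5 * Cf' * indicator (cball 0 (2 * T)) w"
        using Cf w by (intro far An) (auto simp: Cf'_def)
      define y where "y = exp (\<rho>2 * Re w)"
      have y: "y > 0" by (simp add: y_def)
      have g8: "8 / (1 + cmod w) ^ 3 \<le> 8"
      proof -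
        have "0 < (1 + cmod w) ^ 3" by (intro zero_less_power add_pos_nonneg) auto
        then have "8 / (1 + cmod w) ^ 3 \<le> 8 / 1" by (intro divide_left_mono one_le_power) auto
        then show ?thesis by simp
      qed
      have 2: "cmod ((exp (of_real \<rho> * w) - f w) * weight4 w) \<le> \<epsilon> * y * (8 / (1 + cmod w) ^ 3)"
      proof -
        have "cmod ((exp (of_real \<rho> * w) - f w) * weight4 w) \<le> (\<epsilon> * y * cmod (w + 1)) * cmod (weight4 w)"
          unfolding norm_mult y_def using approx w by (intro mult_right_mono) auto
        also have "\<dots> = \<epsilon> * y * (cmod (w + 1) * cmod (weight4 w))" by simp
        also have "\<dots> \<le> \<epsilon> * y * (8 / (1 + cmod w) ^ 3)"
          using weight4_half_plane[OF w(1)] \<epsilon> y by (intro mult_left_mono) auto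
        finally show ?thesis .
      qed
      have 3: "cmod (B\<Theta> w * of_real (P w)) * y \<le> exp \<rho>2"
      proof (cases "Re w \<le> 1")
        case True
        have "cmod (B\<Theta> w * of_real (P w)) \<le> 1"
          using smoothstep_deriv_bounds[of "Re w"] P01[of w] mult_mono[of "smoothstep_deriv (Re w)" "3/2" "P w" 1]
          by (simp add: B\<Theta>_def norm_mult)
        moreover have "y \<le> exp \<rho>2" using True \<rho> mult_left_mono[of "Re w" 1 \<rho>2] by (simp add: y_def)
        ultimately show ?thesis using y mult_mono[of "cmod (B\<Theta> w * of_real (P w))" 1 y "exp \<rho>2"] by simp
      qed (simp add: B\<Theta>_def smoothstep_deriv_1)
      have 4: "cmod (of_real (\<Theta> w) * BP w) * y * 8 \<le> Wd w"
      proof -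
        have "cmod (of_real (\<Theta> w) * BP w) \<le> 1 * (\<Sum>d\<in>E. cmod (\<beta> d w))"
          unfolding norm_mult using \<Theta>01[of w] BP[of w] by (intro mult_mono) auto
        then have "cmod (of_real (\<Theta> w) * BP w) * (y * 8) \<le> (\<Sum>d\<in>E. cmod (\<beta> d w)) * (y * 8)"
          using y by (intro mult_right_mono) auto
        also have "\<dots> = (\<Sum>d\<in>E. cmod (\<beta> d w) * (y * 8))" by (simp add: sum_distrib_right)
        also have "\<dots> \<le> Wd w"
          unfolding Wd_def
        proof (rule sum_mono)
          fix d assume d: "d \<in> E"
          show "cmod (\<beta> d w) * (y * 8) \<le> 8 / snd d * exp (\<rho>2 * (cmod (fst d) + 2 * snd d)) * indicator
              (cball (fst d) (2 * snd d)) w"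
          proof (cases "cmod (w - fst d) \<ge> 2 * snd d")
            case True
            then have "cmod (\<beta> d w) * (y * 8) = 0" using \<beta>(3)[OF d] by simp
            moreover have "0 \<le> 8 / snd d * exp (\<rho>2 * (cmod (fst d) + 2 * snd d)) * indicator (cball (fst d)
                (2 * snd d)) w"
              using Rpos[OF d] by (intro mult_nonneg_nonneg) auto
            ultimately show ?thesis by linarith
          next
            case False
            have "Re w \<le> cmod (fst d) + 2 * snd d"
              using complex_Re_le_cmod[of w] norm_triangle_ineq[of "fst d" "w - fst d"] False by simp
            then have "\<rho>2 * Re w \<le> \<rho>2 * (cmod (fst d) + 2 * snd d)" using \<rho> by (intro mult_left_mono) auto
            then have "y \<le> exp (\<rho>2 * (cmod (fst d) + 2 * snd d))" by (simp add: y_def)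
            then have "cmod (\<beta> d w) * (y * 8) \<le> 1 / snd d * (exp (\<rho>2 * (cmod (fst d) + 2 * snd d)) * 8)"
              using \<beta>(2)[OF d, of w] y Rpos[OF d] by (intro mult_mono) auto
            then show ?thesis using False by (simp add: dist_norm norm_minus_commute mult.commute)
          qed
        qed
        finally show ?thesis by (simp add: mult.assoc)
      qed
      have "cmod (BA w * \<Omega> w * ((exp (of_real \<rho> * w) - f w) * weight4 w))
          \<le> cmod (BA w) * 1 * (\<epsilon> * y * (8 / (1 + cmod w) ^ 3))"
        unfolding norm_mult[of "BA w * \<Omega> w"] norm_mult[of "BA w" "\<Omega> w"]
        using 2 \<Omega>n[of w] by (intro mult_mono) auto
      also have "\<dots> \<le> (cmod (of_real (\<Theta> w) * BP w) + cmod (B\<Theta> w * of_real (P w))) * (\<epsilon> * y * (8 / (1 + cmod w) ^ 3))"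
        unfolding BA_def mult_1_right using \<epsilon> y by (intro mult_right_mono norm_triangle_ineq) auto
      also have "\<dots> = \<epsilon> * (cmod (of_real (\<Theta> w) * BP w) * y * (8 / (1 + cmod w) ^ 3)
          + cmod (B\<Theta> w * of_real (P w)) * y * (8 / (1 + cmod w) ^ 3))"
      proof -
        have "(a + b) * (\<epsilon> * y * h) = \<epsilon> * (a * y * h + b * y * h)" for a b h :: real
          by (simp add: algebra_simps)
        then show ?thesis .
      qed
      also have "\<dots> \<le> \<epsilon> * (cmod (of_real (\<Theta> w) * BP w) * y * 8 + exp \<rho>2 * (8 / (1 + cmod w) ^ 3))"
        using \<epsilon> y 3 g8 by (intro mult_left_mono add_mono mult_right_mono mult_nonneg_nonneg) auto
      also have "\<dots> \<le> \<epsilon> * (8 * exp \<rho>2 * (1 / (1 + cmod w) ^ 3) + Wd w)"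
      proof (rule mult_left_mono)
        have "exp \<rho>2 * (8 / (1 + cmod w) ^ 3) = 8 * exp \<rho>2 * (1 / (1 + cmod w) ^ 3)" by simp
        from add_mono[OF 4 eq_refl[OF this]]
        show "cmod (of_real (\<Theta> w) * BP w) * y * 8 + exp \<rho>2 * (8 / (1 + cmod w) ^ 3)
            \<le> 8 * exp \<rho>2 * (1 / (1 + cmod w) ^ 3) + Wd w" by (simp only: add.commute)
      qed (use \<epsilon> in simp)
      finally have 5: "cmod (BA w * \<Omega> w * ((exp (of_real \<rho> * w) - f w) * weight4 w))
          \<le> \<epsilon> * (8 * exp \<rho>2 * (1 / (1 + cmod w) ^ 3) + Wd w)" .
      have "cmod (BV w * weight4 w + BU' w) \<le> cmod ((1 - A w) * (B\<Omega> w * exp (of_real \<rho> * w) * weight4 w))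
          + cmod (A w * (B\<Omega> w * f w * weight4 w)) + cmod (BA w * \<Omega> w * ((exp (of_real \<rho> * w) - f w) * weight4 w))"
        unfolding eq by (rule order_trans[OF norm_triangle_ineq4 add_right_mono[OF norm_triangle_ineq]])
      also have "\<dots> \<le> W w"
      proof -
        have "p + k * (a + b) * i = (k * a * i + k * b * i) + p" for p k a b i :: real
          by (simp add: algebra_simps)
        then show ?thesis unfolding W_def C'_def using add_mono[OF add_mono[OF far1[of w] 1] 5] by (simp only:)
      qed
      finally show ?thesis .
    qed
    have iWd: "integrable lborel Wd"
      unfolding Wd_def by (intro Bochner_Integration.integrable_sum integral_indicator_cball) (use Rpos
          less_imp_le in force)
    have iW1: "integrable lborel (\<lambda>w::complex. 8 * exp \<rho>2 * (1 / (1 + cmod w) ^ 3))"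
      by (intro integrable_mult_right integrable_inverse_cube)
    have iW2: "integrable lborel (\<lambda>w::complex. C' * indicator (cball 0 (2 * T)) w)"
      by (rule integral_indicator_cball) (use T10 in simp)
    \<comment> \<open>Each disc contributes its height, with the factor \<open>8 / R\<close>, times
      an area of at most \<open>16 * R^2\<close>; hence the factor 128.\<close>
    have IWd: "integral\<^sup>L lborel Wd \<le> 128 * C0"
    proof -
      have "integral\<^sup>L lborel Wd = (\<Sum>d\<in>E. \<integral>w. (8 / snd d * exp (\<rho>2 * (cmod (fst d) + 2 * snd d)))
        * indicator (cball (fst d) (2 * snd d)) w \<partial>lborel)"
        unfolding Wd_def by (intro Bochner_Integration.integral_sum integral_indicator_cball) (use Rpos
            less_imp_le in force)
      also have "\<dots> \<le> (\<Sum>d\<in>E. (8 / snd d * exp (\<rho>2 * (cmod (fst d) + 2 * snd d))) * (4 * (2 * snd d)\<^sup>2))"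
        by (intro sum_mono integral_indicator_cball) (use Rpos less_imp_le in \<open>force+\<close>)
      also have "\<dots> = (\<Sum>d\<in>E. 128 * (snd d * exp (\<rho>2 * (cmod (fst d) + 2 * snd d))))"
        by (intro sum.cong refl) (use Rpos in \<open>force simp: power2_eq_square\<close>)
      also have "\<dots> = 128 * (\<Sum>(e, R)\<in>E. R * exp (\<rho>2 * (cmod e + 2 * R)))"
        by (simp add: sum_distrib_left case_prod_beta)
      finally show ?thesis using sum by simp
    qed
    have "c * \<kappa> = cmod (- of_real (c * \<kappa>) + 0)" using c \<kappa> by (simp add: norm_mult)
    also have "- of_real (c * \<kappa>) + 0 = (\<integral>w. BV w * weight4 w + BU' w \<partial>lborel)"
      using iV IV iU IU by simp
    also have "cmod \<dots> \<le> integral\<^sup>L lborel W"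
      by (rule Bochner_Integration.integral_norm_bound_integral)
        (use iV iU bound iWd iW1 iW2 in \<open>auto simp: W_def[abs_def] simp del: times_divide_eq_right mult_1_right\<close>)
    also have "\<dots> = \<epsilon> * (8 * exp \<rho>2 * J + integral\<^sup>L lborel Wd) + (\<integral>w. C' * indicator (cball 0 (2 * T))
        (w::complex) \<partial>lborel)"
    proof -
      have "integral\<^sup>L lborel W = (\<integral>w. \<epsilon> * (8 * exp \<rho>2 * (1 / (1 + cmod w) ^ 3) + Wd w) \<partial>lborel)
          + (\<integral>w. C' * indicator (cball 0 (2 * T)) (w::complex) \<partial>lborel)"
        unfolding W_def by (intro Bochner_Integration.integral_add integrable_mult_right
            Bochner_Integration.integrable_add iWd iW1 iW2)
      also have "(\<integral>w. \<epsilon> * (8 * exp \<rho>2 * (1 / (1 + cmod w) ^ 3) + Wd w) \<partial>lborel)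
          = \<epsilon> * ((\<integral>w. 8 * exp \<rho>2 * (1 / (1 + cmod w) ^ 3) \<partial>lborel) + integral\<^sup>L lborel Wd)"
        unfolding integral_mult_right_zero[of _ \<epsilon>] Bochner_Integration.integral_add[OF iW1 iWd] ..
      also have "(\<integral>w. 8 * exp \<rho>2 * (1 / (1 + cmod w) ^ 3) \<partial>lborel) = 8 * exp \<rho>2 * J"
        unfolding J_def by (rule integral_mult_right_zero)
      finally show ?thesis .
    qed
    also have "\<dots> \<le> \<epsilon> * Q + c * \<kappa> / 4"
    proof (rule add_mono)
      show "\<epsilon> * (8 * exp \<rho>2 * J + integral\<^sup>L lborel Wd) \<le> \<epsilon> * Q"
        using \<epsilon> IWd by (intro mult_left_mono) (auto simp: Q_def)
      have "(\<integral>w. C' * indicator (cball 0 (2 * T)) (w::complex) \<partial>lborel) \<le> C' * (4 * (2 * T)\<^sup>2)"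
        by (rule integral_indicator_cball) (use T10 C' in auto)
      also have "\<dots> = 256 * (exp \<rho> + Cf') / T ^ 3"
        using T10 by (simp add: C'_def field_simps power2_eq_square power3_eq_cube eval_nat_numeral)
      finally show "(\<integral>w. C' * indicator (cball 0 (2 * T)) (w::complex) \<partial>lborel) \<le> c * \<kappa> / 4" using TC by linarith
    qed
    also have "\<epsilon> * Q = c * \<kappa> / 2" using Q by (simp add: \<epsilon>_def)
    finally show False using c \<kappa> by (simp add: mult_pos_pos)
  qed
qed

section \<open>The ideals generated by singular functions\<close>

lemma in_R_exp:
  assumes K: "compact K" and f: "in_R K f"
  shows "in_R K (\<lambda>z. exp (f z))"
proof (rule in_R_limit)
  fix e :: real assume e: "e > 0"
  obtain M where M: "M > 0" "\<And>z. z \<in> K \<Longrightarrow> cmod (f z) \<le> M" using in_R_bounded[OF K f] by blast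
  have "uniform_limit (cball 0 M) (\<lambda>n x. \<Sum>i<n. inverse (fact i) * x ^ i :: complex) (\<lambda>x. \<Sum>i. inverse (fact
      i) * x ^ i) sequentially"
  proof (rule Weierstrass_m_test)
    show "norm (inverse (fact i) * x ^ i) \<le> inverse (fact i) * M ^ i" if "x \<in> cball 0 M" for i and x :: complex
      using that by (simp add: norm_mult norm_power norm_inverse mult_left_mono power_mono)
    show "summable (\<lambda>i. inverse (fact i) * M ^ i)" by (rule summable_exp)
  qed
  then have "\<forall>\<^sub>F n in sequentially. \<forall>x\<in>cball (0::complex) M. dist (\<Sum>i<n. inverse (fact i) * x ^ i) (\<Sum>i.
      inverse (fact i) * x ^ i) < e"
    using e by (rule uniform_limitD)
  then obtain n where n: "\<And>x. x \<in> cball (0::complex) M \<Longrightarrow> dist (\<Sum>i<n. inverse (fact i) * x ^ i) (\<Sum>i. inverse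
      (fact i) * x ^ i) < e"
    unfolding eventually_sequentially by blast
  have "in_R K (\<lambda>z. \<Sum>i<n. inverse (fact i) * f z ^ i)"
    by (intro in_R_sum in_R_mult in_R_const in_R_power K f)
  moreover have "cmod (exp (f z) - (\<Sum>i<n. inverse (fact i) * f z ^ i)) < e" if "z \<in> K" for z
  proof -
    have "exp (f z) = (\<Sum>i. inverse (fact i) * f z ^ i)" by (simp add: exp_def scaleR_conv_of_real)
    then show ?thesis using n[of "f z"] M(2)[OF that] by (simp add: dist_norm norm_minus_commute)
  qed
  ultimately show "\<exists>g. in_R K g \<and> (\<forall>z\<in>K. cmod (exp (f z) - g z) < e)" by blast
qed

lemma norm_exp_diff_left_half_plane:
  assumes "Re a \<le> 0" "Re b \<le> 0"
  shows "cmod (exp a - exp b) \<le> cmod (a - b)"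
proof -
  have "cmod (exp a - exp b) \<le> 1 * cmod (a - b)"
    by (rule field_differentiable_bound[where S = "{z. Re z \<le> 0}" and f' = exp])
      (use assms convex_halfspace_Re_le in \<open>auto intro: DERIV_exp has_field_derivative_at_within\<close>)
  then show ?thesis by simp
qed

lemma exp_real_mult_left_half_plane:
  assumes "\<sigma> \<ge> 0" "Re a \<le> 0"
  shows "Re (of_real \<sigma> * a) \<le> 0" "cmod (exp (of_real \<sigma> * a)) \<le> 1"
  using assms by (simp_all add: mult_nonneg_nonpos)

text \<open>The shift by \<open>\<delta>\<close> moves the pole from 1 to
  \<open>1 + \<delta>\<close>, off the closed disc, so that exponentials of this function belong to
  \<open>R(K)\<close>. The values stay in the left half plane, so that they remain bounded by
  1.\<close>

lemma Re_moebius_le_0: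
  assumes z: "cmod z \<le> 1" and d: "\<delta> \<ge> 0"
  shows "Re ((z + 1) / (z - 1 - of_real \<delta>)) \<le> 0"
proof -
  have "Re z \<ge> -1" using z abs_Re_le_cmod[of z] by linarith
  then have a: "\<delta> * (1 + Re z) \<ge> 0" using d by simp
  have "(cmod z)\<^sup>2 \<le> 1" using z by (simp add: power_le_one)
  then have b: "(Re z)\<^sup>2 + (Im z)\<^sup>2 \<le> 1" by (simp add: cmod_power2)
  have "Re ((z + 1) * cnj (z - 1 - of_real \<delta>)) = (Re z)\<^sup>2 + (Im z)\<^sup>2 - 1 - \<delta> * (1 + Re z)"
    by (simp add: power2_eq_square algebra_simps)
  also have "\<dots> \<le> 0" using a b by linarith
  finally have "Re ((z + 1) * cnj (z - 1 - of_real \<delta>)) \<le> 0" .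
  then show ?thesis
    by (subst complex_div_cnj) (simp add: divide_nonpos_nonneg Re_divide_of_real[of _ "x\<^sup>2" for x, unfolded
        of_real_power])
qed

lemma moebius_shift:
  assumes z: "cmod z \<le> 1" and t: "t > 0" "cmod (z - 1) \<ge> t" and d: "\<delta> \<ge> 0"
  shows "cmod (z - 1 - of_real \<delta>) \<ge> cmod (z - 1)"
    "cmod ((z + 1) / (z - 1) - (z + 1) / (z - 1 - of_real \<delta>)) \<le> 2 * \<delta> / t\<^sup>2"
proof -
  have "Re z \<le> 1" using z abs_Re_le_cmod[of z] by linarith
  then have "\<bar>Re z - 1\<bar> \<le> \<bar>Re z - 1 - \<delta>\<bar>" using d by linarith
  then have "(Re z - 1)\<^sup>2 \<le> (Re z - 1 - \<delta>)\<^sup>2" by (simp only: abs_le_square_iff)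
  then have "(cmod (z - 1))\<^sup>2 \<le> (cmod (z - 1 - of_real \<delta>))\<^sup>2"
    by (simp add: cmod_power2)
  then show 1: "cmod (z - 1 - of_real \<delta>) \<ge> cmod (z - 1)" by (rule power2_le_imp_le) simp
  have nz: "z - 1 \<noteq> 0" "z - 1 - of_real \<delta> \<noteq> 0" using t 1 by auto
  have "(z + 1) / (z - 1) - (z + 1) / (z - 1 - of_real \<delta>) = - ((z + 1) * of_real \<delta>) / ((z - 1) * (z - 1 - of_real \<delta>))"
    using nz by (simp add: divide_simps) (simp add: algebra_simps)
  then have "cmod ((z + 1) / (z - 1) - (z + 1) / (z - 1 - of_real \<delta>))
      = cmod (z + 1) * \<delta> / (cmod (z - 1) * cmod (z - 1 - of_real \<delta>))"
    using d by (simp add: norm_divide norm_mult)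
  also have "\<dots> \<le> 2 * \<delta> / (t * t)"
  proof (rule frac_le)
    have "cmod (z + 1) \<le> 2" using norm_triangle_ineq[of z 1] z by simp
    then show "cmod (z + 1) * \<delta> \<le> 2 * \<delta>" using d by (intro mult_right_mono) auto
    show "t * t \<le> cmod (z - 1) * cmod (z - 1 - of_real \<delta>)" using t 1 by (intro mult_mono) auto
  qed (use t d in auto)
  finally show "cmod ((z + 1) / (z - 1) - (z + 1) / (z - 1 - of_real \<delta>)) \<le> 2 * \<delta> / t\<^sup>2"
    by (simp add: power2_eq_square)
qed

lemma in_R_shifted_exp:
  assumes K: "compact K" "K \<subseteq> cball 0 1" and \<delta>: "\<delta> > 0"
  shows "in_R K (\<lambda>z. 1 / (z - 1 - of_real \<delta>))"
    "in_R K (\<lambda>z. exp (of_real \<sigma> * ((z + 1) / (z - 1 - of_real \<delta>))))"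
proof -
  have "cmod (1 + complex_of_real \<delta>) = 1 + \<delta>"
    using \<delta> by (metis abs_of_pos add_pos_pos norm_of_real of_real_1 of_real_add zero_less_one)
  then have "1 + complex_of_real \<delta> \<notin> K" using K(2) \<delta> by auto
  then have "in_R K (\<lambda>z. 1 / (z - (1 + of_real \<delta>)))" by (rule in_R_pole[OF K(1)])
  then show 1: "in_R K (\<lambda>z. 1 / (z - 1 - of_real \<delta>))" by (simp add: diff_diff_eq)
  have "in_R K (\<lambda>z. of_real \<sigma> * ((z + 1) * (1 / (z - 1 - of_real \<delta>))))"
    by (intro in_R_mult in_R_const in_R_add in_R_id 1 K(1))
  then show "in_R K (\<lambda>z. exp (of_real \<sigma> * ((z + 1) / (z - 1 - of_real \<delta>))))"
    by (intro in_R_exp K(1)) simp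
qed

lemma I_gen_norm_le:
  assumes "z \<in> K" "K \<subseteq> cball 0 1" "\<rho> \<ge> 0"
  shows "cmod (I_gen K \<rho> z) \<le> cmod (z - 1)"
proof (cases "z = 1")
  case False
  have "Re ((z + 1) / (z - 1)) \<le> 0" using Re_moebius_le_0[of z 0] assms by auto
  then have "cmod (exp (complex_of_real \<rho> * ((z + 1) / (z - 1)))) \<le> 1"
    by (rule exp_real_mult_left_half_plane[OF assms(3)])
  then show ?thesis using assms(1) False
    by (simp add: I_gen_def norm_mult mult_left_le)
qed (use assms in \<open>simp add: I_gen_def\<close>)

text \<open>The quotient of the two generators is bounded by 1 but has an essential singularity at
  1. Its pole is shifted outwards: away from 1 this changes little, and near 1 the factor
  \<open>z - 1\<close> of the generator makes any bounded error small.\<close>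

lemma I_gen_approx:
  assumes K: "compact K" "K \<subseteq> cball 0 1" and \<rho>: "0 \<le> \<rho>1" "\<rho>1 \<le> \<rho>2" and e: "e > 0"
  shows "\<exists>h. in_R K h \<and> (\<forall>z\<in>K. cmod (I_gen K \<rho>2 z - I_gen K \<rho>1 z * h z) < e)"
proof -
  define \<sigma> where "\<sigma> = \<rho>2 - \<rho>1"
  have \<sigma>: "\<sigma> \<ge> 0" using \<rho> by (simp add: \<sigma>_def)
  \<comment> \<open>Within \<open>t\<close> of 1 the error is at most \<open>2 * t < e\<close>.
    Elsewhere \<open>\<delta>\<close> makes the exponentials differ by at most \<open>e / 4\<close>,
    and \<open>cmod (z - 1) \<le> 2\<close>.\<close>
  define t where "t = e / 3"
  define \<delta> where "\<delta> = e * t\<^sup>2 / (8 * (\<sigma> + 1))"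
  have t: "t > 0" and \<delta>: "\<delta> > 0" using e \<sigma> by (auto simp: t_def \<delta>_def)
  define h where "h z = exp (of_real \<sigma> * ((z + 1) / (z - 1 - of_real \<delta>)))" for z :: complex
  have "in_R K h" unfolding h_def by (rule in_R_shifted_exp[OF K \<delta>])
  moreover have "cmod (I_gen K \<rho>2 z - I_gen K \<rho>1 z * h z) < e" if z: "z \<in> K" for z
  proof (cases "z = 1")
    case True
    then show ?thesis using z e by (simp add: I_gen_def)
  next
    case False
    have z1: "cmod z \<le> 1" using z K by auto
    have h: "cmod (h z) \<le> 1"
      unfolding h_def by (rule exp_real_mult_left_half_plane[OF \<sigma> Re_moebius_le_0[OF z1]]) (use \<delta> in simp)
    define m where "m = exp (of_real \<sigma> * ((z + 1) / (z - 1)))"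
    have re: "Re ((z + 1) / (z - 1)) \<le> 0" using Re_moebius_le_0[OF z1, of 0] by simp
    have m: "cmod m \<le> 1" unfolding m_def by (rule exp_real_mult_left_half_plane[OF \<sigma> re])
    have "exp (of_real \<rho>1 * ((z + 1) / (z - 1))) * m = exp (of_real \<rho>2 * ((z + 1) / (z - 1)))"
      unfolding m_def exp_add[symmetric] distrib_right[symmetric] by (simp only: \<sigma>_def of_real_diff
          add_diff_cancel_left' add_diff_eq)
    then have "I_gen K \<rho>2 z = I_gen K \<rho>1 z * m"
      using z False by (simp add: I_gen_def mult.assoc)
    then have "I_gen K \<rho>2 z - I_gen K \<rho>1 z * h z = I_gen K \<rho>1 z * (m - h z)" by (simp add: algebra_simps)
    then have le: "cmod (I_gen K \<rho>2 z - I_gen K \<rho>1 z * h z) \<le> cmod (z - 1) * cmod (m - h z)"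
      using I_gen_norm_le[OF z K(2) \<rho>(1)] by (simp add: norm_mult mult_right_mono)
    show ?thesis
    proof (cases "cmod (z - 1) < t")
      case True
      have "cmod (m - h z) \<le> 2" using norm_triangle_ineq4[of m "h z"] m h by linarith
      then have "cmod (z - 1) * cmod (m - h z) \<le> t * 2" using True t by (intro mult_mono) auto
      then show ?thesis using le e by (simp add: t_def)
    next
      case False
      have "cmod (m - h z) \<le> cmod (of_real \<sigma> * ((z + 1) / (z - 1)) - of_real \<sigma> * ((z + 1) / (z - 1 - of_real \<delta>)))"
        unfolding m_def h_def
        by (intro norm_exp_diff_left_half_plane exp_real_mult_left_half_plane \<sigma> re Re_moebius_le_0 z1)
          (use \<delta> in simp)
      also have "\<dots> = \<sigma> * cmod ((z + 1) / (z - 1) - (z + 1) / (z - 1 - of_real \<delta>))"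
        using \<sigma> by (simp only: right_diff_distrib[symmetric] norm_mult norm_of_real abs_of_nonneg)
      also have "\<dots> \<le> \<sigma> * (2 * \<delta> / t\<^sup>2)"
        using moebius_shift(2)[OF z1 t, of \<delta>] False \<delta> \<sigma> by (intro mult_left_mono) auto
      also have "\<dots> = e * (\<sigma> / (4 * (\<sigma> + 1)))" 
      proof -
        have "2 * \<delta> / t\<^sup>2 = 2 * (e / (8 * (\<sigma> + 1)))" using t by (simp add: \<delta>_def)
        also have "\<dots> = e * (1 / (4 * (\<sigma> + 1)))" using \<sigma> by (simp add: divide_simps)
        finally show ?thesis by simp
      qed
      also have "\<dots> \<le> e * (1 / 4)" using e \<sigma> by (intro mult_left_mono) (auto simp: divide_simps)
      finally have "cmod (m - h z) \<le> e / 4" by simp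
      moreover have "cmod (z - 1) \<le> 2" using norm_triangle_ineq4[of z 1] z1 by simp
      ultimately have "cmod (z - 1) * cmod (m - h z) \<le> 2 * (e / 4)" by (intro mult_mono) auto
      then show ?thesis using le e by simp
    qed
  qed
  ultimately show ?thesis by blast
qed

text \<open>\<open>I_gen K 0\<close> is the polynomial \<open>z - 1\<close>, and
  \<open>I_gen_approx\<close> with \<open>\<rho>1 = 0\<close> approximates the other generators by
  its multiples.\<close>

lemma in_R_I_gen:
  assumes K: "compact K" "K \<subseteq> cball 0 1" and \<rho>: "0 \<le> \<rho>"
  shows "in_R K (I_gen K \<rho>)"
proof (rule in_R_limit)
  fix e :: real assume e: "e > 0"
  obtain h where h: "in_R K h" "\<forall>z\<in>K. cmod (I_gen K \<rho> z - I_gen K 0 z * h z) < e"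
    using I_gen_approx[OF K order_refl \<rho> e] by blast
  have "in_R K (\<lambda>z. z - 1)" by (intro in_R_diff in_R_id in_R_const K)
  then have "in_R K (I_gen K 0)" by (rule in_R_cong) (simp add: I_gen_def)
  then show "\<exists>g. in_R K g \<and> (\<forall>z\<in>K. cmod (I_gen K \<rho> z - g z) < e)"
    using h in_R_mult[OF K(1)] by blast
qed

section \<open>Closed ideals and the ideals of the generators\<close>

lemma closed_ideal_limit:
  assumes I: "closed_ideal K (R_alg K) I" and f: "in_R K f"
    and ap: "\<And>e. e > 0 \<Longrightarrow> \<exists>g. restrict g K \<in> I \<and> (\<forall>z\<in>K. cmod (f z - g z) < e)"
  shows "restrict f K \<in> I"
proof -
  have "I \<subseteq> cont_funs K" using I R_alg_cont_funs by (auto simp: closed_ideal_def)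
  then have "restrict f K \<in> uniform_closure K I"
  proof (rule uniform_closureI[rotated])
    fix e :: real assume "e > 0"
    then obtain g where "restrict g K \<in> I" "\<forall>z\<in>K. cmod (f z - g z) < e" using ap by blast
    then show "\<exists>g\<in>I. \<forall>x\<in>K. cmod (restrict f K x - g x) < e" by (intro bexI[of _ "restrict g K"]) auto
  qed auto
  then show ?thesis using I by (simp add: closed_ideal_def)
qed

lemma closed_ideal_mult:
  assumes I: "closed_ideal K (R_alg K) I" and f: "in_R K f" and g: "g \<in> I"
  shows "restrict (\<lambda>z. g z * f z) K \<in> I"
proof -
  have "(\<lambda>x\<in>K. restrict f K x * g x) \<in> I" using I f g unfolding closed_ideal_def in_R_def by blast
  moreover have "(\<lambda>x\<in>K. restrict f K x * g x) = restrict (\<lambda>z. g z * f z) K" by (auto simp: mult.commute)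
  ultimately show ?thesis by simp
qed

lemma restrict_I_gen: "restrict (I_gen K \<rho>) K = I_gen K \<rho>"
  by (auto simp: I_gen_def)

lemma I_ideal_antimono:
  assumes K: "compact K" "K \<subseteq> cball 0 1" and \<rho>: "0 \<le> \<rho>1" "\<rho>1 \<le> \<rho>2"
  shows "I_ideal K \<rho>2 \<subseteq> I_ideal K \<rho>1"
proof -
  have "I_gen K \<rho>2 \<in> I" if I: "closed_ideal K (R_alg K) I" "I_gen K \<rho>1 \<in> I" for I
  proof -
    have "restrict (I_gen K \<rho>2) K \<in> I"
    proof (rule closed_ideal_limit[OF I(1) in_R_I_gen[OF K]])
      fix e :: real assume "e > 0"
      then obtain h where "in_R K h" "\<forall>z\<in>K. cmod (I_gen K \<rho>2 z - I_gen K \<rho>1 z * h z) < e"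
        using I_gen_approx[OF K \<rho>] by blast
      then show "\<exists>g. restrict g K \<in> I \<and> (\<forall>z\<in>K. cmod (I_gen K \<rho>2 z - g z) < e)"
        using closed_ideal_mult[OF I(1) _ I(2)] by blast
    qed (use \<rho> in auto)
    then show ?thesis by (simp add: restrict_I_gen)
  qed
  then show ?thesis unfolding I_ideal_def hull_def by blast
qed

text \<open>Formally \<open>f\<close> is the generator times \<open>f / I_gen K \<rho>\<close>. The
  reciprocal of the generator is not in \<open>R(K)\<close>, but with the pole shifted to
  \<open>1 + \<delta>\<close> it is; its size near 1 does no harm, because \<open>f\<close> vanishes
  there.\<close>

lemma ideal_J_subset_I_ideal:
  assumes K: "compact K" "K \<subseteq> cball 0 1" and \<rho>: "0 \<le> \<rho>"
  shows "ideal_J K (R_alg K) 1 \<subseteq> I_ideal K \<rho>"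
proof
  fix f assume f: "f \<in> ideal_J K (R_alg K) 1"
  then have fR: "f \<in> R_alg K" by (simp add: ideal_J_def)
  obtain U where U: "openin (top_of_set K) U" "1 \<in> U" "\<forall>y\<in>U. f y = 0"
    using f by (auto simp: ideal_J_def)
  obtain t where t: "t > 0" "\<And>y. y \<in> K \<Longrightarrow> dist y 1 < t \<Longrightarrow> y \<in> U"
    using U(1,2) unfolding openin_euclidean_subtopology_iff by blast
  obtain M where M: "M > 0" "\<And>z. z \<in> K \<Longrightarrow> cmod (f z) \<le> M"
    using in_R_bounded[OF K(1) R_alg_in_R[OF fR]] by blast
  have "f \<in> I" if I: "closed_ideal K (R_alg K) I" "I_gen K \<rho> \<in> I" for I
  proof -
    have "restrict f K \<in> I"
    proof (rule closed_ideal_limit[OF I(1) R_alg_in_R[OF fR]])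
      fix e :: real assume e: "e > 0"
      \<comment> \<open>\<open>A * \<delta>\<close> bounds the relative error:
        \<open>\<delta> / t\<close> from the factor \<open>z - 1\<close>, and
        \<open>3 * \<rho> * (2 * \<delta> / t^2)\<close> from the exponential. The second bound in
        \<open>\<delta>\<close> makes the exponent at most 1, as \<open>norm_exp_diff_1\<close>
        requires.\<close>
      define A where "A = 1 / t + 6 * \<rho> / t\<^sup>2"
      have A: "A > 0" using t \<rho> by (simp add: A_def add_pos_nonneg)
      define \<delta> where "\<delta> = min (e / (2 * M * A)) (1 / A)"
      have \<delta>: "\<delta> > 0" using e M A by (simp add: \<delta>_def)
      have "\<delta> \<le> e / (2 * M * A)" "\<delta> \<le> 1 / A" by (simp_all add: \<delta>_def)
      then have \<delta>A: "M * (A * \<delta>) \<le> e / 2" "A * \<delta> \<le> 1" using M A by (simp_all add: field_simps)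
      define k where "k z = f z * (1 / (z - 1 - of_real \<delta>) * exp (of_real (- \<rho>) * ((z + 1) / (z - 1 -
          of_real \<delta>))))" for z
      have "in_R K k" unfolding k_def
        by (intro in_R_mult in_R_shifted_exp[OF K \<delta>] R_alg_in_R[OF fR] K)
      then have "restrict (\<lambda>z. I_gen K \<rho> z * k z) K \<in> I" by (rule closed_ideal_mult[OF I(1) _ I(2)])
      moreover have "cmod (f z - I_gen K \<rho> z * k z) < e" if z: "z \<in> K" for z
      proof (cases "cmod (z - 1) < t")
        case True
        then have "f z = 0" using t(2)[OF z] U(3) by (simp add: dist_norm)
        then show ?thesis using e by (simp add: k_def)
      next
        case False
        then have z1: "z \<noteq> 1" "t \<le> cmod (z - 1)" "cmod z \<le> 1" using t z K by auto
        note ms = moebius_shift[OF z1(3) t(1) z1(2) less_imp_le[OF \<delta>]]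
        define X where "X = (z - 1) / (z - 1 - of_real \<delta>)"
        define u where "u = of_real \<rho> * ((z + 1) / (z - 1) - (z + 1) / (z - 1 - of_real \<delta>))"
        have nz: "z - 1 - of_real \<delta> \<noteq> 0" using ms(1) z1 t by auto
        have X1: "cmod X \<le> 1" unfolding X_def norm_divide using ms(1) nz by (simp add: divide_le_eq)
        have X2: "cmod (1 - X) \<le> \<delta> / t"
        proof -
          have "1 - X = - of_real \<delta> / (z - 1 - of_real \<delta>)" using nz by (simp add: X_def field_simps)
          then have "cmod (1 - X) = \<delta> / cmod (z - 1 - of_real \<delta>)" using \<delta> by (simp add: norm_divide)
          also have "\<dots> \<le> \<delta> / t" using ms(1) z1 t \<delta> nz by (intro divide_left_mono mult_pos_pos) auto
          finally show ?thesis .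
        qed
        have u: "cmod u \<le> \<rho> * (2 * \<delta> / t\<^sup>2)"
          unfolding u_def norm_mult norm_of_real abs_of_nonneg[OF \<rho>] by (rule mult_left_mono[OF ms(2) \<rho>])
        have "3 * (\<rho> * (2 * \<delta> / t\<^sup>2)) + \<delta> / t = A * \<delta>" by (simp add: A_def algebra_simps)
        then have u3: "3 * cmod u + cmod (1 - X) \<le> A * \<delta>" using u X2 by linarith
        then have "cmod u \<le> 1" using \<delta>A(2) norm_ge_zero[of "1 - X"] norm_ge_zero[of u] by linarith
        then have Y: "cmod (exp u - 1) \<le> 3 * cmod u" by (rule norm_exp_diff_1)
        have "I_gen K \<rho> z * k z = f z * (X * (exp (of_real \<rho> * ((z + 1) / (z - 1))) * exp (of_real (- \<rho>) *
            ((z + 1) / (z - 1 - of_real \<delta>)))))"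
          using z z1 by (simp add: I_gen_def k_def X_def)
        also have "exp (of_real \<rho> * ((z + 1) / (z - 1))) * exp (of_real (- \<rho>) * ((z + 1) / (z - 1 - of_real
            \<delta>))) = exp u"
        proof -
          have "of_real \<rho> * x + of_real (- \<rho>) * y = of_real \<rho> * (x - y)" for x y :: complex
            by (simp add: algebra_simps)
          then show ?thesis unfolding exp_add[symmetric] u_def by (simp only:)
        qed
        finally have "f z - I_gen K \<rho> z * k z = f z * ((1 - X) - X * (exp u - 1))"
          by (simp add: algebra_simps)
        then have "cmod (f z - I_gen K \<rho> z * k z) = cmod (f z) * cmod ((1 - X) - X * (exp u - 1))"
          by (simp add: norm_mult)
        also have "\<dots> \<le> M * (A * \<delta>)"
        proof (rule mult_mono)
          have "cmod (X * (exp u - 1)) \<le> 1 * (3 * cmod u)"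
            unfolding norm_mult using X1 Y by (intro mult_mono) auto
          then show "cmod ((1 - X) - X * (exp u - 1)) \<le> A * \<delta>"
            using norm_triangle_ineq4[of "1 - X" "X * (exp u - 1)"] u3 by linarith
        qed (use M z in auto)
        also have "\<dots> < e" using \<delta>A e by linarith
        finally show ?thesis .
      qed
      ultimately show "\<exists>g. restrict g K \<in> I \<and> (\<forall>z\<in>K. cmod (f z - g z) < e)" by blast
    qed
    then show ?thesis using R_alg_extensional[OF fR] by (simp add: extensional_restrict)
  qed
  then show "f \<in> I_ideal K \<rho>" unfolding I_ideal_def hull_def by blast
qed

lemma I_ideal_closed:
  assumes K: "compact K" "K \<subseteq> cball 0 1" and \<rho>: "0 \<le> \<rho>"
  shows "uniform_closure K (I_ideal K \<rho>) \<subseteq> I_ideal K \<rho>"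
proof
  fix f assume f: "f \<in> uniform_closure K (I_ideal K \<rho>)"
  have "f \<in> I" if I: "closed_ideal K (R_alg K) I" "I_gen K \<rho> \<in> I" for I
  proof -
    have "I_ideal K \<rho> \<subseteq> I" using I unfolding I_ideal_def hull_def by blast
    then have "f \<in> uniform_closure K I" using f uniform_closure_mono by blast
    then show ?thesis using I by (simp add: closed_ideal_def)
  qed
  then show "f \<in> I_ideal K \<rho>" unfolding I_ideal_def hull_def by blast
qed

text \<open>The ideal is an intersection of closed ideals, and the closure of the set
  \<open>B\<close> of multiples of the generator is one of them.\<close>

lemma I_ideal_approx:
  assumes K: "compact K" "K \<subseteq> cball 0 1" and \<rho>: "0 \<le> \<rho>" and f: "f \<in> I_ideal K \<rho>" and e: "e > 0"
  shows "\<exists>h. in_R K h \<and> (\<forall>z\<in>K. cmod (f z - h z * I_gen K \<rho> z) < e)"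
proof -
  define B where "B = {restrict (\<lambda>z. h z * I_gen K \<rho> z) K | h. in_R K h}"
  note g = in_R_I_gen[OF K \<rho>]
  have BR: "B \<subseteq> R_alg K" using in_R_mult[OF K(1) _ g] by (auto simp: B_def in_R_def)
  have Bc: "B \<subseteq> cont_funs K" using BR R_alg_cont_funs by blast
  have BI: "restrict F K \<in> B" if "in_R K h" "\<And>z. z \<in> K \<Longrightarrow> F z = h z * I_gen K \<rho> z" for F h
  proof -
    have "restrict F K = restrict (\<lambda>z. h z * I_gen K \<rho> z) K" using that(2) by (rule restrict_ext)
    then show ?thesis using that(1) unfolding B_def by blast
  qed
  have add: "(\<lambda>x\<in>K. u x + v x) \<in> B" and mult: "(\<lambda>x\<in>K. u x * v x) \<in> B" if uv: "u \<in> B" "v \<in> B" for u v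
  proof -
    obtain h h' where h: "in_R K h" "u = restrict (\<lambda>z. h z * I_gen K \<rho> z) K"
        "in_R K h'" "v = restrict (\<lambda>z. h' z * I_gen K \<rho> z) K" using uv by (auto simp: B_def)
    show "(\<lambda>x\<in>K. u x + v x) \<in> B"
      by (rule BI[OF in_R_add[OF K(1) h(1) h(3)]]) (simp add: h algebra_simps)
    show "(\<lambda>x\<in>K. u x * v x) \<in> B"
      by (rule BI[OF in_R_mult[OF K(1) in_R_mult[OF K(1) h(1) g] h(3)]]) (simp add: h)
  qed
  have "closed_ideal K (R_alg K) (uniform_closure K B)"
    unfolding closed_ideal_def
  proof (intro conjI ballI)
    show "uniform_closure K B \<subseteq> R_alg K"
      using uniform_closure_mono[OF BR, of K] by (simp add: R_alg_def uniform_closure_idem)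
    have "(\<lambda>x\<in>K. 0) \<in> B" by (rule BI[OF in_R_const[OF K(1), of 0]]) simp
    then show "(\<lambda>x\<in>K. 0) \<in> uniform_closure K B" using uniform_closure_subset[OF Bc] by blast
    show "(\<lambda>x\<in>K. u x + v x) \<in> uniform_closure K B" if "u \<in> uniform_closure K B" "v \<in> uniform_closure K B" for u v
      using uniform_closure_combine(1)[OF that K(1) Bc add mult] by blast
    show "(\<lambda>x\<in>K. a x * v x) \<in> uniform_closure K B" if a: "a \<in> R_alg K" and v: "v \<in> uniform_closure K B" for a v
    proof (rule uniform_closureI[OF _ Bc])
      fix \<epsilon> :: real assume \<epsilon>: "\<epsilon> > 0"
      obtain M where M: "M > 0" "\<forall>z\<in>K. cmod (a z) \<le> M" using in_R_bounded[OF K(1) R_alg_in_R[OF a]] by blast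
      obtain b where b: "b \<in> B" "\<forall>x\<in>K. cmod (v x - b x) < \<epsilon> / M"
        using uniform_closureD[OF v, of "\<epsilon> / M"] \<epsilon> M by auto
      obtain h where h: "in_R K h" "b = restrict (\<lambda>z. h z * I_gen K \<rho> z) K" using b(1) by (auto simp: B_def)
      have "(\<lambda>x\<in>K. a x * b x) \<in> B"
        by (rule BI[OF in_R_mult[OF K(1) R_alg_in_R[OF a] h(1)]]) (simp add: h)
      moreover have "cmod ((\<lambda>x\<in>K. a x * v x) x - (\<lambda>x\<in>K. a x * b x) x) < \<epsilon>" if x: "x \<in> K" for x
      proof -
        have "cmod (a x * v x - a x * b x) = cmod (a x) * cmod (v x - b x)"
          by (simp add: right_diff_distrib[symmetric] norm_mult)
        also have "\<dots> \<le> M * cmod (v x - b x)" using M x by (intro mult_right_mono) auto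
        also have "\<dots> < M * (\<epsilon> / M)" using b(2) x M by (intro mult_strict_left_mono) auto
        finally show ?thesis using x M by simp
      qed
      ultimately show "\<exists>g\<in>B. \<forall>x\<in>K. cmod ((\<lambda>x\<in>K. a x * v x) x - g x) < \<epsilon>" by blast
    qed auto
    show "uniform_closure K (uniform_closure K B) = uniform_closure K B" by (rule uniform_closure_idem)
  qed
  moreover have "I_gen K \<rho> \<in> uniform_closure K B"
    using BI[OF in_R_const[OF K(1), of 1], of "I_gen K \<rho>"] uniform_closure_subset[OF Bc]
    by (auto simp: restrict_I_gen)
  ultimately have "f \<in> uniform_closure K B" using f unfolding I_ideal_def hull_def by blast
  then obtain b where b: "b \<in> B" "\<forall>x\<in>K. cmod (f x - b x) < e" using uniform_closureD e by blast
  obtain h where h: "in_R K h" "b = restrict (\<lambda>z. h z * I_gen K \<rho> z) K" using b(1) by (auto simp: B_def)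
  show ?thesis using h b(2) by (intro exI[of _ h]) auto
qed

text \<open>In the coordinate \<open>w = (1 + z) / (1 - z)\<close> the closed disc minus \<open>1\<close> becomes the closed right
  half plane, \<open>I_gen K \<rho>\<close> becomes \<open>- 2 / (w + 1) * exp (- \<rho> * w)\<close>, and the removed disc
  \<open>ball c s\<close> lies in a disc of radius \<open>2 s / (cmod (1 - c) - s)\<^sup>2\<close>.\<close>

lemma I_gen_not_approximable:
  assumes D: "\<And>c s. (c, s) \<in> D \<Longrightarrow> s > 0 \<and> s < cmod (1 - c)"
    and W: "\<And>m. \<exists>C. sum_le (\<lambda>(c, s). s * exp (m / (cmod (1 - c) - s))) D C"
    and \<rho>: "0 \<le> \<rho>1" "\<rho>1 < \<rho>2" and K: "K = cball 0 1 - discs_union D"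
  shows "\<exists>\<epsilon>>0. \<forall>p q. (\<forall>z\<in>K. poly q z \<noteq> 0) \<longrightarrow>
    \<not> (\<forall>z\<in>K. cmod (I_gen K \<rho>1 z - poly p z / poly q z * I_gen K \<rho>2 z) < \<epsilon>)"
proof -
  define \<rho> where "\<rho> = \<rho>2 - \<rho>1"
  have \<rho>': "0 < \<rho>" "\<rho> \<le> \<rho>2" using \<rho> by (auto simp: \<rho>_def)
  define d where "d = (\<lambda>(c, s). cmod (1 - c) - s)"
  define e where "e = (\<lambda>(c::complex, s::real). (1 + c) / (1 - c))"
  define R where "R x = 2 * snd x / (d x)\<^sup>2" for x
  have dpos: "d x > 0" "snd x > 0" if "x \<in> D" for x using D[of "fst x" "snd x"] that by (auto simp: d_def
      case_prod_beta)
  \<comment> \<open>The weights 2 and \<open>2 + 2 * \<rho>2\<close> arise as follows: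
    \<open>R x = 2 * snd x / (d x)^2\<close> is at most \<open>2 * snd x * exp (2 / d x)\<close>,
    hence at most \<open>2 * C2\<close>; the centre satisfies
    \<open>cmod (e x) \<le> 2 / d x + 1\<close>, which contributes another
    \<open>exp (2 * \<rho>2 / d x)\<close>.\<close>
  obtain C2 where C2: "sum_le (\<lambda>(c, s). s * exp (2 / (cmod (1 - c) - s))) D C2" using W by blast
  obtain C3 where C3: "sum_le (\<lambda>(c, s). s * exp ((2 + 2 * \<rho>2) / (cmod (1 - c) - s))) D C3" using W by blast
  have w2: "(\<lambda>(c, s). s * exp (2 / (cmod (1 - c) - s))) = (\<lambda>x. snd x * exp (2 / d x))"
    and w3: "(\<lambda>(c, s). s * exp ((2 + 2 * \<rho>2) / (cmod (1 - c) - s))) = (\<lambda>x. snd x * exp ((2 + 2 * \<rho>2) / d x))"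
    by (auto simp: d_def)
  have R2: "R x \<le> 2 * (snd x * exp (2 / d x))" if "x \<in> D" for x
  proof -
    have "1 / d x \<le> exp (1 / d x)" using exp_ge_add_one_self[of "1 / d x"] by linarith
    then have "(1 / d x)\<^sup>2 \<le> (exp (1 / d x))\<^sup>2" using dpos[OF that] by (intro power_mono) auto
    then have "1 / (d x)\<^sup>2 \<le> exp (2 / d x)" by (simp add: power_divide exp_of_nat_mult[symmetric])
    then have "2 * snd x * (1 / (d x)\<^sup>2) \<le> 2 * snd x * exp (2 / d x)"
      using dpos[OF that] by (intro mult_left_mono) auto
    then show ?thesis by (simp add: R_def)
  qed
  have Rpos: "R x > 0" if "x \<in> D" for x using dpos[OF that] by (simp add: R_def)
  have Rle: "R x \<le> 2 * C2" if "x \<in> D" for x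
  proof -
    have "sum (\<lambda>x. snd x * exp (2 / d x)) {x} \<le> C2" using C2 that unfolding sum_le_def w2 by blast
    then show ?thesis using R2[OF that] by simp
  qed
  have ele: "cmod (e x) \<le> 2 / d x + 1" if "x \<in> D" for x
  proof -
    obtain c s where x: "x = (c, s)" by (cases x)
    have ds: "cmod (1 - c) \<ge> d x" "1 - c \<noteq> 0" using dpos[OF that] by (auto simp: x d_def)
    have "e x = 2 / (1 - c) - 1" using ds by (simp add: e_def x field_simps)
    then have "cmod (e x) \<le> 2 / cmod (1 - c) + 1" using norm_triangle_ineq4[of "2 / (1 - c)" 1] by (simp
        add: norm_divide)
    also have "2 / cmod (1 - c) \<le> 2 / d x" using ds dpos[OF that] by (intro divide_left_mono) auto
    finally show ?thesis by simp
  qed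
  define C0 where "C0 = \<bar>2 * exp (\<rho>2 * (1 + 4 * C2)) * C3\<bar>"
  have sumE: "(\<Sum>x\<in>F. R x * exp (\<rho>2 * (cmod (e x) + 2 * R x))) \<le> C0" if F: "finite F" "F \<subseteq> D" for F
  proof -
    have "(\<Sum>x\<in>F. R x * exp (\<rho>2 * (cmod (e x) + 2 * R x)))
        \<le> (\<Sum>x\<in>F. 2 * exp (\<rho>2 * (1 + 4 * C2)) * (snd x * exp ((2 + 2 * \<rho>2) / d x)))"
    proof (rule sum_mono)
      fix x assume "x \<in> F"
      then have x: "x \<in> D" using F by auto
      have "\<rho>2 * (cmod (e x) + 2 * R x) \<le> \<rho>2 * (2 / d x + 1 + 2 * (2 * C2))"
        using ele[OF x] Rle[OF x] \<rho>' by (intro mult_left_mono) auto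
      also have "\<dots> = \<rho>2 * (1 + 4 * C2) + 2 * \<rho>2 / d x" by (simp add: algebra_simps)
      finally have "exp (\<rho>2 * (cmod (e x) + 2 * R x)) \<le> exp (\<rho>2 * (1 + 4 * C2)) * exp (2 * \<rho>2 / d x)"
        by (simp add: exp_add[symmetric])
      then have "R x * exp (\<rho>2 * (cmod (e x) + 2 * R x))
          \<le> (2 * (snd x * exp (2 / d x))) * (exp (\<rho>2 * (1 + 4 * C2)) * exp (2 * \<rho>2 / d x))"
        using R2[OF x] Rpos[OF x] dpos[OF x] by (intro mult_mono) auto
      also have "\<dots> = 2 * exp (\<rho>2 * (1 + 4 * C2)) * (snd x * (exp (2 / d x) * exp (2 * \<rho>2 / d x)))"
        by (simp add: mult_ac)
      also have "exp (2 / d x) * exp (2 * \<rho>2 / d x) = exp ((2 + 2 * \<rho>2) / d x)"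
        by (simp add: exp_add[symmetric] add_divide_distrib)
      finally show "R x * exp (\<rho>2 * (cmod (e x) + 2 * R x))
          \<le> 2 * exp (\<rho>2 * (1 + 4 * C2)) * (snd x * exp ((2 + 2 * \<rho>2) / d x))" .
    qed
    also have "\<dots> = 2 * exp (\<rho>2 * (1 + 4 * C2)) * (\<Sum>x\<in>F. snd x * exp ((2 + 2 * \<rho>2) / d x))"
      by (simp add: sum_distrib_left)
    also have "\<dots> \<le> 2 * exp (\<rho>2 * (1 + 4 * C2)) * C3"
      using C3 F unfolding sum_le_def w3 by (intro mult_left_mono) auto
    finally show ?thesis by (simp add: C0_def)
  qed
  have "0 \<le> C0" by (simp add: C0_def)
  from exp_not_approximable[OF \<rho>' this] obtain \<epsilon> where \<epsilon>: "\<epsilon> > 0" and core: "\<forall>E f S Cf. finite E \<longrightarrow> (\<forall>e R.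
      (e, R) \<in> E \<longrightarrow> R > 0) \<longrightarrow>
    (\<Sum>(e, R)\<in>E. R * exp (\<rho>2 * (cmod e + 2 * R))) \<le> C0 \<longrightarrow> dbar_on S f (\<lambda>w. 0) \<longrightarrow>
    {w. Re w \<ge> 0} - discs_union E \<subseteq> S \<longrightarrow>
    (\<forall>w. Re w \<ge> 0 \<longrightarrow> w \<notin> discs_union E \<longrightarrow> cmod (f w) \<le> Cf) \<longrightarrow>
    \<not> (\<forall>w. Re w \<ge> 0 \<longrightarrow> w \<notin> discs_union E \<longrightarrow>
        cmod (exp (of_real \<rho> * w) - f w) \<le> \<epsilon> * exp (\<rho>2 * Re w) * cmod (w + 1))"
    by (elim exE conjE)
  show ?thesis
  proof (intro exI[of _ \<epsilon>] conjI allI impI notI)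
    show "0 < \<epsilon>" by (rule \<epsilon>)
    fix p q :: "complex poly"
    assume q: "\<forall>z\<in>K. poly q z \<noteq> 0"
      and ap: "\<forall>z\<in>K. cmod (I_gen K \<rho>1 z - poly p z / poly q z * I_gen K \<rho>2 z) < \<epsilon>"
    let ?B = "cball (0::complex) 1"
    have gB: "continuous_on ?B (I_gen ?B r)" if "r \<ge> 0" for r
      using in_R_continuous[OF in_R_I_gen[of ?B r]] that by simp
    have gK: "I_gen K r z = I_gen ?B r z" if "z \<in> K" for z r using that K by (simp add: I_gen_def)
    \<comment> \<open>Reduction to finitely many discs: the strict estimate on \<open>K\<close> and
      the absence of zeros of \<open>q\<close> persist on a relatively open set \<open>U\<close>,
      and by compactness finitely many of the removed discs cover the rest of the closed
      disc.\<close>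
    define V where "V = {z \<in> ?B. poly q z \<noteq> 0}"
    define F where "F z = cmod (I_gen ?B \<rho>1 z - poly p z / poly q z * I_gen ?B \<rho>2 z)" for z
    have cF: "continuous_on V F"
      unfolding F_def using \<rho> by (intro continuous_intros continuous_on_subset[OF gB]) (auto simp: V_def)
    define U where "U = V \<inter> F -` {..<\<epsilon>}"
    have "openin (top_of_set V) U" unfolding U_def
      by (rule continuous_openin_preimage_gen[OF cF]) auto
    moreover have "openin (top_of_set ?B) V"
    proof -
      have "open {z. poly q z \<noteq> 0}" by (intro open_Collect_neq continuous_intros)
      then have "openin (top_of_set ?B) (?B \<inter> {z. poly q z \<noteq> 0})" by (rule openin_open_Int)
      then show ?thesis by (simp add: V_def Int_def)
    qed
    ultimately have oU: "openin (top_of_set ?B) U" by (rule openin_trans)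
    have KU: "K \<subseteq> U" using q ap gK K by (auto simp: U_def V_def F_def)
    have "closedin (top_of_set ?B) (?B - U)" using oU by (metis closedin_def closedin_diff closedin_topspace
        topspace_euclidean_subtopology)
    then have cU: "compact (?B - U)" using closedin_compact[of ?B "?B - U"] by simp
    have "?B - U \<subseteq> (\<Union>x\<in>D. case x of (c, s) \<Rightarrow> ball c s)" using KU K by (auto simp: discs_union_def)
    moreover have "open (case x of (c, s) \<Rightarrow> ball c s)" for x :: "complex \<times> real" by (cases x) auto
    ultimately obtain D0 where D0: "D0 \<subseteq> D" "finite D0" "?B - U \<subseteq> (\<Union>x\<in>D0. case x of (c, s) \<Rightarrow> ball c s)"
      using compactE_image[OF cU, of D "\<lambda>x. case x of (c, s) \<Rightarrow> ball c s"] by metis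
    then have U: "?B - discs_union D0 \<subseteq> U" by (auto simp: discs_union_def)
    define E where "E = (\<lambda>x. (e x, R x)) ` D0"
    define \<zeta> where "\<zeta> w = (w - 1) / (w + 1)" for w :: complex
    define f where "f w = poly p (\<zeta> w) / poly q (\<zeta> w)" for w
    have \<zeta>U: "\<zeta> w \<in> ?B - discs_union D0" if w: "Re w \<ge> 0" "w \<notin> discs_union E" for w
    proof -
      have w1: "w + 1 \<noteq> 0" using w(1) by (auto simp: complex_eq_iff)
      have "(cmod (w - 1))\<^sup>2 \<le> (cmod (w + 1))\<^sup>2"
        unfolding cmod_power2 using w(1) by (simp add: power2_eq_square algebra_simps)
      then have "cmod (w - 1) \<le> cmod (w + 1)" by (rule power2_le_imp_le) simp
      then have "cmod (\<zeta> w) \<le> 1" using w1 by (simp add: \<zeta>_def norm_divide divide_le_eq)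
      moreover have "\<zeta> w \<notin> discs_union D0"
      proof
        assume "\<zeta> w \<in> discs_union D0"
        then obtain c s where cs: "(c, s) \<in> D0" "cmod (\<zeta> w - c) < s"
          by (auto simp: discs_union_def dist_norm norm_minus_commute)
        define x where "x = (c, s)"
        have x: "x \<in> D" using cs(1) D0(1) by (auto simp: x_def)
        have dx: "d x = cmod (1 - c) - s" "d x > 0" "s > 0" using dpos[OF x] by (auto simp: d_def x_def)
        have 1: "cmod (1 - \<zeta> w) \<ge> d x"
          using norm_triangle_ineq[of "1 - \<zeta> w" "\<zeta> w - c"] cs(2) dx by simp
        have 2: "cmod (1 - c) \<ge> d x" using dx by simp
        have nz: "1 - \<zeta> w \<noteq> 0" "1 - c \<noteq> 0" using 1 2 dx by auto
        have z1: "1 - \<zeta> w = 2 / (w + 1)" using w1 by (simp add: \<zeta>_def field_simps)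
        then have wz: "2 / (1 - \<zeta> w) = w + 1" using w1 by simp
        have "e x = 2 / (1 - c) - 1" using nz by (simp add: e_def x_def field_simps)
        then have "w - e x = 2 / (1 - \<zeta> w) - 2 / (1 - c)" unfolding wz by simp
        also have "\<dots> = 2 * (\<zeta> w - c) / ((1 - \<zeta> w) * (1 - c))" using nz by (simp add: field_simps)
        finally have "cmod (w - e x) = 2 * cmod (\<zeta> w - c) / (cmod (1 - \<zeta> w) * cmod (1 - c))"
          by (simp only: norm_divide norm_mult norm_numeral)
        also have "\<dots> \<le> 2 * cmod (\<zeta> w - c) / (d x * d x)"
          using 1 2 dx by (intro divide_left_mono mult_mono mult_pos_pos) auto
        also have "\<dots> < 2 * s / (d x * d x)" using cs(2) dx by (intro divide_strict_right_mono) auto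
        also have "\<dots> = R x" by (simp add: R_def x_def power2_eq_square)
        finally have "w \<in> ball (e x) (R x)" by (simp add: dist_norm norm_minus_commute)
        then have "w \<in> discs_union E" using cs(1) by (auto simp: discs_union_def E_def x_def)
        then show False using w(2) by simp
      qed
      ultimately show ?thesis by simp
    qed
    define S where "S = {w. w + 1 \<noteq> 0} \<inter> {w. w + 1 \<noteq> 0 \<and> poly q (\<zeta> w) \<noteq> 0}"
    have o1: "open {w::complex. w + 1 \<noteq> 0}" by (intro open_Collect_neq continuous_intros)
    have d\<zeta>: "dbar_on {w. w + 1 \<noteq> 0} \<zeta> (\<lambda>w. 0)"
    proof -
      have 1: "dbar_on {w. w + 1 \<noteq> 0} (\<lambda>w. w + 1) (\<lambda>w. 0 + 0)" "dbar_on {w. w + 1 \<noteq> 0} (\<lambda>w. w - 1) (\<lambda>w. 0 - 0)"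
        by (intro dbar_on_add dbar_on_diff dbar_on_id dbar_on_const o1)+
      from dbar_on_mult[OF 1(2) dbar_on_inverse[OF 1(1)]]
      show ?thesis by (rule dbar_on_cong) (auto simp: \<zeta>_def)
    qed
    have oS: "open S"
    proof -
      have "open ({w. w + 1 \<noteq> 0} \<inter> (\<lambda>w. poly q (\<zeta> w)) -` (- {0}))"
        by (rule continuous_open_preimage[OF dbar_on_continuous_fun[OF dbar_on_poly[OF d\<zeta>]] o1]) auto
      moreover have "S = {w. w + 1 \<noteq> 0} \<inter> (\<lambda>w. poly q (\<zeta> w)) -` (- {0})" by (auto simp: S_def)
      ultimately show ?thesis by simp
    qed
    have df: "dbar_on S f (\<lambda>w. 0)"
    proof -
      have s: "dbar_on S \<zeta> (\<lambda>w. 0)" by (rule dbar_on_subset[OF d\<zeta> oS]) (auto simp: S_def)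
      have "dbar_on S (\<lambda>w. poly p (\<zeta> w) * (1 / poly q (\<zeta> w)))
          (\<lambda>w. poly p (\<zeta> w) * (- 0 / (poly q (\<zeta> w))\<^sup>2) + 0 * (1 / poly q (\<zeta> w)))"
        by (intro dbar_on_mult dbar_on_inverse dbar_on_poly s) (auto simp: S_def)
      then show ?thesis by (rule dbar_on_cong) (auto simp: f_def)
    qed
    have SS: "{w. Re w \<ge> 0} - discs_union E \<subseteq> S"
    proof
      fix w assume "w \<in> {w. Re w \<ge> 0} - discs_union E"
      then have w: "Re w \<ge> 0" "w \<notin> discs_union E" by auto
      then have "\<zeta> w \<in> U" using \<zeta>U U by blast
      moreover have "w + 1 \<noteq> 0" using w(1) by (auto simp: complex_eq_iff)
      ultimately show "w \<in> S" by (auto simp: S_def U_def V_def)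
    qed
    have cK0: "compact (?B - discs_union D0)" by (intro compact_diff compact_cball open_discs_union)
    have "continuous_on (?B - discs_union D0) (\<lambda>z. poly p z / poly q z)"
      using U by (intro continuous_intros) (auto simp: U_def V_def)
    then have "bounded ((\<lambda>z. poly p z / poly q z) ` (?B - discs_union D0))"
      by (intro compact_imp_bounded compact_continuous_image cK0)
    then obtain Cf where Cf: "\<And>z. z \<in> ?B - discs_union D0 \<Longrightarrow> cmod (poly p z / poly q z) \<le> Cf"
      unfolding bounded_iff by blast
    have fE: "finite E" using D0 by (simp add: E_def)
    have RE: "\<forall>e R. (e, R) \<in> E \<longrightarrow> R > 0" using D0 Rpos by (auto simp: E_def)
    have sE: "(\<Sum>(e, R)\<in>E. R * exp (\<rho>2 * (cmod e + 2 * R))) \<le> C0"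
    proof -
      have nn: "0 \<le> R x * exp (\<rho>2 * (cmod (e x) + 2 * R x))" if "x \<in> D0" for x
      proof -
        have "R x > 0" using D0(1) that by (intro Rpos) auto
        then show ?thesis by simp
      qed
      have "(\<Sum>(e, R)\<in>E. R * exp (\<rho>2 * (cmod e + 2 * R))) \<le> (\<Sum>x\<in>D0. R x * exp (\<rho>2 * (cmod (e x) + 2 * R x)))"
        unfolding E_def using D0(2) nn by (intro order_trans[OF sum_image_le]) (auto simp: o_def)
      also have "\<dots> \<le> C0" by (rule sumE[OF D0(2,1)])
      finally show ?thesis .
    qed
    have "\<forall>w. Re w \<ge> 0 \<longrightarrow> w \<notin> discs_union E \<longrightarrow>
        cmod (exp (of_real \<rho> * w) - f w) \<le> \<epsilon> * exp (\<rho>2 * Re w) * cmod (w + 1)"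
    proof (intro allI impI)
      fix w assume w: "Re w \<ge> 0" "w \<notin> discs_union E"
      have w1: "w + 1 \<noteq> 0" using w(1) by (auto simp: complex_eq_iff)
      define z where "z = \<zeta> w"
      have zU: "z \<in> U" using \<zeta>U[OF w] U by (auto simp: z_def)
      then have zB: "z \<in> ?B" and lt: "F z < \<epsilon>" by (auto simp: U_def V_def)
      have z1: "z - 1 = - (2 / (w + 1))" "z \<noteq> 1" using w1 by (auto simp: z_def \<zeta>_def field_simps)
      have "z + 1 = 2 * w / (w + 1)" using w1 by (simp add: z_def \<zeta>_def field_simps)
      then have zw: "(z + 1) / (z - 1) = - w" using w1 z1(1) by simp
      have I: "I_gen ?B r z = (z - 1) * exp (- of_real r * w)" for r
        using zB z1(2) by (simp add: I_gen_def zw)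
      have "exp (of_real \<rho> * w) * exp (- of_real \<rho>2 * w) = exp (- of_real \<rho>1 * w)"
        by (simp add: exp_add[symmetric] \<rho>_def algebra_simps)
      then have "I_gen ?B \<rho>1 z - poly p z / poly q z * I_gen ?B \<rho>2 z
          = (z - 1) * exp (- of_real \<rho>2 * w) * (exp (of_real \<rho> * w) - f w)"
        unfolding I f_def z_def[symmetric] by (simp add: algebra_simps)
      then have "F z = cmod (z - 1) * exp (- (\<rho>2 * Re w)) * cmod (exp (of_real \<rho> * w) - f w)"
        by (simp add: F_def norm_mult)
      then have lt': "2 * cmod (exp (of_real \<rho> * w) - f w) / (cmod (w + 1) * exp (\<rho>2 * Re w)) < \<epsilon>"
        using lt by (simp add: z1 norm_divide exp_minus field_simps)
      have "cmod (w + 1) * exp (\<rho>2 * Re w) > 0" using w1 by simp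
      then have "2 * cmod (exp (of_real \<rho> * w) - f w) < \<epsilon> * (cmod (w + 1) * exp (\<rho>2 * Re w))"
        using lt' by (simp add: pos_divide_less_eq)
      moreover have "\<epsilon> * (cmod (w + 1) * exp (\<rho>2 * Re w)) = \<epsilon> * exp (\<rho>2 * Re w) * cmod (w + 1)" by simp
      ultimately show "cmod (exp (of_real \<rho> * w) - f w) \<le> \<epsilon> * exp (\<rho>2 * Re w) * cmod (w + 1)"
        using norm_ge_zero[of "exp (of_real \<rho> * w) - f w"] by linarith
    qed
    moreover have "\<forall>w. Re w \<ge> 0 \<longrightarrow> w \<notin> discs_union E \<longrightarrow> cmod (f w) \<le> Cf"
      using \<zeta>U Cf by (auto simp: f_def)
    ultimately show False
      using core[THEN spec, THEN spec, THEN spec, THEN spec, THEN mp, OF fE, THEN mp, OF RE, THEN mp, OF sE,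
          THEN mp, OF df, THEN mp, OF SS, of Cf] by blast
  qed
qed

text \<open>An element of \<open>R(K)\<close> multiplying the generator may be replaced by a
  rational function, since the generator has modulus at most 2;
  \<open>I_gen_not_approximable\<close> then applies.\<close>

lemma I_ideal_strict:
  assumes D: "\<And>c s. (c, s) \<in> D \<Longrightarrow> s > 0 \<and> s < cmod (1 - c)"
    and W: "\<And>m. \<exists>C. sum_le (\<lambda>(c, s). s * exp (m / (cmod (1 - c) - s))) D C"
    and \<rho>: "0 \<le> \<rho>1" "\<rho>1 < \<rho>2" and K: "K = cball 0 1 - discs_union D"
  shows "I_gen K \<rho>1 \<notin> I_ideal K \<rho>2"
proof
  assume mem: "I_gen K \<rho>1 \<in> I_ideal K \<rho>2"
  have K': "compact K" "K \<subseteq> cball 0 1"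
    unfolding K by (intro compact_diff compact_cball open_discs_union) auto
  obtain \<epsilon> where \<epsilon>: "\<epsilon> > 0" and no: "\<And>p q. (\<forall>z\<in>K. poly q z \<noteq> 0) \<Longrightarrow>
      \<not> (\<forall>z\<in>K. cmod (I_gen K \<rho>1 z - poly p z / poly q z * I_gen K \<rho>2 z) < \<epsilon>)"
    using I_gen_not_approximable[OF D W \<rho> K] by blast
  obtain h where h: "in_R K h" "\<forall>z\<in>K. cmod (I_gen K \<rho>1 z - h z * I_gen K \<rho>2 z) < \<epsilon> / 2"
    using I_ideal_approx[OF K' _ mem, of "\<epsilon> / 2"] \<rho> \<epsilon> by auto
  have e4: "\<epsilon> / 4 > 0" using \<epsilon> by simp
  obtain p q where q: "\<And>z. z \<in> K \<Longrightarrow> poly q z \<noteq> 0"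
    and pq: "\<And>z. z \<in> K \<Longrightarrow> cmod (h z - poly p z / poly q z) < \<epsilon> / 4"
    by (rule in_R_approx_rational[OF h(1) e4]) blast
  have "cmod (I_gen K \<rho>1 z - poly p z / poly q z * I_gen K \<rho>2 z) < \<epsilon>" if z: "z \<in> K" for z
  proof -
    have "cmod (z - 1) \<le> 2" using norm_triangle_ineq4[of z 1] z K' by auto
    then have g: "cmod (I_gen K \<rho>2 z) \<le> 2" using I_gen_norm_le[OF z K'(2), of \<rho>2] \<rho> by linarith
    have "cmod ((h z - poly p z / poly q z) * I_gen K \<rho>2 z) \<le> \<epsilon> / 4 * 2"
      unfolding norm_mult using pq[OF z] g \<epsilon> by (intro mult_mono) auto
    moreover have eq: "I_gen K \<rho>1 z - poly p z / poly q z * I_gen K \<rho>2 z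
        = (I_gen K \<rho>1 z - h z * I_gen K \<rho>2 z) + (h z - poly p z / poly q z) * I_gen K \<rho>2 z"
      by (simp add: left_diff_distrib)
    moreover have "cmod (I_gen K \<rho>1 z - poly p z / poly q z * I_gen K \<rho>2 z)
        \<le> cmod (I_gen K \<rho>1 z - h z * I_gen K \<rho>2 z) + cmod ((h z - poly p z / poly q z) * I_gen K \<rho>2 z)"
      unfolding eq by (rule norm_triangle_ineq)
    moreover have "cmod (I_gen K \<rho>1 z - h z * I_gen K \<rho>2 z) < \<epsilon> / 2" using h(2) z by blast
    ultimately show ?thesis by linarith
  qed
  then show False using no q by blast
qed

lemma I_gen_mem_I_ideal: "I_gen K \<rho> \<in> I_ideal K \<rho>"
  by (simp add: I_ideal_def hull_inc)

section \<open>Normality and strong regularity\<close>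

text \<open>The centre \<open>a\<close> is only required to be near \<open>x\<close>, so that
  countably many units, with centres in a dense set, serve all points.\<close>

definition local_units :: "complex set \<Rightarrow> bool" where
  "local_units K \<longleftrightarrow> (\<forall>x e. e > 0 \<longrightarrow> (\<exists>a R u. cmod (x - a) < R \<and> ball a (2 * R) \<subseteq> ball x e \<and> in_R K u \<and>
     (\<forall>z. cmod (z - a) \<le> R \<longrightarrow> u z = 1) \<and> (\<forall>z. cmod (z - a) \<ge> 2 * R \<longrightarrow> u z = 0)))"

lemma normal_R_alg:
  assumes K: "compact K" and units: "local_units K"
  shows "normal_algebra K (R_alg K)"
  unfolding normal_algebra_def
proof (intro conjI allI impI natural_R_alg[OF K])
  fix K0 K1 assume *: "closedin (top_of_set K) K0 \<and> closedin (top_of_set K) K1 \<and> K0 \<inter> K1 = {}"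
  then have c0: "compact K0" and c1: "compact K1" and sub: "K0 \<subseteq> K" "K1 \<subseteq> K"
    using closedin_compact[OF K] closedin_imp_subset[of euclidean K] by blast+
  have "\<forall>x\<in>K1. \<exists>a R u. cmod (x - a) < R \<and> ball a (2 * R) \<inter> K0 = {} \<and> in_R K u \<and>
     (\<forall>z. cmod (z - a) \<le> R \<longrightarrow> u z = 1) \<and> (\<forall>z. cmod (z - a) \<ge> 2 * R \<longrightarrow> u z = 0)"
  proof
    fix x assume x: "x \<in> K1"
    have "open (- K0)" "x \<in> - K0" using compact_imp_closed[OF c0] * x by auto
    then obtain e where e: "e > 0" "ball x e \<subseteq> - K0" using openE by blast
    obtain a R u where "cmod (x - a) < R" "ball a (2 * R) \<subseteq> ball x e" "in_R K u"
      "\<forall>z. cmod (z - a) \<le> R \<longrightarrow> u z = 1" "\<forall>z. cmod (z - a) \<ge> 2 * R \<longrightarrow> u z = 0"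
      using units[unfolded local_units_def] e(1) by blast
    then show "\<exists>a R u. cmod (x - a) < R \<and> ball a (2 * R) \<inter> K0 = {} \<and> in_R K u \<and>
      (\<forall>z. cmod (z - a) \<le> R \<longrightarrow> u z = 1) \<and> (\<forall>z. cmod (z - a) \<ge> 2 * R \<longrightarrow> u z = 0)"
      using e(2) by (intro exI[of _ a] exI[of _ R] exI[of _ u]) auto
  qed
  from bchoice[OF this] obtain a where "\<forall>x\<in>K1. \<exists>R u. cmod (x - a x) < R \<and> ball (a x) (2 * R) \<inter> K0 = {} \<and> in_R K u \<and>
     (\<forall>z. cmod (z - a x) \<le> R \<longrightarrow> u z = 1) \<and> (\<forall>z. cmod (z - a x) \<ge> 2 * R \<longrightarrow> u z = 0)" ..
  from bchoice[OF this] obtain R where "\<forall>x\<in>K1. \<exists>u. cmod (x - a x) < R x \<and> ball (a x) (2 * R x) \<inter> K0 = {} \<and> in_R K u \<and>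
     (\<forall>z. cmod (z - a x) \<le> R x \<longrightarrow> u z = 1) \<and> (\<forall>z. cmod (z - a x) \<ge> 2 * R x \<longrightarrow> u z = 0)" ..
  from bchoice[OF this] obtain u where u: "\<forall>x\<in>K1. cmod (x - a x) < R x \<and> ball (a x) (2 * R x) \<inter> K0 = {} \<and>
      in_R K (u x) \<and>
     (\<forall>z. cmod (z - a x) \<le> R x \<longrightarrow> u x z = 1) \<and> (\<forall>z. cmod (z - a x) \<ge> 2 * R x \<longrightarrow> u x z = 0)" ..
  have "K1 \<subseteq> (\<Union>x\<in>K1. ball (a x) (R x))" using u by (auto simp: dist_norm norm_minus_commute)
  then obtain F where F: "F \<subseteq> K1" "finite F" "K1 \<subseteq> (\<Union>x\<in>F. ball (a x) (R x))"
    using compactE_image[OF c1, of K1 "\<lambda>x. ball (a x) (R x)"] by auto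
  \<comment> \<open>This is 1 as soon as one unit is 1, and 0 where all of them vanish.\<close>
  define f where "f z = 1 - (\<Prod>x\<in>F. 1 - u x z)" for z
  have "in_R K f" unfolding f_def using u F(1) by (intro in_R_diff in_R_const in_R_prod K) auto
  moreover have "f z = 1" if z: "z \<in> K1" for z
  proof -
    obtain x where x: "x \<in> F" "z \<in> ball (a x) (R x)" using F(3) z by blast
    then have "u x z = 1" using u F(1) by (auto simp: dist_norm norm_minus_commute subset_iff)
    then have "(\<Prod>x\<in>F. 1 - u x z) = 0" using x F(2) by (intro prod_zero) auto
    then show ?thesis by (simp add: f_def)
  qed
  moreover have "f z = 0" if z: "z \<in> K0" for z
  proof -
    have "u x z = 0" if "x \<in> F" for x
    proof -
      have "x \<in> K1" using that F(1) by blast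
      then have "ball (a x) (2 * R x) \<inter> K0 = {}" "\<forall>z. cmod (z - a x) \<ge> 2 * R x \<longrightarrow> u x z = 0"
        using u by blast+
      then have "z \<notin> ball (a x) (2 * R x)" "\<forall>z. cmod (z - a x) \<ge> 2 * R x \<longrightarrow> u x z = 0" using z by blast+
      then show ?thesis by (auto simp: dist_norm norm_minus_commute)
    qed
    then show ?thesis by (simp add: f_def)
  qed
  ultimately show "\<exists>f\<in>R_alg K. (\<forall>x\<in>K1. f x = 1) \<and> (\<forall>x\<in>K0. f x = 0)"
    using sub by (intro bexI[of _ "restrict f K"]) (auto simp: in_R_def)
qed

text \<open>Since \<open>ideal_M (R_alg K) x\<close> is the closure of the multiples of \<open>z - x\<close>, it suffices to
  approximate \<open>z - x\<close>.\<close>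

lemma strongly_regularI:
  assumes K: "compact K" and x: "x \<in> K"
    and ap: "\<And>e. e > 0 \<Longrightarrow> \<exists>h t. in_R K h \<and> t > 0 \<and> (\<forall>z\<in>K. cmod (z - x) < t \<longrightarrow> h z = 0) \<and>
       (\<forall>z\<in>K. cmod (h z - (z - x)) \<le> e)"
  shows "strongly_regular_at K (R_alg K) x"
  unfolding strongly_regular_at_def
proof
  show "uniform_closure K (ideal_J K (R_alg K) x) \<subseteq> ideal_M (R_alg K) x"
  proof
    fix f assume f: "f \<in> uniform_closure K (ideal_J K (R_alg K) x)"
    have "ideal_J K (R_alg K) x \<subseteq> R_alg K" by (auto simp: ideal_J_def)
    then have "f \<in> R_alg K"
      using f uniform_closure_mono[of _ "R_alg K" K] by (auto simp: R_alg_def uniform_closure_idem)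
    moreover have "cmod (f x) < e" if e: "e > 0" for e
    proof -
      obtain g where "g \<in> ideal_J K (R_alg K) x" "\<forall>y\<in>K. cmod (f y - g y) < e" using uniform_closureD[OF f e] by blast
      moreover from this have "g x = 0" by (auto simp: ideal_J_def)
      ultimately show ?thesis using x by force
    qed
    then have "f x = 0" by (metis less_irrefl zero_less_norm_iff)
    ultimately show "f \<in> ideal_M (R_alg K) x" by (simp add: ideal_M_def)
  qed
  show "ideal_M (R_alg K) x \<subseteq> uniform_closure K (ideal_J K (R_alg K) x)"
  proof
    fix f assume "f \<in> ideal_M (R_alg K) x"
    then have f: "f \<in> R_alg K" "f x = 0" by (auto simp: ideal_M_def)
    show "f \<in> uniform_closure K (ideal_J K (R_alg K) x)"
    proof (rule uniform_closureI)
      show "f \<in> extensional K" by (rule R_alg_extensional[OF f(1)])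
      show "ideal_J K (R_alg K) x \<subseteq> cont_funs K" using R_alg_cont_funs by (auto simp: ideal_J_def)
      fix e :: real assume e: "e > 0"
      then have e3: "e / 3 > 0" by simp
      obtain p q where q: "\<And>z. z \<in> K \<Longrightarrow> poly q z \<noteq> 0"
        and pq: "\<And>z. z \<in> K \<Longrightarrow> cmod (f z - poly p z / poly q z) < e / 3"
        by (rule in_R_approx_rational[OF R_alg_in_R[OF f(1)] e3]) blast
      \<comment> \<open>Subtracting its value at \<open>x\<close> makes the rational function
        divisible by \<open>z - x\<close>; the value is small because
        \<open>f x = 0\<close>.\<close>
      define c where "c = poly p x / poly q x"
      have c: "cmod c < e / 3" using pq[OF x] f(2) by (simp add: c_def)
      have "poly (p - smult c q) x = 0" using q[OF x] by (simp add: c_def)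
      then have "[:- x, 1:] dvd p - smult c q" by (simp only: poly_eq_0_iff_dvd)
      then obtain p1 where p1: "p - smult c q = [:- x, 1:] * p1" by (rule dvdE)
      have g: "in_R K (\<lambda>z. poly p1 z / poly q z)" by (rule in_R_rational[OF q])
      obtain M where M: "M > 0" "\<And>z. z \<in> K \<Longrightarrow> cmod (poly p1 z / poly q z) \<le> M" using in_R_bounded[OF K g] by blast
      have "e / (3 * M) > 0" using e M by simp
      from ap[OF this] obtain h t where h: "in_R K h" "t > 0" "\<forall>z\<in>K. cmod (z - x) < t \<longrightarrow> h z = 0"
        "\<forall>z\<in>K. cmod (h z - (z - x)) \<le> e / (3 * M)" by blast
      define k where "k z = h z * (poly p1 z / poly q z)" for z
      have "restrict k K \<in> ideal_J K (R_alg K) x"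
        unfolding ideal_J_def
      proof (intro CollectI conjI exI[of _ "K \<inter> ball x t"])
        show "restrict k K \<in> R_alg K" using in_R_mult[OF K h(1) g] by (simp add: in_R_def k_def[abs_def])
        show "openin (top_of_set K) (K \<inter> ball x t)" by (rule openin_open_Int) simp
        show "x \<in> K \<inter> ball x t" using x h(2) by simp
        show "\<forall>y\<in>K \<inter> ball x t. restrict k K y = 0" using h(3) by (auto simp: k_def dist_norm norm_minus_commute)
      qed
      moreover have "cmod (f z - restrict k K z) < e" if z: "z \<in> K" for z
      proof -
        have "poly p z - c * poly q z = (z - x) * poly p1 z"
          using arg_cong[OF p1, of "\<lambda>p. poly p z"] by (simp add: algebra_simps)
        then have r: "poly p z / poly q z = c + (z - x) * (poly p1 z / poly q z)"
          using q[OF z] by (simp add: field_simps)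
        have eq: "f z - k z = (f z - poly p z / poly q z) + (c - (h z - (z - x)) * (poly p1 z / poly q z))"
        proof -
          have "F - H * Q = (F - (C + Y * Q)) + (C - (H - Y) * Q)" for F H Q Y C :: complex
            by (simp add: algebra_simps)
          then show ?thesis unfolding r k_def .
        qed
        have "cmod ((h z - (z - x)) * (poly p1 z / poly q z)) \<le> e / (3 * M) * M"
          unfolding norm_mult[of "h z - (z - x)"] using h(4) M z e by (intro mult_mono) auto
        then have "cmod ((h z - (z - x)) * (poly p1 z / poly q z)) \<le> e / 3" using M(1) by simp
        moreover have "cmod (f z - k z) \<le> cmod (f z - poly p z / poly q z) + (cmod c + cmod ((h z - (z - x))
            * (poly p1 z / poly q z)))"
          unfolding eq by (rule order_trans[OF norm_triangle_ineq add_left_mono[OF norm_triangle_ineq4]])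
        ultimately show ?thesis using pq[OF z] c z by simp
      qed
      ultimately show "\<exists>g\<in>ideal_J K (R_alg K) x. \<forall>y\<in>K. cmod (f y - g y) < e" by blast
    qed
  qed
qed

text \<open>The number \<open>cmod (1 - c) - s\<close> is the distance of the disc from 1.
  Finiteness of the weighted sums for every \<open>m\<close> is the smallness near 1 on which
  \<open>I_gen_not_approximable\<close> relies.\<close>

definition light_discs :: "real \<Rightarrow> (complex \<times> real) set \<Rightarrow> bool" where
  "light_discs r D \<longleftrightarrow> countable D \<and> (\<forall>c s. (c, s) \<in> D \<longrightarrow> 0 < s \<and> s < cmod (1 - c)) \<and> sum_le snd D r \<and>
     (\<forall>m. \<exists>C. sum_le (\<lambda>(c, s). s * exp (m / (cmod (1 - c) - s))) D C)"

lemma sum_le_Un: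
  assumes "sum_le w A a" "sum_le w B b" "\<And>d. w d \<ge> 0 \<or> d \<notin> A \<union> B"
  shows "sum_le w (A \<union> B) (a + b)"
  unfolding sum_le_def
proof (intro allI impI)
  fix F assume F: "finite F \<and> F \<subseteq> A \<union> B"
  have "sum w F = sum w (F \<inter> A) + sum w (F - A)" using F by (intro sum.Int_Diff) auto
  also have "\<dots> \<le> a + b" using F assms(1,2) unfolding sum_le_def by (intro add_mono) auto
  finally show "sum w F \<le> a + b" .
qed

lemma light_discs_Un:
  assumes A: "light_discs a A" and B: "light_discs b B"
  shows "light_discs (a + b) (A \<union> B)"
  unfolding light_discs_def
proof (intro conjI allI)
  have pos: "(c, s) \<in> A \<union> B \<longrightarrow> 0 < s \<and> s < cmod (1 - c)" for c s using A B by (auto simp: light_discs_def)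
  show "countable (A \<union> B)" using A B by (simp add: light_discs_def)
  show "(c, s) \<in> A \<union> B \<longrightarrow> 0 < s \<and> s < cmod (1 - c)" for c s by (rule pos)
  show "sum_le snd (A \<union> B) (a + b)"
    using A B pos by (intro sum_le_Un) (auto simp: light_discs_def not_less intro: less_imp_le)
  fix m
  obtain C C' where "sum_le (\<lambda>(c, s). s * exp (m / (cmod (1 - c) - s))) A C"
    "sum_le (\<lambda>(c, s). s * exp (m / (cmod (1 - c) - s))) B C'"
    using A B unfolding light_discs_def by blast
  then have "sum_le (\<lambda>(c, s). s * exp (m / (cmod (1 - c) - s))) (A \<union> B) (C + C')"
    using pos by (intro sum_le_Un) (auto simp: intro: less_imp_le)
  then show "\<exists>C. sum_le (\<lambda>(c, s). s * exp (m / (cmod (1 - c) - s))) (A \<union> B) C" by blast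
qed

text \<open>The budget of the \<open>i\<close>-th family, whose discs keep the distance \<open>d i\<close> from \<open>1\<close>; the factor
  \<open>exp (- (i / d i))\<close> eventually dominates \<open>exp (m / d i)\<close> for each \<open>m\<close>.\<close>

definition budget :: "real \<Rightarrow> real \<Rightarrow> nat \<Rightarrow> real" where
  "budget r d i = r / 8 * (1/2) ^ i * exp (- (real i / d))"

lemma light_discs_family:
  fixes D :: "nat \<Rightarrow> (complex \<times> real) set"
  assumes r: "r > 0" and d: "\<And>i. d i > 0" and cD: "\<And>i. countable (D i)"
    and D: "\<And>i c s. (c, s) \<in> D i \<Longrightarrow> 0 < s \<and> d i \<le> cmod (1 - c) - s"
    and m: "\<And>i. sum_le snd (D i) (budget r (d i) i)"
  shows "light_discs (r / 4) (\<Union>i. D i)"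
  unfolding light_discs_def
proof (intro conjI allI impI)
  show "countable (\<Union>i. D i)" using cD by auto
  fix c s assume "(c, s) \<in> (\<Union>i. D i)"
  then obtain i where "(c, s) \<in> D i" by blast
  from D[OF this] d[of i] show "0 < s" "s < cmod (1 - c)" by linarith+
next
  have geo: "(\<Sum>i<n. r / 8 * (1/2) ^ i) \<le> r / 4" for n :: nat
  proof -
    have "(\<Sum>i<n. r / 8 * (1/2) ^ i) = r / 8 * (\<Sum>i<n. (1/2) ^ i)" by (simp add: sum_distrib_left)
    also have "(\<Sum>i<n. (1/2::real) ^ i) = 2 - 2 * (1/2) ^ n" by (induction n) auto
    also have "r / 8 * (2 - 2 * (1/2) ^ n) \<le> r / 8 * 2" using r by (intro mult_left_mono) auto
    finally show ?thesis by simp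
  qed
  \<comment> \<open>\<open>sum_le_UN\<close> asks for a weight that is nonnegative everywhere,
    whereas the weights at hand are so on the discs only; clipping at 0 does not change their
    sums.\<close>
  have gen: "sum_le (\<lambda>x. max 0 (w x)) (\<Union>i. D i) B"
    if "\<And>i. sum_le (\<lambda>x. max 0 (w x)) (D i) (b i)" "\<And>n. (\<Sum>i<n. b i) \<le> B" for w b B
    by (rule sum_le_UN[OF that(1) _ that(2)]) auto
  have eqw: "sum_le w A B = sum_le (\<lambda>x. max 0 (w x)) A B" if "\<And>x. x \<in> A \<Longrightarrow> w x \<ge> 0" for w A and B :: real
    unfolding sum_le_def using that by (intro all_cong1 imp_cong refl arg_cong2[where f = "(\<le>)"] sum.cong) auto
  have s0: "snd x \<ge> 0" if "x \<in> D i" for x i using D[of "fst x" "snd x" i] that by (simp add: less_imp_le)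
  have bl: "budget r (d i) i \<le> r / 8 * (1/2) ^ i" for i
    unfolding budget_def using r d[of i] by (intro mult_left_le) (auto simp: less_imp_le)
  have "sum_le (\<lambda>x. max 0 (snd x)) (\<Union>i. D i) (r / 4)"
  proof (rule gen[of _ "\<lambda>i. r / 8 * (1/2) ^ i"])
    show "sum_le (\<lambda>x. max 0 (snd x)) (D i) (r / 8 * (1/2) ^ i)" for i
      using sum_le_mono[OF m[of i] order_refl bl] s0 by (subst eqw[symmetric]) auto
  qed (rule geo)
  then show "sum_le snd (\<Union>i. D i) (r / 4)" using s0 by (subst eqw) auto
  fix \<mu> :: real
  define w where "w = (\<lambda>(c, s). s * exp (\<mu> / (cmod (1 - c) - s)))"
  have w0: "w x \<ge> 0" if "x \<in> D i" for x i using s0[OF that] by (auto simp: w_def split: prod.splits)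
  define b where "b i = budget r (d i) i * exp (\<bar>\<mu>\<bar> / d i)" for i
  have b: "sum_le w (D i) (b i)" for i
    unfolding sum_le_def
  proof (intro allI impI)
    fix F assume F: "finite F \<and> F \<subseteq> D i"
    have "sum w F \<le> (\<Sum>x\<in>F. snd x * exp (\<bar>\<mu>\<bar> / d i))"
    proof (rule sum_mono)
      fix x assume "x \<in> F"
      then have x: "x \<in> D i" using F by auto
      obtain c s where xe: "x = (c, s)" by (cases x)
      have ds: "0 < s" "d i \<le> cmod (1 - c) - s" using D[of c s i] x xe by auto
      have "\<mu> / (cmod (1 - c) - s) \<le> \<bar>\<mu>\<bar> / (cmod (1 - c) - s)" using ds d[of i] by (intro divide_right_mono) auto
      also have "\<dots> \<le> \<bar>\<mu>\<bar> / d i" using ds d[of i] by (intro divide_left_mono mult_pos_pos) auto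
      finally show "w x \<le> snd x * exp (\<bar>\<mu>\<bar> / d i)" using ds by (simp add: w_def xe)
    qed
    also have "\<dots> = sum snd F * exp (\<bar>\<mu>\<bar> / d i)" by (simp add: sum_distrib_right)
    also have "\<dots> \<le> b i" unfolding b_def using m[of i] F by (intro mult_right_mono) (auto simp: sum_le_def)
    finally show "sum w F \<le> b i" .
  qed
  \<comment> \<open>From the index \<open>k\<close> on the budget absorbs the weight and a geometric
    series remains; the finitely many earlier terms only enlarge the constant.\<close>
  define k where "k = nat \<lceil>\<bar>\<mu>\<bar>\<rceil>"
  have b0: "b i \<ge> 0" for i using r by (simp add: b_def budget_def)
  have bk: "b i \<le> r / 8 * (1/2) ^ i" if "i \<ge> k" for i
  proof -
    have "\<bar>\<mu>\<bar> \<le> real i" using that unfolding k_def by linarith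
    then have "\<bar>\<mu>\<bar> / d i \<le> real i / d i" using d[of i] by (intro divide_right_mono) auto
    then have "exp (- (real i / d i)) * exp (\<bar>\<mu>\<bar> / d i) \<le> 1" by (simp add: exp_add[symmetric])
    then have "r / 8 * (1/2) ^ i * (exp (- (real i / d i)) * exp (\<bar>\<mu>\<bar> / d i)) \<le> r / 8 * (1/2) ^ i * 1"
      using r by (intro mult_left_mono) auto
    then show ?thesis by (simp add: b_def budget_def mult.assoc)
  qed
  have "(\<Sum>i<n. b i) \<le> (\<Sum>i<k. b i) + r / 4" for n
  proof -
    have "(\<Sum>i<n. b i) \<le> (\<Sum>i\<in>{..<k} \<union> {..<n}. b i)" using b0 by (intro sum_mono2) auto
    also have "{..<k} \<union> {..<n} = {..<k} \<union> {k..<n}" by auto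
    also have "(\<Sum>i\<in>{..<k} \<union> {k..<n}. b i) = (\<Sum>i<k. b i) + (\<Sum>i=k..<n. b i)"
      by (rule sum.union_disjoint) auto
    also have "(\<Sum>i=k..<n. b i) \<le> (\<Sum>i=k..<n. r / 8 * (1/2) ^ i)" by (intro sum_mono bk) auto
    also have "\<dots> \<le> (\<Sum>i<n. r / 8 * (1/2) ^ i)" using r by (intro sum_mono2) auto
    also have "\<dots> \<le> r / 4" by (rule geo)
    finally show ?thesis by simp
  qed
  then have "sum_le (\<lambda>x. max 0 (w x)) (\<Union>i. D i) ((\<Sum>i<k. b i) + r / 4)"
    using b w0 by (intro gen[of _ b]) (auto simp: eqw[symmetric])
  then have "sum_le w (\<Union>i. D i) ((\<Sum>i<k. b i) + r / 4)" using w0 by (subst eqw) auto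
  then show "\<exists>C. sum_le (\<lambda>(c, s). s * exp (\<mu> / (cmod (1 - c) - s))) (\<Union>i. D i) C" unfolding w_def by blast
qed

text \<open>The annulus keeps distance \<open>d\<close> from 1. What has to be bounded is the
  distance of the centre minus the radius, so a point of the disc on the way from \<open>c\<close>
  to 1 is needed.\<close>

lemma annulus_dist_1:
  assumes "cmod (1 - a) < R \<or> cmod (1 - a) > 2 * R"
  shows "\<exists>d>0. \<forall>c s. s > 0 \<longrightarrow> ball c s \<subseteq> {z. R < cmod (z - a) \<and> cmod (z - a) < 2 * R} \<longrightarrow> d \<le> cmod (1 - c) - s"
proof -
  define d where "d = max (R - cmod (1 - a)) (cmod (1 - a) - 2 * R)"
  have d: "d > 0" using assms by (auto simp: d_def)
  have "d \<le> cmod (1 - c) - s" if s: "s > 0" "ball c s \<subseteq> {z. R < cmod (z - a) \<and> cmod (z - a) < 2 * R}" for c s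
  proof (rule ccontr)
    assume "\<not> d \<le> cmod (1 - c) - s"
    then have lt: "cmod (1 - c) < d + s" by simp
    \<comment> \<open>Divides the segment from \<open>c\<close> to 1 in the ratio \<open>s\<close>
      to \<open>d\<close>: if the segment is shorter than \<open>d + s\<close>, then
      \<open>z\<close> lies in the disc and closer to 1 than \<open>d\<close>.\<close>
    define z where "z = c + of_real (s / (d + s)) * (1 - c)"
    have "z - c = of_real (s / (d + s)) * (1 - c)" by (simp add: z_def)
    then have "cmod (z - c) = \<bar>s / (d + s)\<bar> * cmod (1 - c)" by (simp only: norm_mult norm_of_real)
    then have "cmod (z - c) = s / (d + s) * cmod (1 - c)" using s d by simp
    also have "\<dots> < s / (d + s) * (d + s)" using lt s d by (intro mult_strict_left_mono) auto
    finally have "z \<in> ball c s" using s d by (simp add: dist_norm norm_minus_commute)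
    then have z: "R < cmod (z - a)" "cmod (z - a) < 2 * R" using s(2) by auto
    have k: "1 - s / (d + s) = d / (d + s)" using s d by (simp add: field_simps)
    have "1 - z = of_real (1 - s / (d + s)) * (1 - c)" by (simp add: z_def algebra_simps)
    then have "cmod (1 - z) = \<bar>d / (d + s)\<bar> * cmod (1 - c)" by (simp only: k norm_mult norm_of_real)
    then have "cmod (1 - z) = d / (d + s) * cmod (1 - c)" using s d by simp
    also have "\<dots> < d / (d + s) * (d + s)" using lt s d by (intro mult_strict_left_mono) auto
    finally have "cmod (1 - z) < d" using s d by simp
    moreover have "\<bar>cmod (1 - a) - cmod (z - a)\<bar> \<le> cmod (1 - z)"
      using norm_triangle_ineq3[of "1 - a" "z - a"] by simp
    ultimately show False using z by (auto simp: d_def)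
  qed
  then show ?thesis using d by blast
qed

text \<open>If \<open>x = 1\<close>, then \<open>a\<close> near \<open>x\<close> puts 1 inside the
  small disc. Otherwise the radius is taken so small that 1 stays outside the large disc. The factor
  3 is needed because \<open>ball a (2 * R)\<close> lies in the ball of radius \<open>3 * R\<close>
  about \<open>x\<close>.\<close>

lemma unit_parameters_dense:
  fixes A :: "complex set"
  assumes A: "\<And>X. open X \<Longrightarrow> X \<noteq> {} \<Longrightarrow> \<exists>a\<in>A. a \<in> X" and e: "e > 0"
  shows "\<exists>a\<in>A. \<exists>n. cmod (x - a) < 1 / real (Suc n) \<and> 3 / real (Suc n) < e \<and>
    (cmod (1 - a) < 1 / real (Suc n) \<or> cmod (1 - a) > 2 * (1 / real (Suc n)))"
proof -
  define e' where "e' = (if x = 1 then e else min e (cmod (1 - x))) / 3"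
  have "e' > 0" using e by (auto simp: e'_def)
  then obtain n where n: "1 / real (Suc n) < e'" using nat_approx_posE by blast
  have "ball x (1 / real (Suc n)) \<noteq> {}" by simp
  then obtain a where a: "a \<in> A" "a \<in> ball x (1 / real (Suc n))" using A[of "ball x (1 / real (Suc n))"] by auto
  have xa: "cmod (x - a) < 1 / real (Suc n)" using a(2) by (simp add: dist_norm)
  have "cmod (1 - a) < 1 / real (Suc n) \<or> cmod (1 - a) > 2 * (1 / real (Suc n))"
  proof (cases "x = 1")
    case False
    then have "3 * (1 / real (Suc n)) < cmod (1 - x)" using n by (simp add: e'_def)
    moreover have "cmod (1 - x) \<le> cmod (1 - a) + cmod (x - a)"
      using norm_triangle_ineq4[of "1 - a" "x - a"] by simp
    ultimately show ?thesis using xa by linarith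
  qed (use xa in simp)
  moreover have "3 * (1 / real (Suc n)) < e" using n e by (auto simp: e'_def split: if_splits)
  ultimately show ?thesis using a(1) xa by auto
qed

lemma cheese_discs_exist:
  assumes r: "r > 0"
  shows "\<exists>D. light_discs r D \<and> infinite D \<and>
    local_units (cball 0 1 - discs_union D) \<and>
    (\<forall>x\<in>cball 0 1 - discs_union D - {1}. strongly_regular_at (cball 0 1 - discs_union D) (R_alg (cball 0 1 -
        discs_union D)) x)"
proof -
  obtain A :: "complex set" where A: "countable A" "\<And>X. open X \<Longrightarrow> X \<noteq> {} \<Longrightarrow> \<exists>a\<in>A. a \<in> X"
    using countable_dense_exists[where 'a = complex] by blast
  define G where "G = {(a, n). a \<in> A \<and> (cmod (1 - a) < 1 / real (Suc n) \<or> cmod (1 - a) > 2 * (1 / real (Suc n)))}"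
  have Gd: "\<exists>g\<in>G. cmod (x - fst g) < 1 / real (Suc (snd g)) \<and> 3 / real (Suc (snd g)) < e" if "e > 0" for x e
    using unit_parameters_dense[OF A(2) that, of x] by (fastforce simp: G_def)
  have cG: "countable G"
    by (rule countable_subset[of _ "A \<times> UNIV"]) (auto simp: G_def A)
  have neG: "G \<noteq> {}" using Gd[of 1 1] by auto
  define g where "g j = from_nat_into G j" for j
  define ca where "ca j = fst (g j)" for j
  define cr where "cr j = 1 / real (Suc (snd (g j)))" for j
  have gG: "g j \<in> G" for j unfolding g_def by (rule from_nat_into[OF neG])
  have dense: "\<exists>j. cmod (x - ca j) < cr j \<and> 3 * cr j < e" if e: "e > 0" for x e
  proof -
    obtain y where y: "y \<in> G" "cmod (x - fst y) < 1 / real (Suc (snd y))" "3 / real (Suc (snd y)) < e"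
      using Gd[OF e] by blast
    obtain j where "g j = y" using from_nat_into_surj[OF cG y(1)] by (auto simp: g_def)
    then show ?thesis using y by (intro exI[of _ j]) (simp add: ca_def cr_def)
  qed
  have crp: "cr j > 0" for j by (simp add: cr_def)
  have "\<forall>j. \<exists>d>0. \<forall>c s. s > 0 \<longrightarrow> ball c s \<subseteq> {z. cr j < cmod (z - ca j) \<and> cmod (z - ca j) < 2 * cr j} \<longrightarrow> d \<le>
      cmod (1 - c) - s"
  proof
    fix j
    have "cmod (1 - ca j) < cr j \<or> cmod (1 - ca j) > 2 * cr j"
      using gG[of j] by (auto simp: G_def ca_def cr_def)
    then show "\<exists>d>0. \<forall>c s. s > 0 \<longrightarrow> ball c s \<subseteq> {z. cr j < cmod (z - ca j) \<and> cmod (z - ca j) < 2 * cr j} \<longrightarrow> d \<le>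
        cmod (1 - c) - s"
      by (rule annulus_dist_1)
  qed
  from choice[OF this] obtain d1 where d1: "\<And>j. d1 j > 0" and
    d1': "\<And>j c s. s > 0 \<Longrightarrow> ball c s \<subseteq> {z. cr j < cmod (z - ca j) \<and> cmod (z - ca j) < 2 * cr j} \<Longrightarrow> d1 j \<le> cmod
        (1 - c) - s"
    by blast
  have bp: "budget r d i > 0" for d i using r by (simp add: budget_def)
  have "\<forall>j. \<exists>D u M. annulus_unit (ca j) (cr j) (budget r (d1 j) j) D u M"
    using annulus_unit_exists[OF crp bp] by blast
  from choice[OF this] obtain D1 where "\<forall>j. \<exists>u M. annulus_unit (ca j) (cr j) (budget r (d1 j) j) (D1 j) u M" ..
  from choice[OF this] obtain u where "\<forall>j. \<exists>M. annulus_unit (ca j) (cr j) (budget r (d1 j) j) (D1 j) (u j) M" ..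
  from choice[OF this] obtain M where U: "\<And>j. annulus_unit (ca j) (cr j) (budget r (d1 j) j) (D1 j) (u j) (M
      j)" by blast
  define DK where "DK = (\<Union>j. D1 j)"
  have sub1: "ball c s \<subseteq> {z. cr j < cmod (z - ca j) \<and> cmod (z - ca j) < 2 * cr j}" if "(c, s) \<in> D1 j" for c s j
  proof -
    have "ball c s \<subseteq> discs_union (D1 j)" using that by (auto simp: discs_union_def)
    then show ?thesis using U[of j] unfolding annulus_unit_def by blast
  qed
  have LK: "light_discs (r / 4) DK"
    unfolding DK_def
  proof (rule light_discs_family[OF r d1])
    fix i
    show "countable (D1 i)" "sum_le snd (D1 i) (budget r (d1 i) i)" using U[of i] by (auto simp: annulus_unit_def)
    fix c s assume cs: "(c, s) \<in> D1 i"
    then have "s > 0" using U[of i] by (auto simp: annulus_unit_def)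
    then show "0 < s \<and> d1 i \<le> cmod (1 - c) - s" using d1'[OF _ sub1[OF cs]] by simp
  qed
  \<comment> \<open>Used in stage \<open>n\<close> both as precision and as distance from 1, so
    every \<open>x\<close> other than 1 is treated by all late stages, with arbitrarily small
    error.\<close>
  define d2 where "d2 n = 1 / real (Suc n)" for n
  have d2: "0 < d2 n" "d2 n \<le> 1" "d2 n / 4 > 0" for n by (auto simp: d2_def)
  have "\<forall>n. \<exists>D s J. grid_stage (d2 n) (d2 n) (budget r (d2 n / 4) n) s (d2 n / (1 + (\<Sum>j\<in>J. \<bar>M j\<bar>))) D \<and> finite J \<and>
      (\<forall>x. cmod x \<le> 1 \<longrightarrow> (\<exists>j\<in>J. cmod (x - ca j) < cr j \<and> 3 * cr j < s))"
  proof
    fix n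
    obtain s where s: "s > 0" "\<And>\<tau>. \<tau> > 0 \<Longrightarrow> \<exists>D. grid_stage (d2 n) (d2 n) (budget r (d2 n / 4) n) s \<tau> D"
      using grid_stage_exists[OF d2(1) d2(2) d2(1) bp, of n n "d2 n / 4" n] by blast
    \<comment> \<open>A unit with \<open>3 * cr j < s\<close> and \<open>x\<close> in its inner disc
      has its support within \<open>s\<close> of \<open>x\<close>. Finitely many inner discs cover
      the closed unit disc, which gives a common bound before \<open>\<tau>\<close> is
      chosen.\<close>
    define J0 where "J0 = {j. 3 * cr j < s}"
    have "cball 0 1 \<subseteq> (\<Union>j\<in>J0. ball (ca j) (cr j))"
    proof
      fix x :: complex
      obtain j where "cmod (x - ca j) < cr j" "3 * cr j < s" using dense[OF s(1)] by blast
      then show "x \<in> (\<Union>j\<in>J0. ball (ca j) (cr j))" by (auto simp: J0_def dist_norm norm_minus_commute)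
    qed
    then obtain J where J: "J \<subseteq> J0" "finite J" "cball 0 1 \<subseteq> (\<Union>j\<in>J. ball (ca j) (cr j))"
      using compactE_image[of "cball 0 1" J0 "\<lambda>j. ball (ca j) (cr j)"] by auto
    have "d2 n / (1 + (\<Sum>j\<in>J. \<bar>M j\<bar>)) > 0" using d2 by (intro divide_pos_pos add_pos_nonneg sum_nonneg) auto
    then obtain D where "grid_stage (d2 n) (d2 n) (budget r (d2 n / 4) n) s (d2 n / (1 + (\<Sum>j\<in>J. \<bar>M j\<bar>))) D"
      using s(2) by blast
    moreover have "\<exists>j\<in>J. cmod (x - ca j) < cr j \<and> 3 * cr j < s" if "cmod x \<le> 1" for x
    proof -
      have "x \<in> cball 0 1" using that by simp
      then obtain j where "j \<in> J" "x \<in> ball (ca j) (cr j)" using J(3) by blast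
      then show ?thesis using J(1) by (intro bexI[of _ j]) (auto simp: J0_def dist_norm norm_minus_commute)
    qed
    ultimately show "\<exists>D s J. grid_stage (d2 n) (d2 n) (budget r (d2 n / 4) n) s (d2 n / (1 + (\<Sum>j\<in>J. \<bar>M j\<bar>)))
        D \<and> finite J \<and>
      (\<forall>x. cmod x \<le> 1 \<longrightarrow> (\<exists>j\<in>J. cmod (x - ca j) < cr j \<and> 3 * cr j < s))" using J(2) by blast
  qed
  from choice[OF this] obtain D2 where "\<forall>n. \<exists>s J. grid_stage (d2 n) (d2 n) (budget r (d2 n / 4) n) s (d2 n /
      (1 + (\<Sum>j\<in>J. \<bar>M j\<bar>))) (D2 n) \<and> finite J \<and>
      (\<forall>x. cmod x \<le> 1 \<longrightarrow> (\<exists>j\<in>J. cmod (x - ca j) < cr j \<and> 3 * cr j < s))" ..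
  from choice[OF this] obtain s where "\<forall>n. \<exists>J. grid_stage (d2 n) (d2 n) (budget r (d2 n / 4) n) (s n) (d2 n
      / (1 + (\<Sum>j\<in>J. \<bar>M j\<bar>))) (D2 n) \<and> finite J \<and>
      (\<forall>x. cmod x \<le> 1 \<longrightarrow> (\<exists>j\<in>J. cmod (x - ca j) < cr j \<and> 3 * cr j < s n))" ..
  from choice[OF this] obtain J where
      G: "\<And>n. grid_stage (d2 n) (d2 n) (budget r (d2 n / 4) n) (s n) (d2 n / (1 + (\<Sum>j\<in>J n. \<bar>M j\<bar>))) (D2 n)"
      and J: "\<And>n. finite (J n)" "\<And>n x. cmod x \<le> 1 \<Longrightarrow> \<exists>j\<in>J n. cmod (x - ca j) < cr j \<and> 3 * cr j < s n"
    by blast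
  define DL where "DL = (\<Union>n. D2 n)"
  have LL: "light_discs (r / 4) DL"
    unfolding DL_def
  proof (rule light_discs_family[OF r, where d = "\<lambda>n. d2 n / 4"])
    fix i
    have f: "finite (D2 i)" using G[of i] by (simp add: grid_stage_def)
    then show "countable (D2 i)" by (rule countable_finite)
    have p: "0 < s \<and> d2 i / 4 \<le> cmod (1 - c) - s" if "(c, s) \<in> D2 i" for c s
      using G[of i] that by (simp add: grid_stage_def)
    show "0 < s \<and> d2 i / 4 \<le> cmod (1 - c) - s" if "(c, s) \<in> D2 i" for c s by (rule p[OF that])
    show "sum_le snd (D2 i) (budget r (d2 i / 4) i)"
    proof (rule sum_le_finite[OF f])
      show "snd x \<ge> 0" if "x \<in> D2 i" for x using p[of "fst x" "snd x"] that by simp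
      show "sum snd (D2 i) \<le> budget r (d2 i / 4) i" using G[of i] by (simp add: grid_stage_def)
    qed
  qed (use d2 in auto)
  \<comment> \<open>Discs about 5 of radius at most 1 do not meet the closed unit disc. They
    guarantee that \<open>D\<close> is infinite, so that it can be enumerated as a sequence of
    distinct discs.\<close>
  define r' where "r' = min r 1"
  have r': "r' > 0" "r' \<le> r" "r' \<le> 1" using r by (auto simp: r'_def)
  define D3 where "D3 i = {(5 :: complex, budget r' 3 i)}" for i :: nat
  define DD where "DD = (\<Union>i. D3 i)"
  have b3: "0 < budget r' 3 i" "budget r' 3 i \<le> 1" for i
  proof -
    show "0 < budget r' 3 i" using r' by (simp add: budget_def)
    have "(1/2::real) ^ i \<le> 1" by (rule power_le_one) auto
    moreover have "exp (- (real i / 3)) \<le> 1" by simp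
    ultimately have "r' / 8 * (1/2) ^ i * exp (- (real i / 3)) \<le> 1"
      using r' by (intro mult_le_one) auto
    then show "budget r' 3 i \<le> 1" by (simp add: budget_def)
  qed
  have L3: "light_discs (r' / 4) DD"
    unfolding DD_def
  proof (rule light_discs_family[OF r'(1), where d = "\<lambda>n. 3"])
    fix i
    show "countable (D3 i)" by (simp add: D3_def)
    show "0 < s \<and> 3 \<le> cmod (1 - c) - s" if "(c, s) \<in> D3 i" for c s
      using that b3[of i] by (simp add: D3_def)
    show "sum_le snd (D3 i) (budget r' 3 i)"
      by (rule sum_le_finite) (use b3[of i] in \<open>auto simp: D3_def less_imp_le\<close>)
  qed simp
  have infD: "infinite DD"
  proof -
    have "inj (budget r' 3)"
    proof (rule strict_mono_imp_inj_on[of "\<lambda>i. - budget r' 3 i", THEN inj_on_imageI2[of uminus "budget r' 3"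
        UNIV, unfolded o_def]])
      show "strict_mono (\<lambda>i. - budget r' 3 i)"
      proof (rule strict_monoI_Suc)
        fix i
        have "r' / 8 * (1/2) ^ Suc i * exp (- (real (Suc i) / 3)) < r' / 8 * (1/2) ^ i * exp (- (real i / 3))"
          using r' by (intro mult_strict_mono mult_strict_left_mono) auto
        then show "- budget r' 3 i < - budget r' 3 (Suc i)" by (simp add: budget_def)
      qed
    qed
    then have "inj (\<lambda>i. (5 :: complex, budget r' 3 i))" by (auto simp: inj_on_def)
    then have "infinite (range (\<lambda>i. (5 :: complex, budget r' 3 i)))" by (rule range_inj_infinite)
    moreover have "DD = range (\<lambda>i. (5 :: complex, budget r' 3 i))" by (auto simp: DD_def D3_def)
    ultimately show ?thesis by simp
  qed
  define D where "D = (DK \<union> DL) \<union> DD"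
  have LD: "light_discs r D"
  proof -
    have "light_discs (r / 4 + r / 4 + r' / 4) D" unfolding D_def by (intro light_discs_Un LK LL L3)
    moreover have "r / 4 + r / 4 + r' / 4 \<le> r" using r' by simp
    ultimately show ?thesis unfolding light_discs_def using sum_le_mono by blast
  qed
  define K where "K = cball 0 1 - discs_union D"
  have cK: "compact K" unfolding K_def by (intro compact_diff compact_cball open_discs_union)
  have K1: "K \<inter> discs_union (D1 j) = {}" for j
    using discs_union_mono[of "D1 j" D] by (auto simp: K_def D_def DK_def)
  have K2: "K \<inter> discs_union (D2 n) = {}" for n
    using discs_union_mono[of "D2 n" D] by (auto simp: K_def D_def DL_def)
  have u: "in_R K (u j)" "\<And>z. cmod (z - ca j) \<le> cr j \<Longrightarrow> u j z = 1" "\<And>z. cmod (z - ca j) \<ge> 2 * cr j \<Longrightarrow> u j z = 0"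
     "\<And>z. z \<in> K \<Longrightarrow> cmod (u j z) \<le> M j" for j
    using U[of j] cK K1[of j] unfolding annulus_unit_def by blast+
  have units: "local_units K"
    unfolding local_units_def
  proof (intro allI impI)
    fix x :: complex and e :: real assume "e > 0"
    then obtain j where j: "cmod (x - ca j) < cr j" "3 * cr j < e" using dense by blast
    have "ball (ca j) (2 * cr j) \<subseteq> ball x e"
    proof
      fix z assume "z \<in> ball (ca j) (2 * cr j)"
      then have "cmod (z - ca j) < 2 * cr j" by (simp add: dist_norm norm_minus_commute)
      moreover have "cmod (z - x) \<le> cmod (z - ca j) + cmod (x - ca j)"
        using norm_triangle_ineq4[of "z - ca j" "x - ca j"] by simp
      ultimately show "z \<in> ball x e" using j by (simp add: dist_norm norm_minus_commute)
    qed
    then show "\<exists>a R u. cmod (x - a) < R \<and> ball a (2 * R) \<subseteq> ball x e \<and> in_R K u \<and>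
     (\<forall>z. cmod (z - a) \<le> R \<longrightarrow> u z = 1) \<and> (\<forall>z. cmod (z - a) \<ge> 2 * R \<longrightarrow> u z = 0)"
      using j(1) u by blast
  qed
  have "strongly_regular_at K (R_alg K) x" if x: "x \<in> K" "x \<noteq> 1" for x
  proof (rule strongly_regularI[OF cK x(1)])
    fix e :: real assume e: "e > 0"
    have x1: "cmod x \<le> 1" using x by (auto simp: K_def)
    define e' where "e' = min (e / 2) (cmod (x - 1))"
    have "e' > 0" using e x by (simp add: e'_def)
    then obtain n where n: "d2 n < e'" unfolding d2_def using nat_approx_posE by blast
    have n1: "d2 n \<le> e / 2" "d2 n \<le> cmod (x - 1)" using n by (auto simp: e'_def)
    define \<tau> where "\<tau> = d2 n / (1 + (\<Sum>j\<in>J n. \<bar>M j\<bar>))"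
    obtain h where h: "\<forall>K. compact K \<longrightarrow> K \<inter> discs_union (D2 n) = {} \<longrightarrow> in_R K h"
        "\<forall>z. cmod z \<le> 1 \<longrightarrow> z \<notin> discs_union (D2 n) \<longrightarrow> cmod (h z - (z - x)) \<le> d2 n"
        "\<forall>z. cmod (z - x) \<le> s n \<longrightarrow> cmod (h z) \<le> \<tau>"
      using G[of n] x1 n1(2) unfolding grid_stage_def \<tau>_def by blast
    obtain j where j: "j \<in> J n" "cmod (x - ca j) < cr j" "3 * cr j < s n" using J(2)[OF x1] by blast
    define k where "k z = h z * (1 - u j z)" for z
    have "in_R K h" using h(1) cK K2 by blast
    then have "in_R K k" unfolding k_def by (intro in_R_mult in_R_diff in_R_const u cK)
    moreover have "cr j - cmod (x - ca j) > 0" using j by simp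
    moreover have "k z = 0" if "cmod (z - x) < cr j - cmod (x - ca j)" for z
    proof -
      have "cmod (z - ca j) \<le> cmod (z - x) + cmod (x - ca j)"
        using norm_triangle_ineq[of "z - x" "x - ca j"] by simp
      then have "u j z = 1" using that by (intro u) linarith
      then show ?thesis by (simp add: k_def)
    qed
    moreover have "cmod (k z - (z - x)) \<le> e" if z: "z \<in> K" for z
    proof -
      have "cmod z \<le> 1" "z \<notin> discs_union (D2 n)" using z K2[of n] by (auto simp: K_def)
      then have 1: "cmod (h z - (z - x)) \<le> d2 n" using h(2) by blast
      \<comment> \<open>Multiplication by \<open>1 - u j\<close> disturbs \<open>h\<close> only on
        the support of the unit, which lies within \<open>s n\<close> of \<open>x\<close>. There
        \<open>h\<close> is at most \<open>\<tau>\<close>, which outweighs the bound of the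
        unit.\<close>
      have 2: "cmod (h z * u j z) \<le> d2 n"
      proof (cases "cmod (z - ca j) \<ge> 2 * cr j")
        case True
        then show ?thesis using u(3)[OF True] d2(1)[of n] by simp
      next
        case False
        have "cmod (z - x) \<le> cmod (z - ca j) + cmod (x - ca j)"
          using norm_triangle_ineq4[of "z - ca j" "x - ca j"] by simp
        then have "cmod (z - x) \<le> s n" using False j by linarith
        then have hz: "cmod (h z) \<le> \<tau>" using h(3) by blast
        have "\<bar>M j\<bar> \<le> (\<Sum>j\<in>J n. \<bar>M j\<bar>)" using J(1) j(1) by (intro member_le_sum) auto
        then have uz: "cmod (u j z) \<le> 1 + (\<Sum>j\<in>J n. \<bar>M j\<bar>)" using u(4)[OF z, of j] by linarith
        have "cmod (h z * u j z) \<le> \<tau> * (1 + (\<Sum>j\<in>J n. \<bar>M j\<bar>))"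
          unfolding norm_mult using hz uz order_trans[OF norm_ge_zero hz] by (intro mult_mono) auto
        also have "\<dots> = d2 n"
        proof -
          have "1 + (\<Sum>j\<in>J n. \<bar>M j\<bar>) > 0" by (intro add_pos_nonneg sum_nonneg) auto
          then show ?thesis by (simp add: \<tau>_def)
        qed
        finally show ?thesis .
      qed
      have eq: "k z - (z - x) = (h z - (z - x)) - h z * u j z" by (simp add: k_def algebra_simps)
      have "cmod (k z - (z - x)) \<le> cmod (h z - (z - x)) + cmod (h z * u j z)"
        unfolding eq by (rule norm_triangle_ineq4)
      then show ?thesis using 1 2 n1(1) by linarith
    qed
    ultimately show "\<exists>h t. in_R K h \<and> t > 0 \<and> (\<forall>z\<in>K. cmod (z - x) < t \<longrightarrow> h z = 0) \<and>
       (\<forall>z\<in>K. cmod (h z - (z - x)) \<le> e)" by blast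
  qed
  then show ?thesis using LD infD units unfolding K_def D_def by (intro exI[of _ "DK \<union> DL \<union> DD"]) auto
qed

text \<open>As \<open>D\<close> is infinite, its enumeration is a bijection and no radius is counted
  twice.\<close>

lemma infinite_discs_enumerate:
  assumes D: "light_discs r D" "infinite D"
  shows "\<exists>c s. (\<forall>k. s k > 0) \<and> summable s \<and> (\<Sum>k. s k) \<le> r \<and> swiss_cheese c s = cball 0 1 - discs_union D"
proof -
  have cD: "countable D" using D by (simp add: light_discs_def)
  define f where "f = from_nat_into D"
  have f: "bij_betw f UNIV D" unfolding f_def by (rule bij_betw_from_nat_into[OF cD D(2)])
  define c where "c k = fst (f k)" for k
  define s where "s k = snd (f k)" for k
  have fD: "(c k, s k) \<in> D" for k using f by (auto simp: c_def s_def bij_betw_def)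
  have pos: "s k > 0" for k using D(1) fD[of k] by (auto simp: light_discs_def)
  have part: "(\<Sum>k<n. s k) \<le> r" for n
  proof -
    have "inj_on f {..<n}" using f by (auto simp: bij_betw_def inj_on_def)
    then have "(\<Sum>k<n. s k) = sum snd (f ` {..<n})" by (simp add: sum.reindex s_def)
    moreover have "f ` {..<n} \<subseteq> D" using f by (auto simp: bij_betw_def)
    then have "sum snd (f ` {..<n}) \<le> r" using D(1) unfolding light_discs_def sum_le_def by blast
    ultimately show ?thesis by simp
  qed
  have sm: "summable s" using pos part by (intro summableI_nonneg_bounded[of _ r]) (auto simp: less_imp_le)
  have "discs_union D = (\<Union>k. ball (c k) (s k))"
  proof -
    have "D = range f" using f by (simp add: bij_betw_def)
    then show ?thesis by (auto simp: discs_union_def c_def s_def case_prod_beta)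
  qed
  then have "swiss_cheese c s = cball 0 1 - discs_union D" by (simp add: swiss_cheese_def)
  moreover have "(\<Sum>k. s k) \<le> r" by (rule suminf_le_const[OF sm part])
  ultimately show ?thesis using pos sm by blast
qed

theorem theorem1p4:
  fixes r :: real
  assumes "r > 0"
  shows
    "(\<exists>c s. (\<forall>k. s k > 0) \<and> summable s \<and> (\<Sum>k. s k) < r \<and>
        (let K = swiss_cheese c s in
          1 \<in> K \<and>
          normal_algebra K (R_alg K) \<and>
          (\<forall>x\<in>K - {1}. strongly_regular_at K (R_alg K) x) \<and>
          \<not> strongly_regular_at K (R_alg K) 1)) \<and>
     (\<exists>c s. (\<forall>k. s k > 0) \<and> summable s \<and> (\<Sum>k. s k) < r \<and>
        (let K = swiss_cheese c s in
          1 \<in> K \<and>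
          normal_algebra K (R_alg K) \<and>
          (\<forall>x\<in>K - {1}. strongly_regular_at K (R_alg K) x) \<and>
          \<not> strongly_regular_at K (R_alg K) 1 \<and>
          (\<forall>\<rho>1 \<rho>2. 0 \<le> \<rho>1 \<and> \<rho>1 < \<rho>2 \<longrightarrow> I_ideal K \<rho>2 \<subset> I_ideal K \<rho>1)))"
proof -
  \<comment> \<open>Half of \<open>r\<close> turns the weak bound on the sum of the radii into a
    strict one.\<close>
  obtain D where D: "light_discs (r / 2) D" "infinite D" and units: "local_units (cball 0 1 - discs_union D)"
    and reg: "\<forall>x\<in>cball 0 1 - discs_union D - {1}.
      strongly_regular_at (cball 0 1 - discs_union D) (R_alg (cball 0 1 - discs_union D)) x"
    using cheese_discs_exist[of "r / 2"] assms by auto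
  obtain c s where cs: "\<And>k. s k > 0" "summable s" "(\<Sum>k. s k) \<le> r / 2"
    and cheese: "swiss_cheese c s = cball 0 1 - discs_union D"
    using infinite_discs_enumerate[OF D] by blast
  define K where "K = swiss_cheese c s"
  have KD: "K = cball 0 1 - discs_union D" by (simp add: K_def cheese)
  have K: "compact K" "K \<subseteq> cball 0 1"
    unfolding KD by (intro compact_diff compact_cball open_discs_union) auto
  have discs: "0 < t \<and> t < cmod (1 - a)" if "(a, t) \<in> D" for a t
    using D(1) that by (simp add: light_discs_def)
  have weights: "\<exists>C. sum_le (\<lambda>(a, t). t * exp (m / (cmod (1 - a) - t))) D C" for m
    using D(1) by (simp add: light_discs_def)
  have one: "1 \<in> K"
    using discs by (fastforce simp: KD discs_union_def dist_norm norm_minus_commute)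
  have strict: "I_ideal K \<rho>2 \<subset> I_ideal K \<rho>1" if "0 \<le> \<rho>1" "\<rho>1 < \<rho>2" for \<rho>1 \<rho>2
    using I_ideal_antimono[OF K, of \<rho>1 \<rho>2] I_ideal_strict[OF discs weights that KD]
      I_gen_mem_I_ideal[of K \<rho>1] that by auto
  have "\<not> strongly_regular_at K (R_alg K) 1"
  proof
    assume "strongly_regular_at K (R_alg K) 1"
    \<comment> \<open>The ideal \<open>I_ideal K 1\<close> is closed and contains all functions
      vanishing near 1. Strong regularity would put every function vanishing at 1 into it, in
      particular \<open>z - 1\<close>, that is \<open>I_gen K 0\<close>.\<close>
    then have "ideal_M (R_alg K) 1 \<subseteq> I_ideal K 1"
      unfolding strongly_regular_at_def
      using uniform_closure_mono[OF ideal_J_subset_I_ideal[OF K], of 1] I_ideal_closed[OF K, of 1] by auto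
    moreover have "I_gen K 0 \<in> ideal_M (R_alg K) 1"
      using in_R_I_gen[OF K, of 0] one by (simp add: ideal_M_def in_R_def restrict_I_gen) (simp add: I_gen_def)
    ultimately show False using I_ideal_strict[OF discs weights _ _ KD, of 0 1] by auto
  qed
  moreover have "(\<Sum>k. s k) < r" using cs(3) assms by linarith
  ultimately have "(\<forall>k. s k > 0) \<and> summable s \<and> (\<Sum>k. s k) < r \<and> 1 \<in> K \<and> normal_algebra K (R_alg K) \<and>
      (\<forall>x\<in>K - {1}. strongly_regular_at K (R_alg K) x) \<and> \<not> strongly_regular_at K (R_alg K) 1 \<and>
      (\<forall>\<rho>1 \<rho>2. 0 \<le> \<rho>1 \<and> \<rho>1 < \<rho>2 \<longrightarrow> I_ideal K \<rho>2 \<subset> I_ideal K \<rho>1)"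
    using cs one strict reg normal_R_alg[OF K(1)] units unfolding KD by blast
  then show ?thesis unfolding Let_def K_def by blast
qed

end
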